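(* Let $\phi$ be a sign-normalized rank-two Drinfeld $\mathbf A$-module over $L$ with attached data $V=(\alpha,\beta)$, $h$, $\kappa$, $\lambda_1$. Put $E_1=\mathbf s_\phi$ and $E_2=h\,(\lambda_1\tau\mathbf s_\phi+(x+\gamma_1)\mathbf s_\phi)$. Then the $\tau$-action on $M_\phi$ is given by $$\tau\begin{pmatrix} E_1 \\ E_2 \end{pmatrix}=\frac1{\lambda_1}\begin{pmatrix} -(x+\gamma_1) & \frac1h \\ -C_1'^{(1)} & \frac1{x+\gamma_1}\Big(\lambda_1^{q+1}f_\alpha+\frac{C_1'^{(1)}}{h}\Big) \end{pmatrix}\begin{pmatrix} E_1 \\ E_2 \end{pmatrix},$$ where $\gamma_1=(\kappa^q+m+a_1)(m-\kappa)-\theta$ and $C_1'=y+(\kappa+a_1)(x-\alpha)-\beta$.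
   Context: Let $q$ be a prime power and $E: y^2+a_1xy+a_3y=x^3+a_2x^2+a_4x+a_6$ ($a_i\in\mathbb F_q$) an elliptic curve with point at infinity $\infty$; $\mathbf A=\mathbb F_q[x,y]$. Let $\mathbb K=\mathbb F_q(\theta,\eta)$ be an isomorphic copy of $\mathbb F_q(x,y)$ via $x\mapsto\theta,\ y\mapsto\eta$; $L\supseteq\mathbb K$ algebraically closed; $\xi=(\theta,\eta)\in E(L)$; $\mathbf A_L=L\otimes\mathbf A$; $\mathbf K_L$ its fraction field. $\dotplus$ is the group law, $P^\vee$ the inverse of $P$ (so $(a,b)^\vee=(a,b^\vee)$, $b^\vee=-b-a_1a-a_3$), $(a,b)^{(1)}=(a^q,b^q)$. For $g\in\mathbf K_L$, $g^{(1)}$ is obtained by raising coefficients in $L$ to the $q$-th power and fixing $x,y$. $D^{-1}\mathbf A_L=\bigcup_{k\ge0}\mathcal L(D+k\infty)$. $L\{\tau\}$: twisted polynomials, $\tau c=c^q\tau$. A sign-normalized rank-two Drinfeld $\mathbf A$-module is an $\mathbb F_q$-algebra homomorphism $\phi:\mathbf A\to L\{\tau\}$ with $\phi_x=\theta+g_1\tau+g_2\tau^2+g_3\tau^3+\tau^4$, $\phi_y=\eta+h_1\tau+\dots+h_5\tau^5+\tau^6$. Its Anderson motive is $M_\phi=L\{\tau\}\cdot\mathbf s_\phi$ (free of rank one over $L\{\tau\}$), with $a\cdot(\omega\mathbf s_\phi)=\omega\phi_a\mathbf s_\phi$ for $a\in\mathbf A$ and $\tau(gm)=g^{(1)}\tau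 m$; $\tau$ is extended to $\mathbf K_L\otimes_{\mathbf A_L} M_\phi$. Attached data: $V=(\alpha,\beta)\in E(L)$ satisfies $V\dotplus(V^{(1)})^\vee=\xi$; $m=\frac{\beta^q-\beta^\vee}{\alpha^q-\alpha}$ is the slope of the line through $\xi,V^{(1)},V^\vee$; $f_\alpha=\frac{y-\eta-m(x-\theta)}{x-\alpha}$. $V$ is attached to $\phi$ by $\wedge^2_{\mathbf A_L}M_\phi=V^{-1}\mathbf A_L\cdot S_0$ with $\tau S_0=-f_\alpha S_0$. Write $S_0=h\,\mathbf s_\phi\wedge\tau\mathbf s_\phi$ with $h\in\mathbf K_L$; $S_0$ is unique up to $\mathbb F_q^\times$ and is chosen so that $h$ has sign $1$ (leading coefficient at $\infty$, with $x,y$ of sign $1$). Then $(h)=V+\infty-\dot V-\ddot V$ with $\dot V\dotplus\ddot V=V$, and $\kappa$ is the slope of the line through $V^\vee,\dot V,\ddot V$, so $h=\frac{x-\alpha}{y-\beta^\vee-\kappa(x-\alpha)}$. There is a relation $C_2\tau^2\mathbf s_\phi=C_1\tau\mathbf s_\phi+C_0\mathbf s_\phi$ with $C_2\in\langle x^2,x,1\rangle_L$, $C_1\in\langle x^2,y,x,1\rangle_L$, $C_0\in\langle xy,x^2,y,x,1\rangle_L$, normalized so that $C_2$ is monic in $x^2$; $\lambda_1\in L^\times$ is the coefficient of $y$ in $C_1$. *)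

theory Defs
  imports
    "HOL-Computational_Algebra.Computational_Algebra"
    "HOL-Library.Poly_Mapping"
begin

section \<open>Weierstrass curves and their group law\<close>

record 'l weierstrass =
  a1 :: 'l
  a2 :: 'l
  a3 :: 'l
  a4 :: 'l
  a6 :: 'l

datatype 'l point = Infty | Aff 'l 'l

definition on_curve :: "'l::field weierstrass \<Rightarrow> 'l \<Rightarrow> 'l \<Rightarrow> bool" where
  "on_curve E a b \<longleftrightarrow>
     b\<^sup>2 + a1 E * a * b + a3 E * b = a ^ 3 + a2 E * a\<^sup>2 + a4 E * a + a6 E"

definition points :: "'l::field weierstrass \<Rightarrow> 'l point set" where
  "points E = insert Infty {Aff a b | a b. on_curve E a b}"

definition discriminant :: "'l::field weierstrass \<Rightarrow> 'l" where
  "discriminant E =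
    (let b2 = (a1 E)\<^sup>2 + 4 * a2 E;
         b4 = 2 * a4 E + a1 E * a3 E;
         b6 = (a3 E)\<^sup>2 + 4 * a6 E;
         b8 = (a1 E)\<^sup>2 * a6 E + 4 * a2 E * a6 E - a1 E * a3 E * a4 E + a2 E * (a3 E)\<^sup>2 - (a4 E)\<^sup>2
     in - (b2\<^sup>2) * b8 - 8 * b4 ^ 3 - 27 * b6\<^sup>2 + 9 * b2 * b4 * b6)"

definition neg_y :: "'l::field weierstrass \<Rightarrow> 'l \<Rightarrow> 'l \<Rightarrow> 'l" where
  "neg_y E a b = - b - a1 E * a - a3 E"

fun point_neg :: "'l::field weierstrass \<Rightarrow> 'l point \<Rightarrow> 'l point" where
  "point_neg E Infty = Infty"
| "point_neg E (Aff a b) = Aff a (neg_y E a b)"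

text \<open>The chord and tangent law; \<open>s\<close> is the slope of the chord or tangent.\<close>

fun point_add :: "'l::field weierstrass \<Rightarrow> 'l point \<Rightarrow> 'l point \<Rightarrow> 'l point" where
  "point_add E Infty Q = Q"
| "point_add E (Aff a b) Infty = Aff a b"
| "point_add E (Aff a b) (Aff c d) =
    (if a = c \<and> d = neg_y E a b then Infty
     else
       let s = (if a = c
                then (3 * a\<^sup>2 + 2 * a2 E * a + a4 E - a1 E * b) / (2 * b + a1 E * a + a3 E)
                else (d - b) / (c - a));
           r = s\<^sup>2 + a1 E * s - a2 E - a - c
       in Aff r (neg_y E r (b + s * (r - a))))"

fun point_frob :: "nat \<Rightarrow> 'l::field point \<Rightarrow> 'l point" where
  "point_frob q Infty = Infty"
| "point_frob q (Aff a b) = Aff (a ^ q) (b ^ q)"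

text \<open>
  For a power \<open>q\<close> of the characteristic of an algebraically closed field, this is its unique
  subfield with \<open>q\<close> elements.
\<close>

definition finite_subfield :: "nat \<Rightarrow> 'l::field set" where
  "finite_subfield q = {c. c ^ q = c}"

definition poly_over :: "'l::field set \<Rightarrow> 'l poly set" where
  "poly_over S = {u. \<forall>i. coeff u i \<in> S}"

definition elliptic_curve_over :: "'l::field set \<Rightarrow> 'l weierstrass \<Rightarrow> bool" where
  "elliptic_curve_over S E \<longleftrightarrow>
     a1 E \<in> S \<and> a2 E \<in> S \<and> a3 E \<in> S \<and> a4 E \<in> S \<and> a6 E \<in> S \<and> discriminant E \<noteq> 0"

text \<open>
  The point \<open>(\<theta>, \<eta>)\<close> is generic over \<open>\<F>\<^sub>q\<close>: the \<open>\<F>\<^sub>q\<close>-algebra map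
  \<open>\<F>\<^sub>q[x, y] \<rightarrow> L\<close>, \<open>x \<mapsto> \<theta>\<close>, \<open>y \<mapsto> \<eta>\<close> is well defined and injective, so that it extends to an
  isomorphism of \<open>\<F>\<^sub>q(x, y)\<close> with the subfield \<open>\<F>\<^sub>q(\<theta>, \<eta>)\<close> of \<open>L\<close>. The elements of
  \<open>\<F>\<^sub>q[x, y]\<close> are written uniquely as \<open>u(x) + v(x) y\<close>.
\<close>

definition generic_point :: "nat \<Rightarrow> 'l::field weierstrass \<Rightarrow> 'l \<Rightarrow> 'l \<Rightarrow> bool" where
  "generic_point q E \<theta> \<eta> \<longleftrightarrow>
     on_curve E \<theta> \<eta> \<and>
     (\<forall>u \<in> poly_over (finite_subfield q). \<forall>v \<in> poly_over (finite_subfield q).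
        poly u \<theta> + poly v \<theta> * \<eta> = 0 \<longrightarrow> u = 0 \<and> v = 0)"


section \<open>The function field\<close>

text \<open>
  The function field \<open>K\<^sub>L\<close> of \<open>E\<close> over \<open>L\<close> is a type \<open>'k\<close> together with the embedding of the
  constants and the two coordinate functions. The predicate \<open>function_field\<close> says
  that the subring generated by these data is \<open>L[x, y]\<close> modulo the Weierstrass equation
  (that is, \<open>L \<otimes> \<F>\<^sub>q[x, y]\<close>) and that \<open>'k\<close> is its fraction field; this determines the data up to
  unique isomorphism.
\<close>

record ('l, 'k) funfield =
  emb :: "'l \<Rightarrow> 'k"
  fx :: 'k
  fy :: 'k

definition elem :: "('l::field, 'k::field) funfield \<Rightarrow> 'l poly \<Rightarrow> 'l poly \<Rightarrow> 'k" where
  "elem F u v = poly (map_poly (emb F) u) (fx F) + poly (map_poly (emb F) v) (fx F) * fy F"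

definition coord_ring :: "('l::field, 'k::field) funfield \<Rightarrow> 'k set" where
  "coord_ring F = {elem F u v | u v. True}"

definition coord_ring_over :: "'l set \<Rightarrow> ('l::field, 'k::field) funfield \<Rightarrow> 'k set" where
  "coord_ring_over S F = {elem F u v | u v. u \<in> poly_over S \<and> v \<in> poly_over S}"

definition is_field_hom :: "('a::field \<Rightarrow> 'b::field) \<Rightarrow> bool" where
  "is_field_hom f \<longleftrightarrow>
     f 1 = 1 \<and> (\<forall>a b. f (a + b) = f a + f b) \<and> (\<forall>a b. f (a * b) = f a * f b)"

definition function_field :: "'l::field weierstrass \<Rightarrow> ('l, 'k::field) funfield \<Rightarrow> bool" where
  "function_field E F \<longleftrightarrow>
     is_field_hom (emb F) \<and>
     (fy F)\<^sup>2 + emb F (a1 E) * fx F * fy F + emb F (a3 E) * fy F =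
       fx F ^ 3 + emb F (a2 E) * (fx F)\<^sup>2 + emb F (a4 E) * fx F + emb F (a6 E) \<and>
     (\<forall>u v. elem F u v = 0 \<longrightarrow> u = 0 \<and> v = 0) \<and>
     (\<forall>g. \<exists>a \<in> coord_ring F. \<exists>b \<in> coord_ring F. b \<noteq> 0 \<and> g = a / b)"

text \<open>The twist \<open>g \<mapsto> g\<^sup>(\<^sup>1\<^sup>)\<close>, for curves with coefficients in \<open>\<F>\<^sub>q\<close>.\<close>

definition twist :: "nat \<Rightarrow> ('l::field, 'k::field) funfield \<Rightarrow> 'k \<Rightarrow> 'k" where
  "twist q F =
    (THE \<sigma>. is_field_hom \<sigma> \<and> (\<forall>c. \<sigma> (emb F c) = emb F (c ^ q)) \<and> \<sigma> (fx F) = fx F \<and> \<sigma> (fy F) = fy F)"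


section \<open>Orders, divisors and signs\<close>

text \<open>
  The pole order at infinity and the leading coefficient of \<open>u(x) + v(x) y\<close>, for \<open>x\<close> and \<open>y\<close>
  having poles of order 2 and 3 and leading coefficient 1.
\<close>

definition inf_degree :: "'l::field poly \<Rightarrow> 'l poly \<Rightarrow> nat" where
  "inf_degree u v = (if v = 0 then 2 * degree u else max (2 * degree u) (2 * degree v + 3))"

definition inf_lead_coeff :: "'l::field poly \<Rightarrow> 'l poly \<Rightarrow> 'l" where
  "inf_lead_coeff u v =
     (if v \<noteq> 0 \<and> 2 * degree u < 2 * degree v + 3 then lead_coeff v else lead_coeff u)"

definition sign :: "('l::field, 'k::field) funfield \<Rightarrow> 'k \<Rightarrow> 'l" where
  "sign F g =
    (THE c. \<exists>u v r s. elem F u v \<noteq> 0 \<and> elem F r s \<noteq> 0 \<and> g = elem F u v / elem F r s \<and>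
       c = inf_lead_coeff u v / inf_lead_coeff r s)"

fun local_ring :: "('l::field, 'k::field) funfield \<Rightarrow> 'l point \<Rightarrow> 'k set" where
  "local_ring F (Aff a b) =
     {elem F u v / elem F r s | u v r s. poly r a + poly s a * b \<noteq> 0}"
| "local_ring F Infty =
     {elem F u v / elem F r s | u v r s.
        elem F r s \<noteq> 0 \<and> (elem F u v = 0 \<or> inf_degree u v \<le> inf_degree r s)}"

definition local_unit :: "('l::field, 'k::field) funfield \<Rightarrow> 'l point \<Rightarrow> 'k \<Rightarrow> bool" where
  "local_unit F P g \<longleftrightarrow> g \<noteq> 0 \<and> g \<in> local_ring F P \<and> inverse g \<in> local_ring F P"

definition uniformizer :: "('l::field, 'k::field) funfield \<Rightarrow> 'l point \<Rightarrow> 'k \<Rightarrow> bool" where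
  "uniformizer F P t \<longleftrightarrow>
     t \<noteq> 0 \<and> t \<in> local_ring F P \<and> \<not> local_unit F P t \<and>
     (\<forall>g \<in> local_ring F P. \<not> local_unit F P g \<longrightarrow> (\<exists>g' \<in> local_ring F P. g = t * g'))"

text \<open>Meaningful for \<open>g \<noteq> 0\<close> only.\<close>

definition ord_at :: "('l::field, 'k::field) funfield \<Rightarrow> 'l point \<Rightarrow> 'k \<Rightarrow> int" where
  "ord_at F P g = (THE n. \<exists>t w. uniformizer F P t \<and> local_unit F P w \<and> g = t powi n * w)"

type_synonym 'l divisor = "'l point \<Rightarrow>\<^sub>0 int"

abbreviation pt :: "'l point \<Rightarrow> 'l divisor" where
  "pt P \<equiv> Poly_Mapping.single P 1"

definition has_divisor ::
  "'l::field weierstrass \<Rightarrow> ('l, 'k::field) funfield \<Rightarrow> 'k \<Rightarrow> 'l divisor \<Rightarrow> bool" where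
  "has_divisor E F g D \<longleftrightarrow>
     g \<noteq> 0 \<and> Poly_Mapping.keys D \<subseteq> points E \<and>
     (\<forall>P \<in> points E. ord_at F P g = Poly_Mapping.lookup D P)"

definition riemann_roch_space ::
  "'l::field weierstrass \<Rightarrow> ('l, 'k::field) funfield \<Rightarrow> 'l divisor \<Rightarrow> 'k set" where
  "riemann_roch_space E F D =
     {g. g = 0 \<or> (\<forall>P \<in> points E. ord_at F P g + Poly_Mapping.lookup D P \<ge> 0)}"

text \<open>The fractional ideal \<open>D\<^sup>-\<^sup>1 A\<^sub>L\<close>.\<close>

definition inverse_ideal ::
  "'l::field weierstrass \<Rightarrow> ('l, 'k::field) funfield \<Rightarrow> 'l divisor \<Rightarrow> 'k set" where
  "inverse_ideal E F D =
     (\<Union>k::nat. riemann_roch_space E F (D + Poly_Mapping.single Infty (int k)))"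


section \<open>Drinfeld modules and Anderson motives\<close>

text \<open>
  Elements of \<open>L{\<tau>}\<close> are represented by their coefficients, that is, \<open>\<Sum> c\<^sub>i \<tau>\<^sup>i\<close> by the
  element of \<open>'l poly\<close> with coefficients \<open>c\<^sub>i\<close>; the sum is that of polynomials, the product is
  determined by \<open>\<tau> c = c\<^sup>q \<tau>\<close>.
\<close>

definition tw_mult :: "nat \<Rightarrow> 'l::field poly \<Rightarrow> 'l poly \<Rightarrow> 'l poly" where
  "tw_mult q P Q =
     (\<Sum>i\<le>degree P. \<Sum>j\<le>degree Q. monom (coeff P i * coeff Q j ^ (q ^ i)) (i + j))"

definition tau :: "'l::field poly" where
  "tau = monom 1 1"

text \<open>Only the values of \<open>\<phi>\<close> on \<open>A = \<F>\<^sub>q[x, y] \<subseteq> 'k\<close> matter.\<close>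

definition drinfeld_module_rank2 ::
  "nat \<Rightarrow> ('l::field, 'k::field) funfield \<Rightarrow> 'l \<Rightarrow> 'l \<Rightarrow> ('k \<Rightarrow> 'l poly) \<Rightarrow> bool" where
  "drinfeld_module_rank2 q F \<theta> \<eta> \<phi> \<longleftrightarrow>
     (let A = coord_ring_over (finite_subfield q) F in
       (\<forall>c \<in> finite_subfield q. \<phi> (emb F c) = [:c:]) \<and>
       (\<forall>a \<in> A. \<forall>b \<in> A. \<phi> (a + b) = \<phi> a + \<phi> b) \<and>
       (\<forall>a \<in> A. \<forall>b \<in> A. \<phi> (a * b) = tw_mult q (\<phi> a) (\<phi> b))) \<and>
     (\<exists>g1 g2 g3. \<phi> (fx F) = [:\<theta>, g1, g2, g3, 1:]) \<and>
     (\<exists>h1 h2 h3 h4 h5. \<phi> (fy F) = [:\<eta>, h1, h2, h3, h4, h5, 1:])"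

text \<open>
  The Anderson motive \<open>M\<^sub>\<phi> = L{\<tau>} s\<^sub>\<phi>\<close> is identified with \<open>L{\<tau>}\<close>, \<open>\<omega> s\<^sub>\<phi>\<close> corresponding to
  \<open>\<omega>\<close>. The following is the action of \<open>u(x) + v(x) y\<close> in \<open>A\<^sub>L = L \<otimes> A\<close>: constants in \<open>L\<close> act by
  multiplication on the left, \<open>a \<in> A\<close> by multiplication with \<open>\<phi>\<^sub>a\<close> on the right.
\<close>

definition motive_act ::
  "nat \<Rightarrow> ('l::field, 'k::field) funfield \<Rightarrow> ('k \<Rightarrow> 'l poly) \<Rightarrow> 'l poly \<Rightarrow> 'l poly \<Rightarrow> 'l poly \<Rightarrow> 'l poly"
  where
  "motive_act q F \<phi> u v \<omega> =
     (\<Sum>i\<le>degree u. smult (coeff u i) (tw_mult q \<omega> (\<phi> (fx F ^ i)))) +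
     (\<Sum>i\<le>degree v. smult (coeff v i) (tw_mult q \<omega> (\<phi> (fx F ^ i * fy F))))"

text \<open>
  The vector space \<open>K\<^sub>L \<otimes> M\<^sub>\<phi>\<close> over \<open>K\<^sub>L\<close>, with canonical map \<open>\<iota>\<close> from \<open>M\<^sub>\<phi>\<close>, as the localization of
  \<open>M\<^sub>\<phi>\<close> at the nonzero elements of \<open>A\<^sub>L\<close>. It is determined up to unique isomorphism:
  \<open>\<iota>\<close> is \<open>A\<^sub>L\<close>-linear with kernel the torsion of \<open>M\<^sub>\<phi>\<close>, and every vector is
  a fraction.
\<close>

definition generic_fibre ::
  "nat \<Rightarrow> ('l::field, 'k::field) funfield \<Rightarrow> ('k \<Rightarrow> 'l poly) \<Rightarrow>
   ('k \<Rightarrow> 'm::ab_group_add \<Rightarrow> 'm) \<Rightarrow> ('l poly \<Rightarrow> 'm) \<Rightarrow> bool" where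
  "generic_fibre q F \<phi> scale \<iota> \<longleftrightarrow>
     vector_space scale \<and> Modules.additive \<iota> \<and>
     (\<forall>u v \<omega>. \<iota> (motive_act q F \<phi> u v \<omega>) = scale (elem F u v) (\<iota> \<omega>)) \<and>
     (\<forall>\<omega>. \<iota> \<omega> = 0 \<longrightarrow> (\<exists>u v. elem F u v \<noteq> 0 \<and> motive_act q F \<phi> u v \<omega> = 0)) \<and>
     (\<forall>z. \<exists>d \<in> coord_ring F. \<exists>\<omega>. d \<noteq> 0 \<and> z = scale (inverse d) (\<iota> \<omega>))"

definition semilinear ::
  "('k \<Rightarrow> 'k) \<Rightarrow> ('k::field \<Rightarrow> 'm::ab_group_add \<Rightarrow> 'm) \<Rightarrow> ('m \<Rightarrow> 'm) \<Rightarrow> bool" where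
  "semilinear \<sigma> scale T \<longleftrightarrow> Modules.additive T \<and> (\<forall>g z. T (scale g z) = scale (\<sigma> g) (T z))"

definition alternating_bilinear ::
  "('k::field \<Rightarrow> 'm::ab_group_add \<Rightarrow> 'm) \<Rightarrow> ('k \<Rightarrow> 'w::ab_group_add \<Rightarrow> 'w) \<Rightarrow> ('m \<Rightarrow> 'm \<Rightarrow> 'w) \<Rightarrow> bool"
  where
  "alternating_bilinear scale scale2 B \<longleftrightarrow>
     (\<forall>z. Vector_Spaces.linear scale scale2 (B z)) \<and>
     (\<forall>z. Vector_Spaces.linear scale scale2 (\<lambda>y. B y z)) \<and>
     (\<forall>z. B z z = 0)"

text \<open>
  The exterior square by its universal property. It suffices to demand the factorization for
  scalar-valued forms: it makes the canonical map from the exterior square injective (its dual is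
  onto), and the condition on the span makes it surjective.
\<close>

definition exterior_square ::
  "('k::field \<Rightarrow> 'm::ab_group_add \<Rightarrow> 'm) \<Rightarrow> ('k \<Rightarrow> 'w::ab_group_add \<Rightarrow> 'w) \<Rightarrow> ('m \<Rightarrow> 'm \<Rightarrow> 'w) \<Rightarrow> bool"
  where
  "exterior_square scale scale2 wedge \<longleftrightarrow>
     vector_space scale2 \<and>
     alternating_bilinear scale scale2 wedge \<and>
     module.span scale2 {wedge y z | y z. True} = UNIV \<and>
     (\<forall>B. alternating_bilinear scale ((*) :: 'k \<Rightarrow> 'k \<Rightarrow> 'k) B \<longrightarrow>
        (\<exists>l. Vector_Spaces.linear scale2 (*) l \<and> (\<forall>y z. l (wedge y z) = B y z)))"

text \<open>
  The exterior square of \<open>M\<^sub>\<phi>\<close> over \<open>A\<^sub>L\<close>, as the lattice it spans in the exterior square of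
  \<open>K\<^sub>L \<otimes> M\<^sub>\<phi>\<close>. Since \<open>A\<^sub>L\<close> acts on the first factor, additive combinations
  are enough.
\<close>

definition wedge_lattice :: "('l::field poly \<Rightarrow> 'm) \<Rightarrow> ('m \<Rightarrow> 'm \<Rightarrow> 'w::ab_group_add) \<Rightarrow> 'w set" where
  "wedge_lattice \<iota> wedge = {\<Sum>i<n. wedge (\<iota> (\<omega> i)) (\<iota> (\<psi> i)) | (n::nat) \<omega> \<psi>. True}"

end

theory Submission
  imports Defs
begin

text \<open>
  Write \<open>\<tau>\<^sup>2 s = a \<tau> s + b s\<close> with \<open>a = C1 / C2\<close> and \<open>b = C0 / C2\<close>. The first row of the matrix is
  the definition of \<open>E2\<close>, solved for \<open>\<tau> s\<close>. Comparing coefficients of \<open>s\<close> and \<open>\<tau> s\<close>, which are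
  linearly independent (\<open>independent_s_\<tau>s\<close>), the second row amounts to the two equations
    \<open>h\<^sup>(\<^sup>1\<^sup>) b = f h\<close> and
    \<open>(x + \<gamma>1) h\<^sup>(\<^sup>1\<^sup>) (lam1\<^sup>q a + x + \<gamma>1\<^sup>q) = lam1\<^sup>q\<^sup>+\<^sup>1 f h + C1'\<^sup>(\<^sup>1\<^sup>)\<close>
  in the function field. The first one is the equation \<open>\<tau> S0 = - f S0\<close>.

  For the second one all functions are made explicit in terms of the line \<open>y - l(x)\<close> with slope
  \<open>\<kappa>\<close>. Its product with \<open>h\<close> has no affine poles and equals \<open>x - \<alpha>\<close> (\<open>function_of_line_divisor\<close>; it
  is for this that the orders at all points of the smooth curve are studied). The function \<open>C1'\<close>
  defines the image of the line under negation, and \<open>h = C1' / N\<close> for a monic quadratic polynomial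
  \<open>N\<close> in \<open>x\<close>. As the chord of slope \<open>m\<close> and the twist of the line pass through opposite points,
  \<open>f h / h\<^sup>(\<^sup>1\<^sup>)\<close> simplifies (\<open>chord_times_twisted_line\<close>), and the first equation becomes
  \<open>b = (x + \<gamma>1) h - \<mu>\<close> with the constant \<open>\<mu> = \<kappa>\<^sup>q + m + a1\<close>.

  The structure of the motive determines \<open>a\<close> and \<open>C2\<close>. Counting degrees in \<open>\<tau>\<close>, every element of
  it is a combination of \<open>s\<close> and \<open>\<tau> s\<close> over the coordinate ring and of \<open>\<tau>\<^sup>2 s\<close> and \<open>\<tau>\<^sup>3 s\<close> over
  \<open>L\<close> (\<open>motive_normal_form\<close>). Because \<open>lam1\<close> is not zero, \<open>\<tau>\<^sup>3 s\<close> can be expressed by \<open>x \<tau>\<^sup>2 s\<close>,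
  so that \<open>s\<close>, \<open>\<tau> s\<close>, \<open>\<tau>\<^sup>2 s\<close> generate the motive. Since \<open>S0\<close> lies in its exterior square, \<open>h\<close> is
  a combination of \<open>1\<close>, \<open>a\<close>, \<open>b\<close> over the coordinate ring (\<open>wedge_lattice_elements\<close>). In
  particular common denominators of \<open>a\<close> and \<open>b\<close> are denominators of \<open>h\<close>. This gives \<open>C2 = N\<close>
  (\<open>c2_eq\<close>) and \<open>a = lam1 h + d2\<close> (\<open>a_eq\<close>). So \<open>E2\<close> is \<open>\<tau>\<^sup>2 s - d2 \<tau> s + \<mu> s\<close>, an element of the
  motive, and writing \<open>x \<tau>\<^sup>2 s\<close> in normal form yields the equations between polynomials in \<open>x\<close>
  from which the second equation is derived (\<open>tau_second_coefficient\<close>).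
\<close>

section \<open>The coordinate ring\<close>

text \<open>
  The Weierstrass equation in the form \<open>y\<^sup>2 = weier_cubic(x) - weier_lin(x) y\<close>, which reduces
  every product of coordinate functions to the normal form \<open>u(x) + v(x) y\<close>. Most identities below
  are proved by comparing the coefficients \<open>v\<close>.
\<close>

definition weier_cubic :: "'l::field weierstrass \<Rightarrow> 'l poly" where
  "weier_cubic E = [:a6 E, a4 E, a2 E, 1:]"

definition weier_lin :: "'l::field weierstrass \<Rightarrow> 'l poly" where
  "weier_lin E = [:a3 E, a1 E:]"

definition value_at :: "'l::field \<Rightarrow> 'l \<Rightarrow> 'l poly \<Rightarrow> 'l poly \<Rightarrow> 'l" where
  "value_at a b u v = poly u a + poly v a * b"

lemma is_field_hom_simps:
  assumes "is_field_hom \<sigma>"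
  shows "\<sigma> 0 = 0" "\<sigma> 1 = 1" "\<sigma> (a + b) = \<sigma> a + \<sigma> b" "\<sigma> (a * b) = \<sigma> a * \<sigma> b"
    "\<sigma> (- a) = - \<sigma> a" "\<sigma> (a - b) = \<sigma> a - \<sigma> b" "\<sigma> (a / b) = \<sigma> a / \<sigma> b"
    "\<sigma> (a ^ n) = \<sigma> a ^ n" "\<sigma> a = 0 \<longleftrightarrow> a = 0"
proof -
  have add: "\<sigma> (a + b) = \<sigma> a + \<sigma> b" and mult: "\<sigma> (a * b) = \<sigma> a * \<sigma> b" and one: "\<sigma> 1 = 1"
    for a b using assms unfolding is_field_hom_def by auto
  have "\<sigma> 0 + \<sigma> 0 = \<sigma> 0 + 0" using add[of 0 0] by simp
  then show zero: "\<sigma> 0 = 0" by (rule add_left_imp_eq)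
  show "\<sigma> 1 = 1" "\<sigma> (a + b) = \<sigma> a + \<sigma> b" "\<sigma> (a * b) = \<sigma> a * \<sigma> b" by fact+
  have neg: "\<sigma> (- b) = - \<sigma> b" for b
    using add[of b "- b"] zero by (simp add: eq_neg_iff_add_eq_0 add.commute)
  show "\<sigma> (- a) = - \<sigma> a" by (rule neg)
  show "\<sigma> (a - b) = \<sigma> a - \<sigma> b" using add[of a "- b"] neg by simp
  show "\<sigma> (a ^ n) = \<sigma> a ^ n" by (induction n) (auto simp: one mult)
  have nz: "\<sigma> b \<noteq> 0" if "b \<noteq> 0" for b
  proof
    assume "\<sigma> b = 0"
    then have "\<sigma> (b * inverse b) = 0" by (simp add: mult)
    then show False using that one by simp
  qed
  show "\<sigma> a = 0 \<longleftrightarrow> a = 0" using nz zero by auto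
  show "\<sigma> (a / b) = \<sigma> a / \<sigma> b"
  proof (cases "b = 0")
    case False
    have "\<sigma> (a / b) * \<sigma> b = \<sigma> a" using mult[of "a / b" b] False by simp
    then show ?thesis using nz[OF False] by (simp add: field_simps)
  qed (simp add: zero)
qed

locale weierstrass_field =
  fixes E :: "'l::alg_closed_field weierstrass" and F :: "('l, 'k::field) funfield"
  assumes function_field: "function_field E F"
begin

lemma emb_hom: "is_field_hom (emb F)"
  using function_field unfolding function_field_def by blast

lemmas emb_simps = is_field_hom_simps[OF emb_hom]

definition px :: "'l poly \<Rightarrow> 'k" where
  "px u = poly (map_poly (emb F) u) (fx F)"

abbreviation X :: 'k where "X \<equiv> fx F"
abbreviation Y :: 'k where "Y \<equiv> fy F"
abbreviation el :: "'l poly \<Rightarrow> 'l poly \<Rightarrow> 'k" where "el \<equiv> elem F"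

lemma el_px: "el u v = px u + px v * Y"
  by (simp add: elem_def px_def)

lemma px_pCons [simp]: "px (pCons c u) = emb F c + X * px u"
  by (simp add: px_def map_poly_pCons emb_simps)

lemma px_0 [simp]: "px 0 = 0"
  by (simp add: px_def)

lemma px_1 [simp]: "px 1 = 1"
  by (simp add: one_pCons emb_simps)

lemma px_add: "px (u + v) = px u + px v"
  by (induction u v rule: poly_induct2) (auto simp: emb_simps algebra_simps)

lemma px_smult: "px (smult c u) = emb F c * px u"
  by (induction u) (auto simp: emb_simps algebra_simps)

lemma px_mult: "px (u * v) = px u * px v"
  by (induction u) (auto simp: px_add px_smult emb_simps algebra_simps)

lemma px_minus: "px (- u) = - px u"
  using px_smult[of "- 1" u] by (simp add: emb_simps)

lemma px_diff: "px (u - v) = px u - px v"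
  using px_add[of u "- v"] by (simp add: px_minus)

lemma px_power: "px (u ^ n) = px u ^ n"
  by (induction n) (auto simp: px_mult)

lemmas px_simps = px_add px_mult px_minus px_diff px_smult px_power

lemma el_eq_0_iff: "el u v = 0 \<longleftrightarrow> u = 0 \<and> v = 0"
  using function_field unfolding function_field_def by (auto simp: el_px)

lemma el_eq_iff: "el u v = el r s \<longleftrightarrow> u = r \<and> v = s"
proof -
  have "el u v - el r s = el (u - r) (v - s)" by (simp add: el_px px_simps algebra_simps)
  then show ?thesis using el_eq_0_iff[of "u - r" "v - s"] by auto
qed

lemma px_eq_0_iff: "px u = 0 \<longleftrightarrow> u = 0"
  using el_eq_0_iff[of u 0] by (simp add: el_px)

lemma weierstrass_eq: "Y\<^sup>2 = px (weier_cubic E) - px (weier_lin E) * Y"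
proof -
  have "Y\<^sup>2 + emb F (a1 E) * X * Y + emb F (a3 E) * Y =
       X ^ 3 + emb F (a2 E) * X\<^sup>2 + emb F (a4 E) * X + emb F (a6 E)"
    using function_field unfolding function_field_def by blast
  then show ?thesis
    by (simp add: weier_cubic_def weier_lin_def emb_simps) (simp add: algebra_simps power2_eq_square power3_eq_cube eq_diff_eq)
qed

lemma el_mult:
  "el u v * el r s =
     el (u * r + v * s * weier_cubic E) (u * s + v * r - v * s * weier_lin E)"
proof -
  have "el u v * el r s = px u * px r + (px u * px s + px v * px r) * Y + px v * px s * Y\<^sup>2"
    by (simp add: el_px algebra_simps power2_eq_square)
  also have "\<dots> = el (u * r + v * s * weier_cubic E) (u * s + v * r - v * s * weier_lin E)"
    by (simp only: weierstrass_eq el_px px_simps) (simp add: algebra_simps)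
  finally show ?thesis .
qed

lemma coord_ring_iff: "g \<in> coord_ring F \<longleftrightarrow> (\<exists>u v. g = el u v)"
  by (auto simp: coord_ring_def)

lemma coord_ring_closed [simp]:
  "el u v \<in> coord_ring F" "px u \<in> coord_ring F" "emb F c \<in> coord_ring F" "X \<in> coord_ring F"
  "Y \<in> coord_ring F" "0 \<in> coord_ring F" "1 \<in> coord_ring F"
proof -
  have px_in: "px u \<in> coord_ring F" for u
  proof -
    have "px u = el u 0" by (simp add: el_px)
    then show ?thesis unfolding coord_ring_iff by blast
  qed
  show "px u \<in> coord_ring F" by (rule px_in)
  show "el u v \<in> coord_ring F" by (auto simp: coord_ring_def)
  show "emb F c \<in> coord_ring F" "0 \<in> coord_ring F" "1 \<in> coord_ring F" "X \<in> coord_ring F"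
    using px_in[of "[:c:]"] px_in[of 0] px_in[of 1] px_in[of "[:0, 1:]"] by (auto simp: emb_simps)
  show "Y \<in> coord_ring F"
  proof -
    have "Y = el 0 1" by (simp add: el_px)
    then show ?thesis unfolding coord_ring_iff by blast
  qed
qed

lemma coord_ring_mult [simp]:
  "g \<in> coord_ring F \<Longrightarrow> k \<in> coord_ring F \<Longrightarrow> g * k \<in> coord_ring F"
  unfolding coord_ring_iff using el_mult by metis

lemma coord_ring_minus [simp]: "g \<in> coord_ring F \<Longrightarrow> - g \<in> coord_ring F"
proof -
  have "- el u v = el (- u) (- v)" for u v by (simp add: el_px px_simps)
  then show "g \<in> coord_ring F \<Longrightarrow> - g \<in> coord_ring F" unfolding coord_ring_iff by metis
qed

lemma coord_ring_add [simp]: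
  "g \<in> coord_ring F \<Longrightarrow> k \<in> coord_ring F \<Longrightarrow> g + k \<in> coord_ring F"
proof -
  have "el u v + el r s = el (u + r) (v + s)" for u v r s by (simp add: el_px px_simps algebra_simps)
  then show "g \<in> coord_ring F \<Longrightarrow> k \<in> coord_ring F \<Longrightarrow> g + k \<in> coord_ring F"
    unfolding coord_ring_iff by metis
qed

lemma coord_ring_diff [simp]:
  "g \<in> coord_ring F \<Longrightarrow> k \<in> coord_ring F \<Longrightarrow> g - k \<in> coord_ring F"
  using coord_ring_add[of g "- k"] by simp

lemma coord_ring_power [simp]: "g \<in> coord_ring F \<Longrightarrow> g ^ n \<in> coord_ring F"
  by (induction n) auto

lemma fraction_el: obtains u v r s where "g = el u v / el r s" "el r s \<noteq> 0"
  using function_field unfolding function_field_def by (metis (no_types) coord_ring_iff)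

text \<open>Multiplying with the conjugate of the denominator makes it a polynomial in \<open>x\<close>.\<close>

lemma fraction_px: obtains u v d where "d \<noteq> 0" "px d * g = el u v"
proof -
  obtain u v r s where g: "g = el u v / el r s" and nz: "el r s \<noteq> 0" by (rule fraction_el)
  define c where "c = el (r - s * weier_lin E) (- s)"
  have c0: "c \<noteq> 0"
    using nz unfolding c_def el_eq_0_iff by auto
  define d where "d = r * (r - s * weier_lin E) - s * s * weier_cubic E"
  have "el r s * c = el d 0" unfolding c_def el_mult d_def el_eq_iff by (simp add: algebra_simps)
  then have d: "el r s * c = px d" by (simp add: el_px)
  have "px d \<noteq> 0" using d nz c0 by (metis mult_eq_0_iff)
  then have d0: "d \<noteq> 0" by auto
  have "px d * g = el u v * c" using nz unfolding d[symmetric] g by simp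
  then obtain u' v' where "px d * g = el u' v'" unfolding c_def el_mult by blast
  then show thesis using that d0 by blast
qed

text \<open>
  Substituting \<open>x = t\<^sup>2\<close>, \<open>y = t\<^sup>3\<close> is multiplicative up to terms of lower degree in \<open>t\<close>, since the
  cuspidal cubic \<open>y\<^sup>2 = x\<^sup>3\<close> is the top degree part of the Weierstrass equation for the weights 2 and
  3; degree and leading coefficient in \<open>t\<close> are those at infinity.
\<close>

definition cusp :: "'l poly \<Rightarrow> 'l poly \<Rightarrow> 'l poly" where
  "cusp u v = pcompose u [:0, 0, 1:] + pcompose v [:0, 0, 1:] * [:0, 0, 0, 1:]"

lemma degree_sq_pcompose: "degree (pcompose u [:0, 0, 1::'l:]) = 2 * degree u"
  by (simp add: degree_pcompose)

lemma lead_coeff_sq_pcompose: "lead_coeff (pcompose u [:0, 0, 1::'l:]) = lead_coeff u"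
  by (subst lead_coeff_comp) auto

lemma degree_sq_pcompose_cube:
  assumes "v \<noteq> 0"
  shows "degree (pcompose v [:0, 0, 1::'l:] * [:0, 0, 0, 1:]) = 2 * degree v + 3"
proof -
  have "pcompose v [:0, 0, 1:] \<noteq> 0" using lead_coeff_sq_pcompose[of v] assms by auto
  then have "degree (pcompose v [:0, 0, 1:] * [:0, 0, 0, 1:]) =
      degree (pcompose v [:0, 0, 1:]) + degree [:0, 0, 0, 1::'l:]"
    by (rule degree_mult_eq) simp
  then show ?thesis by (simp only: degree_sq_pcompose) simp
qed

lemma degree_lead_coeff_cusp:
  assumes "u \<noteq> 0 \<or> v \<noteq> 0"
  shows "degree (cusp u v) = inf_degree u v" "lead_coeff (cusp u v) = inf_lead_coeff u v"
    "cusp u v \<noteq> 0"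
proof -
  let ?p = "pcompose u [:0, 0, 1:]" and ?q = "pcompose v [:0, 0, 1:] * [:0, 0, 0, 1:]"
  have lq: "lead_coeff ?q = lead_coeff v"
    by (subst lead_coeff_mult) (simp add: lead_coeff_sq_pcompose)
  have "degree (cusp u v) = inf_degree u v \<and> lead_coeff (cusp u v) = inf_lead_coeff u v"
  proof (cases "v = 0")
    case True
    then show ?thesis
      using degree_sq_pcompose[of u] lead_coeff_sq_pcompose[of u]
      by (simp add: cusp_def inf_degree_def inf_lead_coeff_def)
  next
    case False
    have dp: "degree ?p = 2 * degree u" by (rule degree_sq_pcompose)
    have dq: "degree ?q = 2 * degree v + 3" by (rule degree_sq_pcompose_cube[OF False])
    have "2 * degree u \<noteq> 2 * degree v + 3" by presburger
    then consider "2 * degree u < 2 * degree v + 3" | "2 * degree u > 2 * degree v + 3" by linarith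
    then show ?thesis
    proof cases
      case 1
      then have "degree ?p < degree ?q" using dp dq by simp
      then show ?thesis
        using 1 False dq lq degree_add_eq_right[of ?p ?q] lead_coeff_add_le[of ?p ?q]
        unfolding cusp_def inf_degree_def inf_lead_coeff_def by auto
    next
      case 2
      then have "degree ?q < degree ?p" using dp dq by simp
      then show ?thesis
        using 2 False dp lead_coeff_sq_pcompose[of u] degree_add_eq_left[of ?q ?p]
          lead_coeff_add_le[of ?q ?p]
        unfolding cusp_def inf_degree_def inf_lead_coeff_def by (auto simp: add.commute)
    qed
  qed
  then show 1: "degree (cusp u v) = inf_degree u v" "lead_coeff (cusp u v) = inf_lead_coeff u v"
    by auto
  have "inf_lead_coeff u v \<noteq> 0"
    using assms unfolding inf_lead_coeff_def by (auto split: if_splits)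
  then show "cusp u v \<noteq> 0" using 1 by auto
qed

lemma inf_mult:
  assumes "u \<noteq> 0 \<or> v \<noteq> 0" "r \<noteq> 0 \<or> s \<noteq> 0" and prod: "el u v * el r s = el p q"
  shows "inf_degree p q = inf_degree u v + inf_degree r s"
    "inf_lead_coeff p q = inf_lead_coeff u v * inf_lead_coeff r s"
    "p \<noteq> 0 \<or> q \<noteq> 0"
proof -
  let ?c = "\<lambda>w. pcompose w [:0, 0, 1::'l:]"
  have pq: "p = u * r + v * s * weier_cubic E" "q = u * s + v * r - v * s * weier_lin E"
    using prod unfolding el_mult el_eq_iff by auto
  show nz: "p \<noteq> 0 \<or> q \<noteq> 0"
    using prod assms(1,2) el_eq_0_iff by (metis mult_eq_0_iff)
  define d where "d = ?c (v * s) * [:a6 E, 0, a4 E, - a3 E, a2 E, - a1 E:]"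
  have cusp: "cusp p q = cusp u v * cusp r s + d"
  proof -
    let ?t3 = "[:0, 0, 0, 1:]"
    have "?c (weier_cubic E) - ?c (weier_lin E) * ?t3 - ?t3 * ?t3 =
        [:a6 E, 0, a4 E, - a3 E, a2 E, - a1 E:]"
      unfolding weier_cubic_def weier_lin_def by (simp add: pcompose_pCons)
    then have d: "d = ?c v * ?c s * (?c (weier_cubic E) - ?c (weier_lin E) * ?t3 - ?t3 * ?t3)"
      unfolding d_def pcompose_mult by simp
    show ?thesis
      unfolding cusp_def pq d pcompose_mult pcompose_add pcompose_diff
      by algebra
  qed
  have prod_nz: "cusp u v * cusp r s \<noteq> 0" and
    dprod: "degree (cusp u v * cusp r s) = inf_degree u v + inf_degree r s"
    using degree_lead_coeff_cusp[OF assms(1)] degree_lead_coeff_cusp[OF assms(2)]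
    by (auto simp: degree_mult_eq)
  have "cusp p q = cusp u v * cusp r s \<or> degree d < degree (cusp u v * cusp r s)"
  proof (cases "v * s = 0")
    case True
    then have "d = 0" unfolding d_def by (simp only: pcompose_0 mult_zero_left)
    then show ?thesis using cusp by simp
  next
    case False
    have "degree d \<le> degree (?c (v * s)) + degree [:a6 E, 0, a4 E, - a3 E, a2 E, - a1 E:]"
      unfolding d_def by (rule degree_mult_le)
    also have "\<dots> \<le> 2 * degree (v * s) + 5"
      by (rule add_mono) (simp add: degree_pcompose, simp)
    also have "\<dots> < inf_degree u v + inf_degree r s"
      using False by (auto simp: degree_mult_eq inf_degree_def)
    finally show ?thesis unfolding dprod by blast
  qed
  then have "degree (cusp p q) = degree (cusp u v * cusp r s) \<and>
      lead_coeff (cusp p q) = lead_coeff (cusp u v * cusp r s)"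
    using cusp degree_add_eq_left[of d "cusp u v * cusp r s"]
      lead_coeff_add_le[of d "cusp u v * cusp r s"] by (auto simp: add.commute)
  then show "inf_degree p q = inf_degree u v + inf_degree r s"
    "inf_lead_coeff p q = inf_lead_coeff u v * inf_lead_coeff r s"
    using dprod degree_lead_coeff_cusp[OF assms(1)] degree_lead_coeff_cusp[OF assms(2)]
      degree_lead_coeff_cusp[OF nz] lead_coeff_mult[of "cusp u v" "cusp r s"] by auto
qed

lemma inf_cross:
  assumes "el u v * el r s = el u' v' * el r' s'"
    and "el u v \<noteq> 0" "el r s \<noteq> 0" "el u' v' \<noteq> 0" "el r' s' \<noteq> 0"
  shows "inf_degree u v + inf_degree r s = inf_degree u' v' + inf_degree r' s'"
    and "inf_lead_coeff u v * inf_lead_coeff r s = inf_lead_coeff u' v' * inf_lead_coeff r' s'"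
proof -
  have "u \<noteq> 0 \<or> v \<noteq> 0" "r \<noteq> 0 \<or> s \<noteq> 0" "u' \<noteq> 0 \<or> v' \<noteq> 0" "r' \<noteq> 0 \<or> s' \<noteq> 0"
    using assms(2-) el_eq_0_iff by auto
  moreover obtain p q where pq: "el u v * el r s = el p q" "el u' v' * el r' s' = el p q"
    using assms(1) el_mult by metis
  ultimately show "inf_degree u v + inf_degree r s = inf_degree u' v' + inf_degree r' s'"
    "inf_lead_coeff u v * inf_lead_coeff r s = inf_lead_coeff u' v' * inf_lead_coeff r' s'"
    using inf_mult[of u v r s p q] inf_mult[of u' v' r' s' p q] by auto
qed

lemma sign_fraction:
  assumes "el u v \<noteq> 0" "el r s \<noteq> 0"
  shows "sign F (el u v / el r s) = inf_lead_coeff u v / inf_lead_coeff r s"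
  unfolding sign_def
proof (rule the_equality)
  show "\<exists>u' v' r' s'. el u' v' \<noteq> 0 \<and> el r' s' \<noteq> 0 \<and> el u v / el r s = el u' v' / el r' s' \<and>
     inf_lead_coeff u v / inf_lead_coeff r s = inf_lead_coeff u' v' / inf_lead_coeff r' s'"
    using assms by blast
next
  fix c
  assume "\<exists>u' v' r' s'. el u' v' \<noteq> 0 \<and> el r' s' \<noteq> 0 \<and> el u v / el r s = el u' v' / el r' s' \<and>
     c = inf_lead_coeff u' v' / inf_lead_coeff r' s'"
  then obtain u' v' r' s' where *: "el u' v' \<noteq> 0" "el r' s' \<noteq> 0"
      "el u v / el r s = el u' v' / el r' s'" "c = inf_lead_coeff u' v' / inf_lead_coeff r' s'"
    by blast
  have "el u v * el r' s' = el u' v' * el r s" using * assms by (simp add: field_simps)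
  then have "inf_lead_coeff u v * inf_lead_coeff r' s' = inf_lead_coeff u' v' * inf_lead_coeff r s"
    using inf_cross(2) * assms by blast
  moreover have "inf_lead_coeff r s \<noteq> 0" "inf_lead_coeff r' s' \<noteq> 0"
    using assms * el_eq_0_iff degree_lead_coeff_cusp by (metis leading_coeff_0_iff)+
  ultimately show "c = inf_lead_coeff u v / inf_lead_coeff r s"
    using *(4) by (simp add: frac_eq_eq mult.commute)
qed

end

section \<open>Orders at the points of the curve\<close>

text \<open>
  The orders at a point are meaningful once the local ring has a uniformizer of which every
  nonzero function is a power up to a unit. The first locale has what is needed to prove that this
  is so, the second one (\<open>place\<close>) assumes it.
\<close>

locale uniformized_ring =
  fixes F :: "('l::field, 'k::field) funfield" and P :: "'l point" and t :: 'k
  assumes uniformizer: "uniformizer F P t"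
    and one_in: "1 \<in> local_ring F P"
    and mult_in: "a \<in> local_ring F P \<Longrightarrow> b \<in> local_ring F P \<Longrightarrow> a * b \<in> local_ring F P"
begin

abbreviation "unit \<equiv> local_unit F P"

lemma unit_one: "unit 1"
  using one_in by (simp add: local_unit_def)

lemma unit_mult: "unit a \<Longrightarrow> unit b \<Longrightarrow> unit (a * b)"
  unfolding local_unit_def using mult_in by (auto simp: inverse_mult_distrib)

lemma unit_inverse: "unit a \<Longrightarrow> unit (inverse a)"
  unfolding local_unit_def by auto

lemma unit_power: "unit a \<Longrightarrow> unit (a ^ n)"
  by (induction n) (auto intro: unit_one unit_mult)

lemma unit_powi: "unit a \<Longrightarrow> unit (a powi n)"
  by (auto simp: power_int_def intro: unit_power unit_inverse)

lemma power_in: "a \<in> local_ring F P \<Longrightarrow> a ^ n \<in> local_ring F P"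
  by (induction n) (auto intro: one_in mult_in)

lemma t_not_unit_power:
  assumes "k > 0" shows "\<not> unit (t ^ k)"
proof
  assume u: "unit (t ^ k)"
  have t: "t \<noteq> 0" "t \<in> local_ring F P" "\<not> unit t"
    using uniformizer by (auto simp: uniformizer_def)
  have "t ^ k = t * t ^ (k - 1)" using assms by (metis power_eq_if not_gr_zero)
  then have "inverse t = t ^ (k - 1) * inverse (t ^ k)" using t(1) by simp
  then have "inverse t \<in> local_ring F P"
    using u t(2) power_in mult_in by (auto simp: local_unit_def)
  then show False using t by (auto simp: local_unit_def)
qed

lemma t_powi_unit_iff: "unit (t powi n) \<longleftrightarrow> n = 0"
proof
  assume u: "unit (t powi n)"
  show "n = 0"
  proof (rule ccontr)
    assume "n \<noteq> 0"
    then consider "n > 0" | "n < 0" by linarith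
    then show False
    proof cases
      case 1
      then show False using u t_not_unit_power[of "nat n"] by (simp add: power_int_def)
    next
      case 2
      then have "unit (inverse (t ^ nat (- n)))" using u by (simp add: power_int_def power_inverse)
      then have "unit (t ^ nat (- n))" using unit_inverse by fastforce
      then show False using t_not_unit_power[of "nat (- n)"] 2 by simp
    qed
  qed
qed (simp add: unit_one)

text \<open>
  Any two uniformizers divide each other, so they differ by a unit, and a power of a uniformizer
  is a unit only if the exponent is zero.
\<close>

lemma ord_at_eq:
  assumes w: "unit w"
  shows "ord_at F P (t powi n * w) = n"
  unfolding ord_at_def
proof (rule the_equality)
  show "\<exists>t' w'. uniformizer F P t' \<and> unit w' \<and> t powi n * w = t' powi n * w'"
    using w uniformizer by blast
next
  fix n'
  assume "\<exists>t' w'. uniformizer F P t' \<and> unit w' \<and> t powi n * w = t' powi n' * w'"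
  then obtain t' w' where t': "uniformizer F P t'" and w': "unit w'"
    and eq: "t powi n * w = t' powi n' * w'" by blast
  obtain g' where g': "g' \<in> local_ring F P" "t' = t * g'"
    using t' uniformizer unfolding uniformizer_def by blast
  obtain g'' where g'': "g'' \<in> local_ring F P" "t = t' * g''"
    using t' uniformizer unfolding uniformizer_def by blast
  have t0: "t \<noteq> 0" "t' \<noteq> 0" using t' uniformizer unfolding uniformizer_def by auto
  have "t = t * g' * g''" using g''(2) unfolding g'(2) .
  then have g1: "g' * g'' = 1" using t0(1) by (simp add: mult.assoc)
  then have "inverse g' = g''" by (rule inverse_unique)
  moreover have "g' \<noteq> 0" using g1 by auto
  ultimately have "unit g'" using g'(1) g''(1) by (simp add: local_unit_def)
  then have u: "unit (g' powi n' * w' * inverse w)"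
    by (intro unit_mult unit_inverse unit_powi w w')
  have "t powi (n - n') = g' powi n' * w' * inverse w"
  proof -
    have "w \<noteq> 0" using w by (simp add: local_unit_def)
    moreover have "t powi n * w = t powi n' * (g' powi n' * w')"
      using eq unfolding g'(2) power_int_mult_distrib by simp
    ultimately show ?thesis using t0(1) by (simp add: power_int_diff divide_simps)
  qed
  then show "n' = n" using u t_powi_unit_iff[of "n - n'"] by simp
qed

lemma ord_at_unit: "unit w \<Longrightarrow> ord_at F P w = 0"
  using ord_at_eq[of w 0] by simp

text \<open>
  Dividing by \<open>t\<close> as long as the quotient is not a unit must end.
\<close>

lemma decompose_if_bounded:
  assumes g: "g \<in> local_ring F P"
    and bound: "\<And>k g'. g' \<in> local_ring F P \<Longrightarrow> g = t ^ k * g' \<Longrightarrow> k \<le> N"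
  shows "\<exists>n w. unit w \<and> g = t ^ n * w"
proof (rule ccontr)
  assume no: "\<not> ?thesis"
  have "\<exists>g' \<in> local_ring F P. g = t ^ k * g'" for k
  proof (induction k)
    case 0
    then show ?case using g by auto
  next
    case (Suc k)
    then obtain g' where g': "g' \<in> local_ring F P" "g = t ^ k * g'" by blast
    then have "\<not> unit g'" using no by blast
    then obtain g'' where "g'' \<in> local_ring F P" "g' = t * g''"
      using g'(1) uniformizer unfolding uniformizer_def by blast
    then show ?case using g'(2) by (intro bexI[of _ g'']) (auto simp: mult_ac)
  qed
  then show False using bound[of _ "Suc N"] by fastforce
qed

end

locale place = uniformized_ring +
  assumes decompose: "g \<noteq> 0 \<Longrightarrow> \<exists>n w. local_unit F P w \<and> g = t powi n * w"
begin

lemma ord_at_mult: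
  assumes "a \<noteq> 0" "b \<noteq> 0"
  shows "ord_at F P (a * b) = ord_at F P a + ord_at F P b"
proof -
  obtain n v where a: "unit v" "a = t powi n * v" using decompose[OF assms(1)] by blast
  obtain k w where b: "unit w" "b = t powi k * w" using decompose[OF assms(2)] by blast
  have t0: "t \<noteq> 0" using uniformizer unfolding uniformizer_def by auto
  have "t powi (n + k) = t powi n * t powi k" using t0 by (simp add: power_int_add)
  then have "a * b = t powi (n + k) * (v * w)" unfolding a b by (simp add: mult_ac)
  then have "ord_at F P (a * b) = n + k" using ord_at_eq[OF unit_mult[OF a(1) b(1)]] by simp
  then show ?thesis using a b ord_at_eq by simp
qed

lemma ord_at_nonneg_imp_in:
  assumes "a \<noteq> 0" "ord_at F P a \<ge> 0"
  shows "a \<in> local_ring F P"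
proof -
  obtain n v where a: "unit v" "a = t powi n * v" using decompose[OF assms(1)] by blast
  then have "n \<ge> 0" using assms ord_at_eq by simp
  then have "a = t ^ nat n * v" using a by (simp add: power_int_def)
  moreover have "t \<in> local_ring F P" using uniformizer unfolding uniformizer_def by auto
  ultimately show ?thesis using a power_in mult_in by (auto simp: local_unit_def)
qed

lemma ord_at_1: "ord_at F P 1 = 0"
  by (rule ord_at_unit[OF unit_one])

end

text \<open>
  A singular point expresses \<open>a3\<close>, \<open>a4\<close> and \<open>a6\<close> by the other coefficients and the coordinates,
  and the quantities \<open>b4\<close>, \<open>b6\<close>, \<open>b8\<close> become polynomials in \<open>a\<close> and \<open>b2\<close> only. This holds in all
  characteristics.
\<close>

lemma discriminant_eq_0_if_singular:
  fixes E :: "'l::field weierstrass"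
  assumes "on_curve E a b" "2 * b + a1 E * a + a3 E = 0"
    and "3 * a\<^sup>2 + 2 * a2 E * a + a4 E - a1 E * b = 0"
  shows "discriminant E = 0"
proof -
  have a3: "a3 E = - 2 * b - a1 E * a" using assms(2) by (simp add: algebra_simps eq_neg_iff_add_eq_0)
  have a4: "a4 E = a1 E * b - 3 * a\<^sup>2 - 2 * a2 E * a" using assms(3) by (simp add: algebra_simps eq_neg_iff_add_eq_0)
  have a6: "a6 E = b\<^sup>2 + a1 E * a * b + a3 E * b - a ^ 3 - a2 E * a\<^sup>2 - a4 E * a"
    using assms(1) unfolding on_curve_def by (simp add: algebra_simps)
  define b2 where "b2 = (a1 E)\<^sup>2 + 4 * a2 E"
  have b4: "2 * a4 E + a1 E * a3 E = - 6 * a\<^sup>2 - b2 * a"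
    unfolding b2_def a4 a3 by (simp add: algebra_simps power2_eq_square)
  have b6: "(a3 E)\<^sup>2 + 4 * a6 E = 8 * a ^ 3 + b2 * a\<^sup>2"
    unfolding b2_def a6 a4 a3 by (simp add: algebra_simps power2_eq_square power3_eq_cube)
  have b8: "(a1 E)\<^sup>2 * a6 E + 4 * a2 E * a6 E - a1 E * a3 E * a4 E + a2 E * (a3 E)\<^sup>2 - (a4 E)\<^sup>2
      = - 9 * a ^ 4 - a ^ 3 * b2"
    unfolding b2_def a6 a4 a3 by (simp add: algebra_simps power2_eq_square power3_eq_cube power4_eq_xxxx)
  show ?thesis
    unfolding discriminant_def Let_def b4 b6 b8 unfolding b2_def[symmetric]
    by (simp add: algebra_simps power2_eq_square power3_eq_cube power4_eq_xxxx)
qed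

context weierstrass_field begin

lemma value_at_mult:
  assumes "on_curve E a b" "el u v * el r s = el p q"
  shows "value_at a b p q = value_at a b u v * value_at a b r s"
proof -
  have pq: "p = u * r + v * s * weier_cubic E" "q = u * s + v * r - v * s * weier_lin E"
    using assms(2) unfolding el_mult el_eq_iff by auto
  have "poly (weier_cubic E) a = b\<^sup>2 + poly (weier_lin E) a * b"
    using assms(1) unfolding on_curve_def weier_cubic_def weier_lin_def
    by (simp add: algebra_simps power2_eq_square power3_eq_cube)
  then show ?thesis unfolding pq value_at_def by (simp add: algebra_simps power2_eq_square)
qed

lemma value_at_cross:
  assumes "on_curve E a b" "el u v * el r s = el u' v' * el r' s'"
  shows "value_at a b u v * value_at a b r s = value_at a b u' v' * value_at a b r' s'"
  using assms el_mult value_at_mult by metis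

lemma value_at_0 [simp]: "value_at a b 0 0 = 0"
  by (simp add: value_at_def)

lemma value_at_nonzero_imp: "value_at a b u v \<noteq> 0 \<Longrightarrow> el u v \<noteq> 0"
  using el_eq_0_iff by auto

lemma local_ring_AffI:
  assumes "value_at a b r s \<noteq> 0" "g * el r s = el u v"
  shows "g \<in> local_ring F (Aff a b)"
proof -
  have "g = el u v / el r s" using assms value_at_nonzero_imp by (simp add: eq_divide_eq)
  then show ?thesis using assms(1) unfolding local_ring.simps value_at_def by blast
qed

lemma local_ring_AffE:
  assumes "g \<in> local_ring F (Aff a b)"
  obtains u v r s where "value_at a b r s \<noteq> 0" "g * el r s = el u v"
proof -
  obtain u v r s where "g = el u v / el r s" "value_at a b r s \<noteq> 0"
    using assms by (auto simp: value_at_def)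
  then show thesis using that[of r s u v] value_at_nonzero_imp[of a b r s] by simp
qed

lemma el_in_local_ring_Aff: "el u v \<in> local_ring F (Aff a b)"
  by (rule local_ring_AffI[of a b 1 0 _ u v]) (simp_all add: value_at_def el_px)

lemma local_ring_Aff_mult:
  assumes "on_curve E a b" "g \<in> local_ring F (Aff a b)" "k \<in> local_ring F (Aff a b)"
  shows "g * k \<in> local_ring F (Aff a b)"
proof -
  obtain u v r s where 1: "value_at a b r s \<noteq> 0" "g * el r s = el u v"
    using assms(2) by (rule local_ring_AffE)
  obtain u' v' r' s' where 2: "value_at a b r' s' \<noteq> 0" "k * el r' s' = el u' v'"
    using assms(3) by (rule local_ring_AffE)
  obtain r2 s2 where rs: "el r s * el r' s' = el r2 s2" using el_mult by blast
  obtain u2 v2 where uv: "el u v * el u' v' = el u2 v2" using el_mult by blast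
  have "value_at a b r2 s2 \<noteq> 0" using value_at_mult[OF assms(1) rs] 1 2 by simp
  moreover have "g * k * el r2 s2 = el u2 v2"
    unfolding rs[symmetric] uv[symmetric] 1(2)[symmetric] 2(2)[symmetric] by simp
  ultimately show ?thesis by (rule local_ring_AffI)
qed

lemma local_unit_el:
  assumes "value_at a b u v \<noteq> 0"
  shows "local_unit F (Aff a b) (el u v)"
proof -
  have nz: "el u v \<noteq> 0" using assms by (rule value_at_nonzero_imp)
  then have "inverse (el u v) * el u v = el 1 0" by (simp add: el_px)
  then have "inverse (el u v) \<in> local_ring F (Aff a b)" using assms local_ring_AffI by blast
  then show ?thesis unfolding local_unit_def using nz el_in_local_ring_Aff by blast
qed

lemma el_local_unit_imp:
  assumes "on_curve E a b" "local_unit F (Aff a b) (el u v)"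
  shows "value_at a b u v \<noteq> 0"
proof -
  have "inverse (el u v) \<in> local_ring F (Aff a b)" "el u v \<noteq> 0"
    using assms(2) by (auto simp: local_unit_def)
  then obtain u' v' r s where 1: "value_at a b r s \<noteq> 0" "inverse (el u v) * el r s = el u' v'"
    by (metis local_ring_AffE)
  have "el u v * el u' v' = el r s" unfolding 1(2)[symmetric] using \<open>el u v \<noteq> 0\<close> by simp
  then show ?thesis using value_at_mult[OF assms(1)] 1 by fastforce
qed

text \<open>
  Up to sign, the product of \<open>y - b\<close> with its conjugate is \<open>x - a\<close> times a polynomial \<open>q\<close>, and \<open>q(a)\<close> is the
  value at \<open>(a, b)\<close> of a partial derivative of the Weierstrass equation.
\<close>

definition tangent_poly :: "'l \<Rightarrow> 'l \<Rightarrow> 'l poly" where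
  "tangent_poly a b = [:a4 E - a1 E * b + a * (a2 E + a), a2 E + a, 1:]"

lemma tangent_poly_eq:
  assumes "on_curve E a b"
  shows "(Y - emb F b) * el [:b + a3 E, a1 E:] 1 = (X - emb F a) * px (tangent_poly a b)"
proof -
  have "(Y - emb F b) * el [:b + a3 E, a1 E:] 1 = Y\<^sup>2 + px (weier_lin E) * Y - emb F (b\<^sup>2 + a3 E * b) - emb F (a1 E * b) * X"
    by (simp add: el_px weier_lin_def emb_simps algebra_simps power2_eq_square)
  also have "\<dots> = px (weier_cubic E - [:b\<^sup>2 + a3 E * b, a1 E * b:])"
    unfolding weierstrass_eq by (simp add: px_simps emb_simps algebra_simps)
  also have "weier_cubic E - [:b\<^sup>2 + a3 E * b, a1 E * b:] = [:- a, 1:] * tangent_poly a b"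
    using assms unfolding on_curve_def weier_cubic_def tangent_poly_def
    by (simp add: algebra_simps power2_eq_square power3_eq_cube)
  also have "px \<dots> = (X - emb F a) * px (tangent_poly a b)"
    unfolding px_mult by (simp add: emb_simps)
  finally show ?thesis .
qed

lemma tangent_poly_value: "poly (tangent_poly a b) a = 3 * a\<^sup>2 + 2 * a2 E * a + a4 E - a1 E * b"
  unfolding tangent_poly_def by (simp add: algebra_simps power2_eq_square)

lemma vanishing_el:
  assumes "value_at a b u v = 0"
  obtains r s where "el u v = (X - emb F a) * el r s + emb F (poly v a) * (Y - emb F b)"
proof -
  obtain r where r: "u - [:poly u a:] = [:- a, 1:] * r"
    using poly_eq_0_iff_dvd[of "u - [:poly u a:]" a] by (auto elim!: dvdE)
  obtain s where s: "v - [:poly v a:] = [:- a, 1:] * s"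
    using poly_eq_0_iff_dvd[of "v - [:poly v a:]" a] by (auto elim!: dvdE)
  have u: "px u = emb F (poly u a) + (X - emb F a) * px r"
    using arg_cong[OF r, of px] by (simp only: px_simps px_pCons px_0) (simp add: emb_simps algebra_simps)
  have v: "px v = emb F (poly v a) + (X - emb F a) * px s"
    using arg_cong[OF s, of px] by (simp only: px_simps px_pCons px_0) (simp add: emb_simps algebra_simps)
  have "poly u a = - poly v a * b" using assms unfolding value_at_def by (simp add: add_eq_0_iff)
  then have "el u v = (X - emb F a) * el r s + emb F (poly v a) * (Y - emb F b)"
    unfolding el_px u v by (simp add: emb_simps algebra_simps)
  then show thesis by (rule that)
qed

text \<open>
  Here \<open>i\<close> is the ramification index of \<open>x\<close> at the point. The norm of a function is a polynomial
  in \<open>x\<close>, hence a power of \<open>x - a\<close> times a unit; this bounds the powers of \<open>t\<close> that divide the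
  function.
\<close>

lemma affine_place_of_generator:
  assumes P: "on_curve E a b" and t: "t \<noteq> 0" "t = el t1 t2" "value_at a b t1 t2 = 0"
    and gen: "\<And>u v. value_at a b u v = 0 \<Longrightarrow> \<exists>g \<in> local_ring F (Aff a b). el u v = t * g"
    and ram: "local_unit F (Aff a b) w0" "X - emb F a = t ^ i * w0"
  shows "place F (Aff a b) t"
proof -
  let ?R = "local_ring F (Aff a b)"
  have not_unit: "\<not> local_unit F (Aff a b) t"
    using el_local_unit_imp[OF P] t by blast
  have unif: "uniformizer F (Aff a b) t"
    unfolding uniformizer_def
  proof (intro conjI ballI impI)
    show "t \<in> ?R" unfolding t(2) by (rule el_in_local_ring_Aff)
    fix g assume g: "g \<in> ?R" "\<not> local_unit F (Aff a b) g"
    obtain u v r s where 1: "value_at a b r s \<noteq> 0" "g * el r s = el u v"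
      using g(1) by (rule local_ring_AffE)
    have rs: "el r s \<noteq> 0" "local_unit F (Aff a b) (el r s)" "inverse (el r s) \<in> ?R"
      using local_unit_el[OF 1(1)] by (auto simp: local_unit_def)
    have g_eq: "g = el u v * inverse (el r s)" using 1(2) rs(1) by (simp add: field_simps)
    have "value_at a b u v = 0"
    proof (rule ccontr)
      assume nz: "value_at a b u v \<noteq> 0"
      have "inverse g * el u v = el r s" using value_at_nonzero_imp[OF nz] rs(1) unfolding g_eq by simp
      then have "inverse g \<in> ?R" using nz by (rule local_ring_AffI[rotated])
      moreover have "g \<noteq> 0" using value_at_nonzero_imp[OF nz] 1(2) by auto
      ultimately show False using g unfolding local_unit_def by blast
    qed
    then obtain g' where g': "g' \<in> ?R" "el u v = t * g'" using gen by blast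
    show "\<exists>g' \<in> ?R. g = t * g'"
      using local_ring_Aff_mult[OF P g'(1) rs(3)] unfolding g_eq g'(2) by (auto simp: mult.assoc simp del: local_ring.simps)
  qed (use t(1) not_unit in auto)
  interpret uniformized_ring F "Aff a b" t
  proof
    show "1 \<in> ?R" using el_in_local_ring_Aff[of 1 0 a b] by (simp only: el_px px_1 px_0) simp
  qed (use unif local_ring_Aff_mult[OF P] in blast)+
  have dec: "\<exists>n w. unit w \<and> el u v = t ^ n * w" if nz: "el u v \<noteq> 0" for u v
  proof -
    obtain r s d where d: "d \<noteq> 0" "px d * (1 / el u v) = el r s"
      by (rule fraction_px[of "1 / el u v"]) blast
    then have prod: "el u v * el r s = px d" using nz by (auto simp: field_simps)
    obtain d' where d': "d = [:- a, 1:] ^ order a d * d'" "\<not> [:- a, 1:] dvd d'"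
      using order_decomp[OF d(1), of a] by blast
    have "value_at a b d' 0 \<noteq> 0" using d'(2) by (simp add: value_at_def poly_eq_0_iff_dvd)
    then have ud': "unit (px d')" using local_unit_el[of a b d' 0] by (simp add: el_px)
    let ?j = "order a d"
    have "px d = (X - emb F a) ^ ?j * px d'"
      using arg_cong[OF d'(1), of px] by (simp add: px_simps emb_simps)
    then have pd: "el u v * el r s = t ^ (i * ?j) * (w0 ^ ?j * px d')"
      unfolding prod ram(2) by (simp add: power_mult_distrib power_mult mult.assoc)
    show ?thesis
    proof (rule decompose_if_bounded[where N = "i * ?j", OF el_in_local_ring_Aff])
      fix k g' assume g': "g' \<in> ?R" "el u v = t ^ k * g'"
      show "k \<le> i * ?j"
      proof (rule ccontr)
        assume "\<not> k \<le> i * ?j"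
        then have k: "k = i * ?j + Suc (k - Suc (i * ?j))" by simp
        define m where "m = k - Suc (i * ?j)"
        have "t ^ (i * ?j) * (w0 ^ ?j * px d') = t ^ k * g' * el r s"
          using pd unfolding g'(2) by simp
        also have "\<dots> = t ^ (i * ?j) * (t * (t ^ m * g' * el r s))"
          by (subst k) (simp add: power_add m_def mult_ac)
        finally have eq: "w0 ^ ?j * px d' = t * (t ^ m * g' * el r s)" using t(1) by simp
        have u: "unit (w0 ^ ?j * px d')" by (intro unit_mult unit_power ram ud')
        have tR: "t \<in> ?R" using unif by (simp add: uniformizer_def)
        have in_R: "(t ^ m * g' * el r s) * inverse (w0 ^ ?j * px d') \<in> ?R"
          using u by (intro mult_in power_in tR g'(1) el_in_local_ring_Aff) (simp add: local_unit_def)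
        have "inverse t = (t ^ m * g' * el r s) * inverse (w0 ^ ?j * px d')"
          using u t(1) unfolding eq local_unit_def by (simp add: field_simps)
        then show False using in_R not_unit t(1) tR unfolding local_unit_def by metis
      qed
    qed
  qed
  show ?thesis
  proof
    fix g :: 'k assume g: "g \<noteq> 0"
    obtain u v r s where eq: "g = el u v / el r s" "el r s \<noteq> 0" by (rule fraction_el)
    have "el u v \<noteq> 0" using g eq by auto
    then obtain n w where 1: "unit w" "el u v = t ^ n * w" using dec by blast
    obtain n' w' where 2: "unit w'" "el r s = t ^ n' * w'" using dec eq(2) by blast
    have "unit (w * inverse w')" by (intro unit_mult unit_inverse 1 2)
    moreover have "g = t powi (int n - int n') * (w * inverse w')"
      unfolding eq(1) 1(2) 2(2) using t(1) by (simp add: power_int_diff field_simps)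
    ultimately show "\<exists>n w. unit w \<and> g = t powi n * w" by blast
  qed
qed

lemma emb_2: "emb F 2 = 2"
  using emb_simps(3)[of 1 1] by (simp add: emb_simps(2))

text \<open>
  If the partial derivative with respect to \<open>y\<close> does not vanish, then \<open>y - b\<close> is a multiple of
  \<open>x - a\<close> by \<open>tangent_poly_eq\<close>, and \<open>x - a\<close> is a uniformizer. Otherwise the one with respect to
  \<open>x\<close> does not vanish, the conjugate of \<open>y - b\<close> is, up to sign, \<open>y - b\<close> plus a multiple of
  \<open>x - a\<close>, and \<open>x - a\<close> is the square of the uniformizer \<open>y - b\<close> times a unit.
\<close>

lemma affine_place:
  assumes P: "on_curve E a b" and disc: "discriminant E \<noteq> 0"
  shows "\<exists>t. place F (Aff a b) t"
proof (cases "2 * b + a1 E * a + a3 E = 0")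
  case False
  let ?c = "el [:b + a3 E, a1 E:] 1"
  have uc: "local_unit F (Aff a b) ?c"
    using False by (intro local_unit_el) (simp add: value_at_def algebra_simps)
  have "place F (Aff a b) (X - emb F a)"
  proof (rule affine_place_of_generator[OF P])
    show "X - emb F a = el [:- a, 1:] 0" by (simp add: el_px emb_simps)
    then show "X - emb F a \<noteq> 0" using el_eq_0_iff[of "[:- a, 1:]" 0] by simp
    show "value_at a b [:- a, 1:] 0 = 0" by (simp add: value_at_def)
    show "local_unit F (Aff a b) 1" using local_unit_el[of a b 1 0] by (simp add: value_at_def el_px)
    show "X - emb F a = (X - emb F a) ^ 1 * 1" by simp
    fix u v assume "value_at a b u v = 0"
    then obtain r s where rs: "el u v = (X - emb F a) * el r s + emb F (poly v a) * (Y - emb F b)"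
      by (rule vanishing_el)
    define g where "g = el r s + emb F (poly v a) * px (tangent_poly a b) * inverse ?c"
    have c0: "?c \<noteq> 0" using uc by (simp add: local_unit_def)
    have Y_eq: "Y - emb F b = (X - emb F a) * px (tangent_poly a b) * inverse ?c"
      using tangent_poly_eq[OF P] c0 by (simp add: eq_divide_eq flip: divide_inverse)
    have eq: "el u v = (X - emb F a) * g" unfolding rs g_def Y_eq by (simp add: algebra_simps)
    have "g * ?c = el r s * ?c + emb F (poly v a) * px (tangent_poly a b)"
      unfolding g_def using c0 by (simp add: algebra_simps)
    also have "\<dots> \<in> coord_ring F" by simp
    finally obtain u' v' where "g * ?c = el u' v'" unfolding coord_ring_iff by blast
    then have "g \<in> local_ring F (Aff a b)"
      using local_ring_AffI[of a b "[:b + a3 E, a1 E:]" 1 g u' v'] False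
      by (simp add: value_at_def algebra_simps del: local_ring.simps)
    then show "\<exists>g \<in> local_ring F (Aff a b). el u v = (X - emb F a) * g" using eq by blast
  qed
  then show ?thesis by blast
next
  case True
  define q where "q = px (tangent_poly a b) - emb F (a1 E) * (Y - emb F b)"
  have q: "q = el (tangent_poly a b + [:a1 E * b:]) [:- a1 E:]"
    unfolding q_def by (simp add: el_px px_simps emb_simps algebra_simps)
  have evq: "value_at a b (tangent_poly a b + [:a1 E * b:]) [:- a1 E:] \<noteq> 0"
    using discriminant_eq_0_if_singular[OF P True] disc tangent_poly_value[of a b] by (auto simp: value_at_def)
  have uq: "local_unit F (Aff a b) q" unfolding q by (rule local_unit_el[OF evq])
  have uq': "local_unit F (Aff a b) (inverse q)" using uq unfolding local_unit_def by simp
  have q0: "q \<noteq> 0" using uq by (simp add: local_unit_def)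
  have sq: "(X - emb F a) * q = (Y - emb F b) ^ 2"
  proof -
    have "el [:b + a3 E, a1 E:] 1 = (Y - emb F b) + emb F (a1 E) * (X - emb F a) + emb F (2 * b + a1 E * a + a3 E)"
      by (simp add: el_px emb_simps emb_2 algebra_simps)
    then have c_eq: "el [:b + a3 E, a1 E:] 1 = (Y - emb F b) + emb F (a1 E) * (X - emb F a)"
      using True by (simp add: emb_simps(1))
    show ?thesis using tangent_poly_eq[OF P] unfolding q_def c_eq
      by (simp add: algebra_simps power2_eq_square)
  qed
  have "place F (Aff a b) (Y - emb F b)"
  proof (rule affine_place_of_generator[OF P])
    show "Y - emb F b = el [:- b:] 1" by (simp add: el_px emb_simps)
    then show "Y - emb F b \<noteq> 0" using el_eq_0_iff[of "[:- b:]" 1] by simp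
    show "value_at a b [:- b:] 1 = 0" by (simp add: value_at_def)
    show "local_unit F (Aff a b) (inverse q)" by (rule uq')
    show X: "X - emb F a = (Y - emb F b) ^ 2 * inverse q" using sq q0 by (simp add: field_simps)
    fix u v assume "value_at a b u v = 0"
    then obtain r s where rs: "el u v = (X - emb F a) * el r s + emb F (poly v a) * (Y - emb F b)"
      by (rule vanishing_el)
    define g where "g = (Y - emb F b) * el r s * inverse q + emb F (poly v a)"
    have eq: "el u v = (Y - emb F b) * g"
      unfolding rs g_def X by (simp add: algebra_simps power2_eq_square)
    have "g * q = (Y - emb F b) * el r s + emb F (poly v a) * q"
      unfolding g_def using q0 by (simp add: distrib_right mult.assoc)
    also have "\<dots> \<in> coord_ring F" unfolding q by simp
    finally obtain u' v' where "g * q = el u' v'" unfolding coord_ring_iff by blast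
    then have "g \<in> local_ring F (Aff a b)" using local_ring_AffI[OF evq] unfolding q by blast
    then show "\<exists>g \<in> local_ring F (Aff a b). el u v = (Y - emb F b) * g" using eq by blast
  qed
  then show ?thesis by blast
qed

end

context weierstrass_field begin

lemma X_el: "X = el [:0, 1:] 0" and Y_el: "Y = el 0 1"
  by (simp_all add: el_px emb_simps)

lemma X_nonzero: "X \<noteq> 0" and Y_nonzero: "Y \<noteq> 0"
  unfolding X_el Y_el el_eq_0_iff by simp_all

lemma inf_degree_XY: "inf_degree [:0, 1:] (0 :: 'l poly) = 2" "inf_degree 0 (1 :: 'l poly) = 3"
  by (simp_all add: inf_degree_def)

lemma mult_X_power:
  assumes "el u v \<noteq> 0"
  obtains r s where "el u v * X ^ n = el r s" "inf_degree r s = inf_degree u v + 2 * n"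
proof -
  have "\<exists>r s. el u v * X ^ n = el r s \<and> inf_degree r s = inf_degree u v + 2 * n"
  proof (induction n)
    case (Suc n)
    then obtain r s where 1: "el u v * X ^ n = el r s" "inf_degree r s = inf_degree u v + 2 * n"
      by blast
    obtain p q where pq: "el r s * el [:0, 1:] 0 = el p q" using el_mult by blast
    have "el r s \<noteq> 0" unfolding 1(1)[symmetric] using assms X_nonzero by simp
    then have "r \<noteq> 0 \<or> s \<noteq> 0" by (auto simp: el_eq_0_iff)
    then have "inf_degree p q = inf_degree r s + inf_degree [:0, 1:] (0 :: 'l poly)"
      by (intro inf_mult(1)[OF _ _ pq]) auto
    moreover have "el u v * X ^ Suc n = el p q"
      using pq unfolding X_el[symmetric] 1(1)[symmetric] by (simp add: mult_ac)
    ultimately show ?case using 1(2) unfolding inf_degree_XY by (intro exI[of _ p] exI[of _ q]) simp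
  qed auto
  then show thesis using that by blast
qed

lemma mult_Y_power:
  assumes "el u v \<noteq> 0"
  obtains r s where "el u v * Y ^ n = el r s" "inf_degree r s = inf_degree u v + 3 * n"
proof -
  have "\<exists>r s. el u v * Y ^ n = el r s \<and> inf_degree r s = inf_degree u v + 3 * n"
  proof (induction n)
    case (Suc n)
    then obtain r s where 1: "el u v * Y ^ n = el r s" "inf_degree r s = inf_degree u v + 3 * n"
      by blast
    obtain p q where pq: "el r s * el 0 1 = el p q" using el_mult by blast
    have "el r s \<noteq> 0" unfolding 1(1)[symmetric] using assms Y_nonzero by simp
    then have "r \<noteq> 0 \<or> s \<noteq> 0" by (auto simp: el_eq_0_iff)
    then have "inf_degree p q = inf_degree r s + inf_degree 0 (1 :: 'l poly)"
      by (intro inf_mult(1)[OF _ _ pq]) auto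
    moreover have "el u v * Y ^ Suc n = el p q"
      using pq unfolding Y_el[symmetric] 1(1)[symmetric] by (simp add: mult_ac)
    ultimately show ?case using 1(2) unfolding inf_degree_XY by (intro exI[of _ p] exI[of _ q]) simp
  qed auto
  then show thesis using that by blast
qed

lemma local_ring_Infty_iff:
  assumes "el u v \<noteq> 0" "el r s \<noteq> 0"
  shows "el u v / el r s \<in> local_ring F Infty \<longleftrightarrow> inf_degree u v \<le> inf_degree r s"
proof
  assume "el u v / el r s \<in> local_ring F Infty"
  then obtain u' v' r' s' where *: "el u v / el r s = el u' v' / el r' s'" "el r' s' \<noteq> 0"
      "el u' v' = 0 \<or> inf_degree u' v' \<le> inf_degree r' s'" unfolding local_ring.simps by blast
  then have nz: "el u' v' \<noteq> 0" using assms by auto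
  have "el u v * el r' s' = el u' v' * el r s" using * assms by (simp add: field_simps)
  then have "inf_degree u v + inf_degree r' s' = inf_degree u' v' + inf_degree r s"
    using inf_cross(1) assms * nz by blast
  then show "inf_degree u v \<le> inf_degree r s" using * nz by auto
next
  assume "inf_degree u v \<le> inf_degree r s"
  then show "el u v / el r s \<in> local_ring F Infty"
    unfolding local_ring.simps using assms(2) by blast
qed

lemma local_unit_InftyI:
  assumes "el u v \<noteq> 0" "el r s \<noteq> 0" "inf_degree u v = inf_degree r s"
  shows "local_unit F Infty (el u v / el r s)"
  using local_ring_Infty_iff[of u v r s] local_ring_Infty_iff[of r s u v] assms
  unfolding local_unit_def by simp

lemma decompose_Infty:
  assumes "el u v \<noteq> 0" "el r s \<noteq> 0"
  shows "\<exists>w. local_unit F Infty w \<and>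
    el u v / el r s = (X / Y) powi (int (inf_degree r s) - int (inf_degree u v)) * w"
proof (cases "inf_degree u v \<le> inf_degree r s")
  case True
  define n where "n = inf_degree r s - inf_degree u v"
  obtain p q where pq: "el u v * Y ^ n = el p q" "inf_degree p q = inf_degree u v + 3 * n"
    by (rule mult_Y_power[OF assms(1)])
  obtain p' q' where pq': "el r s * X ^ n = el p' q'" "inf_degree p' q' = inf_degree r s + 2 * n"
    by (rule mult_X_power[OF assms(2)])
  have "el p q \<noteq> 0" "el p' q' \<noteq> 0" "inf_degree p q = inf_degree p' q'"
    using pq pq' assms X_nonzero Y_nonzero True n_def by (auto simp flip: pq(1) pq'(1))
  then have "local_unit F Infty (el p q / el p' q')" by (rule local_unit_InftyI)
  moreover have "el u v / el r s = (X / Y) ^ n * (el p q / el p' q')"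
    unfolding pq(1)[symmetric] pq'(1)[symmetric] using X_nonzero Y_nonzero by (simp add: power_divide)
  moreover have "int (inf_degree r s) - int (inf_degree u v) = int n" using True n_def by simp
  ultimately show ?thesis by (metis power_int_of_nat)
next
  case False
  define n where "n = inf_degree u v - inf_degree r s"
  obtain p q where pq: "el u v * X ^ n = el p q" "inf_degree p q = inf_degree u v + 2 * n"
    by (rule mult_X_power[OF assms(1)])
  obtain p' q' where pq': "el r s * Y ^ n = el p' q'" "inf_degree p' q' = inf_degree r s + 3 * n"
    by (rule mult_Y_power[OF assms(2)])
  have "el p q \<noteq> 0" "el p' q' \<noteq> 0" "inf_degree p q = inf_degree p' q'"
    using pq pq' assms X_nonzero Y_nonzero False n_def by (auto simp flip: pq(1) pq'(1))
  then have "local_unit F Infty (el p q / el p' q')" by (rule local_unit_InftyI)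
  moreover have "el u v / el r s = inverse ((X / Y) ^ n) * (el p q / el p' q')"
    unfolding pq(1)[symmetric] pq'(1)[symmetric] using X_nonzero Y_nonzero by (simp add: power_divide)
  moreover have "int (inf_degree r s) - int (inf_degree u v) = - int n" using False n_def by simp
  ultimately show ?thesis by (metis power_int_minus power_int_of_nat)
qed

lemma place_Infty: "place F Infty (X / Y)"
proof
  show one: "1 \<in> local_ring F Infty"
    using local_ring_Infty_iff[of 1 0 1 0] by (simp add: el_px del: local_ring.simps)
  show "a * b \<in> local_ring F Infty"
    if "a \<in> local_ring F Infty" "b \<in> local_ring F Infty" for a b
  proof (cases "a = 0 \<or> b = 0")
    case True
    have "0 \<in> local_ring F Infty"
    proof -
      have "0 = el 0 0 / el 1 0" "el 1 0 \<noteq> 0" "el 0 0 = 0" by (simp_all add: el_px)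
      then show ?thesis unfolding local_ring.simps by blast
    qed
    then show ?thesis using True by (auto simp del: local_ring.simps)
  next
    case False
    obtain u v r s where a: "a = el u v / el r s" "el r s \<noteq> 0" by (rule fraction_el)
    obtain u' v' r' s' where b: "b = el u' v' / el r' s'" "el r' s' \<noteq> 0" by (rule fraction_el)
    have nz: "el u v \<noteq> 0" "el u' v' \<noteq> 0" using a b False by auto
    then have le: "inf_degree u v \<le> inf_degree r s" "inf_degree u' v' \<le> inf_degree r' s'"
      using that a b local_ring_Infty_iff by auto
    obtain p q where pq: "el u v * el u' v' = el p q" using el_mult by blast
    obtain p' q' where pq': "el r s * el r' s' = el p' q'" using el_mult by blast
    have "inf_degree p q \<le> inf_degree p' q'"
      using inf_mult(1)[OF _ _ pq] inf_mult(1)[OF _ _ pq'] le nz a(2) b(2) el_eq_0_iff by auto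
    moreover have "el p q \<noteq> 0" "el p' q' \<noteq> 0" using nz a(2) b(2) pq pq' by (metis mult_eq_0_iff)+
    moreover have "a * b = el p q / el p' q'" unfolding a b pq[symmetric] pq'[symmetric] by simp
    ultimately show ?thesis using local_ring_Infty_iff by simp
  qed
  show dec: "\<exists>n w. local_unit F Infty w \<and> g = (X / Y) powi n * w" if "g \<noteq> 0" for g
  proof -
    obtain u v r s where g: "g = el u v / el r s" "el r s \<noteq> 0" by (rule fraction_el)
    then show ?thesis using decompose_Infty[of u v r s] that by auto
  qed
  show "uniformizer F Infty (X / Y)"
    unfolding uniformizer_def
  proof (intro conjI ballI impI)
    show "X / Y \<noteq> 0" using X_nonzero Y_nonzero by simp
    show "X / Y \<in> local_ring F Infty"
      using X_nonzero Y_nonzero local_ring_Infty_iff[of "[:0, 1:]" 0 0 1]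
      unfolding X_el[symmetric] Y_el[symmetric] by (simp add: inf_degree_def del: local_ring.simps)
    show "\<not> local_unit F Infty (X / Y)"
      using X_nonzero Y_nonzero local_ring_Infty_iff[of 0 1 "[:0, 1:]" 0]
      unfolding X_el[symmetric] Y_el[symmetric] local_unit_def
      by (simp add: inf_degree_def del: local_ring.simps)
    fix g assume g: "g \<in> local_ring F Infty" "\<not> local_unit F Infty g"
    show "\<exists>g' \<in> local_ring F Infty. g = X / Y * g'"
    proof (cases "g = 0")
      case True
      then show ?thesis using g(1) by (intro bexI[of _ g]) auto
    next
      case False
      obtain u v r s where g_eq: "g = el u v / el r s" "el r s \<noteq> 0" by (rule fraction_el)
      have nz: "el u v \<noteq> 0" using False g_eq by auto
      have lt: "inf_degree u v < inf_degree r s"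
        using g g_eq nz local_ring_Infty_iff[of u v r s] local_unit_InftyI[of u v r s] by force
      obtain p q where pq: "el u v * Y ^ 1 = el p q" "inf_degree p q = inf_degree u v + 3 * 1"
        by (rule mult_Y_power[OF nz])
      obtain p' q' where pq': "el r s * X ^ 1 = el p' q'" "inf_degree p' q' = inf_degree r s + 2 * 1"
        by (rule mult_X_power[OF g_eq(2)])
      have "el p q \<noteq> 0" "el p' q' \<noteq> 0"
        unfolding pq(1)[symmetric] pq'(1)[symmetric] using nz g_eq(2) X_nonzero Y_nonzero by auto
      then have "el p q / el p' q' \<in> local_ring F Infty"
        using lt pq(2) pq'(2) local_ring_Infty_iff by simp
      moreover have "g = X / Y * (el p q / el p' q')"
        unfolding g_eq pq(1)[symmetric] pq'(1)[symmetric] using X_nonzero Y_nonzero by simp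
      ultimately show ?thesis by blast
    qed
  qed
qed

lemma ord_at_Infty_el:
  assumes "el u v \<noteq> 0"
  shows "ord_at F Infty (el u v) = - int (inf_degree u v)"
proof -
  have one: "el 1 0 = 1" by (simp add: el_px)
  have deg: "inf_degree 1 (0 :: 'l poly) = 0" by (simp add: inf_degree_def)
  interpret place F Infty "X / Y" by (rule place_Infty)
  obtain w where "local_unit F Infty w"
      "el u v / el 1 0 = (X / Y) powi (int (inf_degree 1 (0 :: 'l poly)) - int (inf_degree u v)) * w"
    using decompose_Infty[of u v 1 0] assms unfolding one by auto
  then show ?thesis using ord_at_eq[of w] unfolding deg one by simp
qed

section \<open>Functions without affine poles\<close>

lemma on_curve_neg_y: "on_curve E a b \<Longrightarrow> on_curve E a (neg_y E a b)"
  unfolding on_curve_def neg_y_def by (simp add: algebra_simps power2_eq_square)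

lemma exists_point_over: "\<exists>b. on_curve E a b"
proof -
  define p where "p = [:- poly (weier_cubic E) a, poly (weier_lin E) a, 1:]"
  have "degree p > 0" unfolding p_def by simp
  then obtain b where "poly p b = 0" using alg_closed_imp_poly_has_root by blast
  then have "on_curve E a b"
    unfolding p_def on_curve_def weier_cubic_def weier_lin_def
    by (simp add: algebra_simps power2_eq_square power3_eq_cube)
  then show ?thesis by blast
qed

text \<open>
  The function \<open>u(x) + v(x) y\<close> vanishes at all points over \<open>a\<close>. If there are two of them, this
  gives two linear equations for \<open>u(a)\<close> and \<open>v(a)\<close>. At a ramification point \<open>x - a\<close> vanishes
  twice, but \<open>v(a) (y - b)\<close> only once unless \<open>v(a) = 0\<close>.
\<close>

lemma divides_if_regular_over:
  assumes disc: "discriminant E \<noteq> 0"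
    and eq: "el u v = (X - emb F a) * g"
    and reg: "\<And>b. on_curve E a b \<Longrightarrow> g \<in> local_ring F (Aff a b)"
  shows "poly u a = 0 \<and> poly v a = 0"
proof -
  obtain b where P: "on_curve E a b" using exists_point_over by blast
  have X_a: "X - emb F a = el [:- a, 1:] 0" by (simp add: el_px emb_simps)
  have vanish: "value_at a b' u v = 0" if b': "on_curve E a b'" for b'
  proof -
    obtain p q r s where 1: "value_at a b' r s \<noteq> 0" "g * el r s = el p q"
      using reg[OF b'] by (rule local_ring_AffE)
    have "el u v * el r s = el [:- a, 1:] 0 * el p q"
      unfolding eq X_a[symmetric] 1(2)[symmetric] by simp
    then have "value_at a b' u v * value_at a b' r s = value_at a b' [:- a, 1:] 0 * value_at a b' p q"
      by (rule value_at_cross[OF b'])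
    then show ?thesis using 1(1) by (simp add: value_at_def)
  qed
  have "poly v a = 0"
  proof (cases "neg_y E a b = b")
    case False
    have "poly v a * (neg_y E a b - b) = value_at a (neg_y E a b) u v - value_at a b u v"
      unfolding value_at_def by (simp add: algebra_simps)
    also have "\<dots> = 0" using vanish[OF P] vanish[OF on_curve_neg_y[OF P]] by simp
    finally have "poly v a * (neg_y E a b - b) = 0" .
    then show ?thesis using False by simp
  next
    case True
    then have y': "2 * b + a1 E * a + a3 E = 0"
      unfolding neg_y_def by (simp add: algebra_simps eq_neg_iff_add_eq_0)
    obtain r s where rs: "el u v = (X - emb F a) * el r s + emb F (poly v a) * (Y - emb F b)"
      using vanish[OF P] by (rule vanishing_el)
    obtain p q r' s' where 1: "value_at a b r' s' \<noteq> 0" "g * el r' s' = el p q"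
      using reg[OF P] by (rule local_ring_AffE)
    have q0: "poly (tangent_poly a b) a \<noteq> 0"
      using discriminant_eq_0_if_singular[OF P y'] disc tangent_poly_value[of a b] by auto
    let ?t = "tangent_poly a b" and ?c = "el [:b + a3 E, a1 E:] 1"
    have X0: "X - emb F a \<noteq> 0" unfolding X_a el_eq_0_iff by simp
    have cancel: "e * c = (r * c + k * w) * s"
      if "x0 \<noteq> 0" "x0 * e = (x0 * r + k * y0) * s" "y0 * c = x0 * w" for x0 y0 e c r k w s :: 'k
    proof -
      have "x0 * (e * c) = (x0 * r * c + k * (y0 * c)) * s"
        using that(2) by (simp only: mult.assoc[symmetric]) (simp add: algebra_simps)
      also have "\<dots> = x0 * ((r * c + k * w) * s)" unfolding that(3) by (simp add: algebra_simps)
      finally show ?thesis using that(1) by simp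
    qed
    have "(X - emb F a) * el p q = ((X - emb F a) * el r s + emb F (poly v a) * (Y - emb F b)) * el r' s'"
      by (simp only: 1(2)[symmetric] rs[symmetric]) (simp only: eq mult.assoc)
    then have *: "el p q * ?c = (el r s * ?c + emb F (poly v a) * px ?t) * el r' s'"
      by (rule cancel[OF X0 _ tangent_poly_eq[OF P]])
    have evc: "value_at a b [:b + a3 E, a1 E:] 1 = 0" using y' unfolding value_at_def by (simp add: algebra_simps)
    obtain e1 e2 where e: "el p q * ?c = el e1 e2" using el_mult by blast
    obtain d1 d2 where d: "el r s * ?c = el d1 d2" using el_mult by blast
    have "el e1 e2 * el 1 0 = el (d1 + smult (poly v a) ?t) d2 * el r' s'"
      using * unfolding e d by (simp add: el_px px_simps algebra_simps)
    then have "value_at a b e1 e2 * value_at a b 1 0 = value_at a b (d1 + smult (poly v a) ?t) d2 * value_at a b r' s'"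
      by (rule value_at_cross[OF P])
    moreover have "value_at a b e1 e2 = 0" "value_at a b d1 d2 = 0"
      using value_at_mult[OF P e] value_at_mult[OF P d] evc by auto
    ultimately have "value_at a b (d1 + smult (poly v a) ?t) d2 = 0" using 1(1) by simp
    moreover have "value_at a b (d1 + smult (poly v a) ?t) d2 = value_at a b d1 d2 + poly v a * poly ?t a"
      unfolding value_at_def by (simp add: algebra_simps)
    ultimately have "poly v a * poly ?t a = 0" using \<open>value_at a b d1 d2 = 0\<close> by simp
    then show ?thesis using q0 by simp
  qed
  then show ?thesis using vanish[OF P] by (simp add: value_at_def)
qed

text \<open>
  The roots of a denominator in \<open>x\<close> can be cancelled one after the other.
\<close>

lemma coord_ring_if_regular:
  assumes disc: "discriminant E \<noteq> 0"
    and reg: "\<And>a b. on_curve E a b \<Longrightarrow> g \<in> local_ring F (Aff a b)"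
  shows "g \<in> coord_ring F"
proof -
  have "g \<in> coord_ring F"
    if "degree d = n" "d \<noteq> 0" "px d * g = el u v" and reg: "\<And>a b. on_curve E a b \<Longrightarrow> g \<in> local_ring F (Aff a b)"
    for d n u v using that(1-3)
  proof (induction n arbitrary: d u v)
    case 0
    then obtain c where c: "d = [:c:]" "c \<noteq> 0" by (auto elim!: degree_eq_zeroE)
    then have "g = el (smult (1 / c) u) (smult (1 / c) v)"
      using 0(3) by (simp add: el_px px_simps emb_simps field_simps)
    then show ?case by simp
  next
    case (Suc n)
    then obtain a where a: "poly d a = 0" using alg_closed_imp_poly_has_root[of d] by auto
    then obtain d' where d': "d = [:- a, 1:] * d'" by (auto simp: poly_eq_0_iff_dvd elim!: dvdE)
    have X_a: "px [:- a, 1:] = X - emb F a" by (simp add: emb_simps)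
    have X0: "X - emb F a \<noteq> 0" unfolding X_a[symmetric] px_eq_0_iff by simp
    have eq: "el u v = (X - emb F a) * (px d' * g)"
      using Suc.prems(3) unfolding d' px_mult X_a by (simp add: mult.assoc)
    have "px d' * g \<in> local_ring F (Aff a b)" if "on_curve E a b" for b
      using local_ring_Aff_mult[OF that el_in_local_ring_Aff[of d' 0] reg[OF that]] by (simp add: el_px)
    then have "poly u a = 0 \<and> poly v a = 0" by (rule divides_if_regular_over[OF disc eq])
    then obtain u' v' where uv: "u = [:- a, 1:] * u'" "v = [:- a, 1:] * v'"
      by (auto simp: poly_eq_0_iff_dvd elim!: dvdE)
    have "el u v = (X - emb F a) * el u' v'"
      unfolding uv el_px px_mult X_a by (simp add: algebra_simps)
    then have "px d' * g = el u' v'" using eq X0 by simp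
    moreover have "d' \<noteq> 0" using Suc.prems(2) d' by auto
    moreover have "degree d' = n"
      using Suc.prems(1) \<open>d' \<noteq> 0\<close> unfolding d' by (subst (asm) degree_mult_eq) auto
    ultimately show ?case using Suc.IH by blast
  qed
  then show ?thesis using fraction_px[of g] reg by metis
qed

lemma on_curve_imp_place:
  assumes "discriminant E \<noteq> 0" "P \<in> points E"
  obtains t where "place F P t"
  using assms affine_place place_Infty unfolding points_def by auto

lemma one_in_inverse_ideal:
  assumes disc: "discriminant E \<noteq> 0" and D: "\<And>P. P \<in> points E \<Longrightarrow> Poly_Mapping.lookup D P \<ge> 0"
  shows "1 \<in> inverse_ideal E F D"
proof -
  have "ord_at F P 1 = 0" if "P \<in> points E" for P
    using on_curve_imp_place[OF disc that] place.ord_at_1 by metis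
  then have "1 \<in> riemann_roch_space E F (D + Poly_Mapping.single Infty (int 0))"
    using D by (simp add: riemann_roch_space_def)
  then show ?thesis unfolding inverse_ideal_def by blast
qed

text \<open>
  The two divisors add up to that of \<open>x - \<alpha>\<close>. The product of \<open>h\<close> and the line therefore has no
  affine pole and a double pole at infinity, so it is a linear polynomial in \<open>x\<close> vanishing at \<open>V\<close>.
\<close>

lemma function_of_line_divisor:
  assumes disc: "discriminant E \<noteq> 0" and V: "on_curve E \<alpha> \<beta>"
    and h: "has_divisor E F h (pt (Aff \<alpha> \<beta>) + pt Infty - pt V1 - pt V2)" and sgn: "sign F h = 1"
    and line: "has_divisor E F (Y - px lam)
      (pt (Aff \<alpha> (neg_y E \<alpha> \<beta>)) + pt V1 + pt V2 - Poly_Mapping.single Infty 3)"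
    and lam: "degree lam \<le> 1"
  shows "h = (X - emb F \<alpha>) / (Y - px lam)"
proof -
  let ?l = "Y - px lam"
  have h0: "h \<noteq> 0" and l0: "?l \<noteq> 0" using h line by (auto simp: has_divisor_def)
  define k where "k = h * ?l"
  have k0: "k \<noteq> 0" using h0 l0 by (simp add: k_def)
  have ord: "ord_at F P k = Poly_Mapping.lookup (pt (Aff \<alpha> \<beta>) + pt (Aff \<alpha> (neg_y E \<alpha> \<beta>)) - Poly_Mapping.single Infty 2) P"
    if P: "P \<in> points E" for P
  proof -
    obtain t where "place F P t" using on_curve_imp_place[OF disc P] .
    then interpret place F P t .
    have "ord_at F P k = ord_at F P h + ord_at F P ?l" unfolding k_def by (rule ord_at_mult[OF h0 l0])
    then show ?thesis using h line P
      by (simp add: has_divisor_def lookup_add lookup_minus lookup_single when_def)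
  qed
  have "k \<in> local_ring F (Aff a b)" if ab: "on_curve E a b" for a b
  proof -
    have P: "Aff a b \<in> points E" using ab by (auto simp: points_def)
    obtain t where "place F (Aff a b) t" using on_curve_imp_place[OF disc P] .
    then interpret place F "Aff a b" t .
    have "ord_at F (Aff a b) k \<ge> 0" unfolding ord[OF P]
      by (simp add: lookup_add lookup_minus lookup_single when_def)
    then show ?thesis by (rule ord_at_nonneg_imp_in[OF k0])
  qed
  then have "k \<in> coord_ring F" by (rule coord_ring_if_regular[OF disc])
  then obtain u v where k: "k = el u v" unfolding coord_ring_iff by blast
  have "ord_at F Infty k = - 2"
    using ord[of Infty] by (simp add: points_def lookup_add lookup_minus lookup_single)
  then have "inf_degree u v = 2" using ord_at_Infty_el k k0 by simp
  then have v: "v = 0" and u: "degree u = 1" by (auto simp: inf_degree_def split: if_splits)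
  have V': "Aff \<alpha> \<beta> \<in> points E" using V by (auto simp: points_def)
  have "poly u \<alpha> = 0"
  proof (rule ccontr)
    assume "poly u \<alpha> \<noteq> 0"
    then have unit: "local_unit F (Aff \<alpha> \<beta>) k" unfolding k by (intro local_unit_el) (simp add: value_at_def v)
    obtain t where "place F (Aff \<alpha> \<beta>) t" using on_curve_imp_place[OF disc V'] .
    then interpret place F "Aff \<alpha> \<beta>" t .
    have "ord_at F (Aff \<alpha> \<beta>) k = 0" by (rule ord_at_unit[OF unit])
    then show False unfolding ord[OF V'] by (simp add: lookup_add lookup_minus lookup_single when_def split: if_splits)
  qed
  then obtain w where w: "u = [:- \<alpha>, 1:] * w" by (auto simp: poly_eq_0_iff_dvd elim!: dvdE)
  have "w \<noteq> 0" using w u by auto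
  then have "degree w = 0" using u unfolding w by (subst (asm) degree_mult_eq) auto
  then obtain c where c: "w = [:c:]" by (auto elim!: degree_eq_zeroE)
  have k': "k = emb F c * (X - emb F \<alpha>)"
    unfolding k v w c by (simp add: el_px px_simps emb_simps algebra_simps)
  have l: "?l = el (- lam) 1" by (simp add: el_px px_simps)
  have "h = el u v / el (- lam) 1" using l0 unfolding k[symmetric] k_def l[symmetric] by simp
  then have "sign F h = inf_lead_coeff u v / inf_lead_coeff (- lam) 1"
    using sign_fraction[of u v "- lam" 1] k k0 l l0 by simp
  also have "\<dots> = c" using lam u unfolding v by (simp add: inf_lead_coeff_def w c)
  finally have "c = 1" using sgn by simp
  then show ?thesis using k' l0 unfolding k_def by (simp add: emb_simps field_simps)
qed

end

section \<open>Twisted polynomials and the motive\<close>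

lemma coeff_tw_mult:
  "coeff (tw_mult q P Q) n =
     (\<Sum>i\<le>degree P. \<Sum>j\<le>degree Q. if i + j = n then coeff P i * coeff Q j ^ (q ^ i) else 0)"
  by (simp add: tw_mult_def coeff_sum)

lemma degree_tw_mult:
  fixes P Q :: "'l::field poly"
  assumes "P \<noteq> 0" "Q \<noteq> 0"
  shows "degree (tw_mult q P Q) = degree P + degree Q" "tw_mult q P Q \<noteq> 0"
proof -
  have "coeff (tw_mult q P Q) (degree P + degree Q) =
      (\<Sum>i\<le>degree P. if i = degree P then lead_coeff P * lead_coeff Q ^ (q ^ degree P) else 0)"
    unfolding coeff_tw_mult
  proof (rule sum.cong)
    fix i assume "i \<in> {..degree P}"
    then have "(\<Sum>j\<le>degree Q. if i + j = degree P + degree Q then coeff P i * coeff Q j ^ (q ^ i) else 0) =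
        (\<Sum>j\<le>degree Q. if j = degree Q then (if i = degree P then lead_coeff P * lead_coeff Q ^ (q ^ degree P) else 0) else 0)"
      by (intro sum.cong) auto
    then show "(\<Sum>j\<le>degree Q. if i + j = degree P + degree Q then coeff P i * coeff Q j ^ (q ^ i) else 0) =
        (if i = degree P then lead_coeff P * lead_coeff Q ^ (q ^ degree P) else 0)"
      by simp
  qed simp
  also have "\<dots> \<noteq> 0" using assms by simp
  finally have nz: "coeff (tw_mult q P Q) (degree P + degree Q) \<noteq> 0" .
  then show "tw_mult q P Q \<noteq> 0" by auto
  have "degree (tw_mult q P Q) \<le> degree P + degree Q"
    unfolding tw_mult_def
    by (intro degree_sum_le) (auto intro: order_trans[OF degree_monom_le])
  then show "degree (tw_mult q P Q) = degree P + degree Q"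
    using le_degree[OF nz] by simp
qed

lemma tw_mult_1_right: "tw_mult q P [:1:] = P"
proof -
  have "tw_mult q P [:1:] = (\<Sum>i\<le>degree P. monom (coeff P i) i)"
    by (simp add: tw_mult_def)
  then show ?thesis by (simp add: poly_as_sum_of_monoms)
qed

lemma tw_mult_1_left: "tw_mult q [:1:] P = P"
  by (simp add: tw_mult_def poly_as_sum_of_monoms)

lemma degree_tau: "degree (tau :: 'l::field poly) = 1"
  by (simp add: tau_def degree_monom_eq)

lemma tw_mult_tau_monom: 
  assumes "q > 0" 
  shows "tw_mult q tau (monom c n) = monom (c ^ q) (Suc n)"
proof (rule poly_eqI)
  fix k
  show "coeff (tw_mult q tau (monom c n)) k = coeff (monom (c ^ q) (Suc n)) k"
  proof (cases "c = 0")
    case True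
    then have "tw_mult q tau (monom c n) = 0"
      using assms by (simp add: tw_mult_def power_0_left)
    then show ?thesis using True assms by simp
  next
    case False
    then have d: "degree (monom c n) = n" by (rule degree_monom_eq)
    have "{..1::nat} = {0, 1}" by auto
    then have "coeff (tw_mult q tau (monom c n)) k =
       (\<Sum>j\<le>n. if 1 + j = k then coeff (monom c n) j ^ q else 0)"
      unfolding coeff_tw_mult degree_tau d by (simp add: tau_def cong: if_cong)
    also have "\<dots> = (\<Sum>j\<le>n. if j = n then (if Suc n = k then c ^ q else 0) else 0)"
      using assms by (intro sum.cong) auto
    finally show ?thesis by simp
  qed
qed

lemma degree_sum_increasing:
  fixes P :: "nat \<Rightarrow> 'l::field poly"
  assumes "\<And>i. P i \<noteq> 0" "\<And>i. degree (P i) = d i" "strict_mono d" "c n \<noteq> 0"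
  shows "degree (\<Sum>i\<le>n. smult (c i) (P i)) = d n" "(\<Sum>i\<le>n. smult (c i) (P i)) \<noteq> 0"
proof -
  have "coeff (\<Sum>i\<le>n. smult (c i) (P i)) (d n) = (\<Sum>i\<le>n. if i = n then c n * lead_coeff (P n) else 0)"
    unfolding coeff_sum
  proof (rule sum.cong)
    fix i assume "i \<in> {..n}"
    then have "i = n \<or> degree (P i) < d n" using assms(2,3) by (auto simp: strict_mono_less)
    then show "coeff (smult (c i) (P i)) (d n) = (if i = n then c n * lead_coeff (P n) else 0)"
      using assms(2) by (auto simp: coeff_eq_0)
  qed simp
  also have "\<dots> \<noteq> 0"
    using assms(4) assms(1)[of n] assms(2)[of n] leading_coeff_0_iff[of "P n"] by simp
  finally have nz: "coeff (\<Sum>i\<le>n. smult (c i) (P i)) (d n) \<noteq> 0" .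
  then show "(\<Sum>i\<le>n. smult (c i) (P i)) \<noteq> 0" by auto
  have "degree (\<Sum>i\<le>n. smult (c i) (P i)) \<le> d n"
  proof (rule degree_sum_le)
    fix i assume "i \<in> {..n}"
    then have "d i \<le> d n" using assms(3) by (simp add: strict_mono_less_eq)
    then show "degree (smult (c i) (P i)) \<le> d n"
      using assms(2) degree_smult_le order_trans by metis
  qed simp
  then show "degree (\<Sum>i\<le>n. smult (c i) (P i)) = d n" using le_degree[OF nz] by simp
qed

locale drinfeld_motive = weierstrass_field E F
  for E :: "'l::alg_closed_field weierstrass" and F :: "('l, 'k::field) funfield" +
  fixes q :: nat and \<theta> \<eta> :: 'l and \<phi> :: "'k \<Rightarrow> 'l poly"
    and scale :: "'k \<Rightarrow> 'm::ab_group_add \<Rightarrow> 'm" and \<iota> :: "'l poly \<Rightarrow> 'm" and \<tau> :: "'m \<Rightarrow> 'm"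
  assumes q_pos: "q > 0"
    and drinfeld: "drinfeld_module_rank2 q F \<theta> \<eta> \<phi>"
    and fibre: "generic_fibre q F \<phi> scale \<iota>"
    and tau_semilinear: "semilinear (twist q F) scale \<tau>"
    and tau_\<iota>: "\<And>\<omega>. \<tau> (\<iota> \<omega>) = \<iota> (tw_mult q tau \<omega>)"
begin

sublocale vector_space scale
  using fibre unfolding generic_fibre_def by blast

lemma \<iota>_add: "\<iota> (v + w) = \<iota> v + \<iota> w"
  using fibre unfolding generic_fibre_def by (simp add: Modules.additive_def)

lemma \<tau>_add: "\<tau> (v + w) = \<tau> v + \<tau> w"
  using tau_semilinear unfolding semilinear_def by (simp add: Modules.additive_def)

lemma \<tau>_scale: "\<tau> (scale g v) = scale (twist q F g) (\<tau> v)"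
  using tau_semilinear unfolding semilinear_def by simp

lemma \<iota>_act: "\<iota> (motive_act q F \<phi> u v \<omega>) = scale (el u v) (\<iota> \<omega>)"
  using fibre unfolding generic_fibre_def by blast

abbreviation "s \<equiv> \<iota> 1"

lemma poly_over_monom: "monom 1 i \<in> poly_over (finite_subfield q)" "0 \<in> poly_over (finite_subfield q)"
  using q_pos by (auto simp: poly_over_def finite_subfield_def)

lemma px_monom: "px (monom 1 i) = X ^ i"
  by (induction i) (auto simp: monom_0 monom_Suc emb_simps)

lemma powers_in_A:
  "X ^ i \<in> coord_ring_over (finite_subfield q) F" "X ^ i * Y \<in> coord_ring_over (finite_subfield q) F"
proof -
  have "X ^ i = el (monom 1 i) 0" "X ^ i * Y = el 0 (monom 1 i)" by (simp_all add: el_px px_monom)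
  then show "X ^ i \<in> coord_ring_over (finite_subfield q) F" "X ^ i * Y \<in> coord_ring_over (finite_subfield q) F"
    unfolding coord_ring_over_def using poly_over_monom by blast+
qed

lemma \<phi>_mult:
  assumes "a \<in> coord_ring_over (finite_subfield q) F" "b \<in> coord_ring_over (finite_subfield q) F"
  shows "\<phi> (a * b) = tw_mult q (\<phi> a) (\<phi> b)"
  using drinfeld assms unfolding drinfeld_module_rank2_def Let_def by blast

lemma \<phi>_1: "\<phi> 1 = [:1:]"
proof -
  have "\<phi> (emb F 1) = [:1:]"
    using drinfeld unfolding drinfeld_module_rank2_def Let_def by (simp add: finite_subfield_def)
  then show ?thesis by (simp add: emb_simps(2))
qed

lemma degree_\<phi>_X_Y: "degree (\<phi> X) = 4" "degree (\<phi> Y) = 6" "\<phi> X \<noteq> 0" "\<phi> Y \<noteq> 0"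
  using drinfeld unfolding drinfeld_module_rank2_def by auto

lemma degree_\<phi>_X_power: "degree (\<phi> (X ^ i)) = 4 * i \<and> \<phi> (X ^ i) \<noteq> 0"
proof (induction i)
  case (Suc i)
  have "\<phi> (X ^ Suc i) = tw_mult q (\<phi> X) (\<phi> (X ^ i))"
    using \<phi>_mult[OF powers_in_A(1)[of 1] powers_in_A(1)[of i]] by simp
  then show ?case using Suc degree_tw_mult[of "\<phi> X" "\<phi> (X ^ i)" q] degree_\<phi>_X_Y by simp
qed (simp add: \<phi>_1)

lemma degree_\<phi>_X_power_Y: "degree (\<phi> (X ^ i * Y)) = 4 * i + 6 \<and> \<phi> (X ^ i * Y) \<noteq> 0"
proof -
  have "\<phi> (X ^ i * Y) = tw_mult q (\<phi> (X ^ i)) (\<phi> Y)"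
    using \<phi>_mult[OF powers_in_A(1)[of i] powers_in_A(2)[of 0]] by simp
  then show ?thesis
    using degree_tw_mult[of "\<phi> (X ^ i)" "\<phi> Y" q] degree_\<phi>_X_power[of i] degree_\<phi>_X_Y by simp
qed

text \<open>
  The powers of \<open>x\<close> raise degrees in \<open>\<tau>\<close> by multiples of 4, their products with \<open>y\<close> by numbers that
  are 2 modulo 4; so no cancellation of leading terms is possible.
\<close>

lemma degree_motive_act:
  assumes "u \<noteq> 0 \<or> v \<noteq> 0" "\<omega> \<noteq> 0"
  shows "degree (motive_act q F \<phi> u v \<omega>) = degree \<omega> + 2 * inf_degree u v"
    "motive_act q F \<phi> u v \<omega> \<noteq> 0"
proof -
  define A where "A = (\<Sum>i\<le>degree u. smult (coeff u i) (tw_mult q \<omega> (\<phi> (X ^ i))))"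
  define B where "B = (\<Sum>i\<le>degree v. smult (coeff v i) (tw_mult q \<omega> (\<phi> (X ^ i * Y))))"
  have act: "motive_act q F \<phi> u v \<omega> = A + B" unfolding motive_act_def A_def B_def ..
  have A: "degree A = degree \<omega> + 4 * degree u \<and> A \<noteq> 0" if "u \<noteq> 0"
    unfolding A_def using that degree_\<phi>_X_power degree_tw_mult[OF assms(2)]
    by (intro conjI degree_sum_increasing[where d = "\<lambda>i. degree \<omega> + 4 * i"]) (auto simp: strict_mono_def)
  have B: "degree B = degree \<omega> + (4 * degree v + 6) \<and> B \<noteq> 0" if "v \<noteq> 0"
    unfolding B_def using that degree_\<phi>_X_power_Y degree_tw_mult[OF assms(2)]
    by (intro conjI degree_sum_increasing[where d = "\<lambda>i. degree \<omega> + (4 * i + 6)"]) (auto simp: strict_mono_def)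
  have A0: "A = 0" if "u = 0" using that by (simp add: A_def)
  have B0: "B = 0" if "v = 0" using that by (simp add: B_def)
  have "degree (A + B) = degree \<omega> + 2 * inf_degree u v \<and> A + B \<noteq> 0"
  proof (cases "u = 0 \<or> v = 0")
    case True
    then show ?thesis using assms(1) A A0 B B0 by (auto simp: inf_degree_def)
  next
    case False
    have "4 * degree u \<noteq> 4 * degree v + 6" by presburger
    then consider "degree A < degree B" | "degree B < degree A" using A B False by fastforce
    then show ?thesis
    proof cases
      case 1
      then show ?thesis
        using A B False degree_add_eq_right[of A B] by (auto simp: inf_degree_def)
    next
      case 2
      then show ?thesis
        using A B False degree_add_eq_left[of B A] by (auto simp: inf_degree_def)
    qed
  qed
  then show "degree (motive_act q F \<phi> u v \<omega>) = degree \<omega> + 2 * inf_degree u v"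
    "motive_act q F \<phi> u v \<omega> \<noteq> 0" unfolding act by auto
qed

lemma \<iota>_eq_0_imp: "\<iota> \<omega> = 0 \<Longrightarrow> \<omega> = 0"
  using fibre degree_motive_act(2) el_eq_0_iff unfolding generic_fibre_def by metis

lemma \<tau>_s: "\<tau> s = \<iota> tau"
  unfolding tau_\<iota> tw_mult_1_right[folded one_pCons] ..

text \<open>
  Multiples of \<open>s\<close> have even degree in \<open>\<tau>\<close>, multiples of \<open>\<tau> s\<close> have odd degree.
\<close>

lemma independent_coord:
  assumes eq: "scale (el u v) s + scale (el u' v') (\<tau> s) = 0"
  shows "el u v = 0 \<and> el u' v' = 0"
proof (rule ccontr)
  assume nz: "\<not> ?thesis"
  let ?A = "motive_act q F \<phi> u v 1" and ?B = "motive_act q F \<phi> u' v' tau"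
  have "\<iota> (?A + ?B) = 0" unfolding \<iota>_add \<iota>_act \<tau>_s[symmetric] by (rule eq)
  then have sum: "?A + ?B = 0" by (rule \<iota>_eq_0_imp)
  have tau0: "(tau :: 'l poly) \<noteq> 0" by (simp add: tau_def)
  have A: "u \<noteq> 0 \<or> v \<noteq> 0 \<Longrightarrow> ?A \<noteq> 0 \<and> degree ?A = 2 * inf_degree u v"
    using degree_motive_act[of u v 1] by simp
  have B: "u' \<noteq> 0 \<or> v' \<noteq> 0 \<Longrightarrow> ?B \<noteq> 0 \<and> degree ?B = 2 * inf_degree u' v' + 1"
    using degree_motive_act[of u' v' tau] tau0 by (simp add: degree_tau)
  have A0: "\<not> (u \<noteq> 0 \<or> v \<noteq> 0) \<Longrightarrow> ?A = 0" and B0: "\<not> (u' \<noteq> 0 \<or> v' \<noteq> 0) \<Longrightarrow> ?B = 0"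
    by (auto simp: motive_act_def)
  have "(u \<noteq> 0 \<or> v \<noteq> 0) \<and> (u' \<noteq> 0 \<or> v' \<noteq> 0)"
    using nz sum A B A0 B0 unfolding el_eq_0_iff by (metis add_0_left add_0_right)
  moreover have "degree ?A = degree ?B" using sum by (metis add_eq_0_iff degree_minus)
  ultimately have "2 * inf_degree u v = 2 * inf_degree u' v' + 1" using A B by simp
  then show False by presburger
qed

lemma independent_s_\<tau>s:
  assumes "scale g s + scale g' (\<tau> s) = 0"
  shows "g = 0 \<and> g' = 0"
proof -
  obtain u v d where 1: "d \<noteq> 0" "px d * g = el u v" by (rule fraction_px)
  obtain u' v' d' where 2: "d' \<noteq> 0" "px d' * g' = el u' v'" by (rule fraction_px)
  have "scale (px d * px d') (scale g s + scale g' (\<tau> s)) = 0" using assms by simp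
  then have eq: "scale (px d * px d' * g) s + scale (px d * px d' * g') (\<tau> s) = 0"
    by (simp add: scale_right_distrib)
  have "px d * px d' * g = px d' * (px d * g)" "px d * px d' * g' = px d * (px d' * g')"
    by (simp_all add: mult_ac)
  then have "px d * px d' * g = el (d' * u) (d' * v)" "px d * px d' * g' = el (d * u') (d * v')"
    unfolding 1(2) 2(2) by (simp_all add: el_px px_mult algebra_simps)
  then have "px d * px d' * g = 0 \<and> px d * px d' * g' = 0"
    using eq independent_coord by metis
  then show ?thesis using 1(1) 2(1) by (simp add: px_eq_0_iff)
qed

lemma s_\<tau>s_coeffs:
  assumes "scale g s + scale g' (\<tau> s) = scale k s + scale k' (\<tau> s)"
  shows "g = k" "g' = k'"
proof -
  have "scale (g - k) s + scale (g' - k') (\<tau> s) = 0"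
    using assms by (simp add: scale_left_diff_distrib algebra_simps)
  then have "g - k = 0 \<and> g' - k' = 0" by (rule independent_s_\<tau>s)
  then show "g = k" "g' = k'" by auto
qed

lemma scale_\<tau>s_cancel: "scale g (\<tau> s) = scale k (\<tau> s) \<Longrightarrow> g = k"
  using s_\<tau>s_coeffs(2)[of 0 g 0 k] by simp

lemma scale_emb: "scale (emb F c) (\<iota> \<omega>) = \<iota> (smult c \<omega>)"
  using \<iota>_act[of "[:c:]" 0 \<omega>] by (simp add: motive_act_def el_px \<phi>_1 tw_mult_1_right)

lemma scale_X: "scale X (\<iota> \<omega>) = \<iota> (tw_mult q \<omega> (\<phi> X))"
proof -
  have "{..Suc 0} = {0, 1}" by auto
  then show ?thesis using \<iota>_act[of "[:0, 1:]" 0 \<omega>] by (simp add: motive_act_def el_px emb_simps)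
qed

lemma scale_Y: "scale Y (\<iota> \<omega>) = \<iota> (tw_mult q \<omega> (\<phi> Y))"
  using \<iota>_act[of 0 1 \<omega>] by (simp add: motive_act_def el_px)

lemma twist_unique_on_\<tau>s: "\<tau> (scale g s) = scale k (\<tau> s) \<Longrightarrow> twist q F g = k"
  using scale_\<tau>s_cancel \<tau>_scale by metis

text \<open>
  A scalar is determined by its multiple of \<open>\<tau> s\<close>. So the laws of the twist can be
  read off from the semilinearity of \<open>\<tau>\<close>.
\<close>

lemma twist_hom: "is_field_hom (twist q F)"
  unfolding is_field_hom_def
proof (intro conjI allI)
  show "twist q F 1 = 1" by (rule twist_unique_on_\<tau>s) simp
  fix a b
  show "twist q F (a + b) = twist q F a + twist q F b"
    by (rule twist_unique_on_\<tau>s) (simp add: scale_left_distrib \<tau>_add \<tau>_scale)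
  show "twist q F (a * b) = twist q F a * twist q F b"
    by (rule twist_unique_on_\<tau>s) (simp add: \<tau>_scale flip: scale_scale)
qed

lemma twist_emb: "twist q F (emb F c) = emb F (c ^ q)"
proof (rule twist_unique_on_\<tau>s)
  have "smult c (1 :: 'l poly) = monom c 0" by (simp add: monom_0 one_pCons)
  moreover have "smult (c ^ q) (tau :: 'l poly) = monom (c ^ q) 1" by (simp add: tau_def smult_monom)
  ultimately show "\<tau> (scale (emb F c) s) = scale (emb F (c ^ q)) (\<tau> s)"
    unfolding \<tau>_s scale_emb unfolding tau_\<iota> using tw_mult_tau_monom[OF q_pos, of c 0] by simp
qed

lemma twist_X: "twist q F X = X"
proof (rule twist_unique_on_\<tau>s)
  have "tw_mult q 1 (\<phi> X) = \<phi> X" using tw_mult_1_left[of q "\<phi> X"] by (simp add: one_pCons)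
  then have "\<tau> (scale X s) = \<iota> (tw_mult q tau (\<phi> X))" by (simp only: scale_X tau_\<iota>)
  also have "\<dots> = scale X (\<tau> s)" unfolding \<tau>_s by (rule scale_X[symmetric])
  finally show "\<tau> (scale X s) = scale X (\<tau> s)" .
qed

lemma twist_Y: "twist q F Y = Y"
proof (rule twist_unique_on_\<tau>s)
  have "tw_mult q 1 (\<phi> Y) = \<phi> Y" using tw_mult_1_left[of q "\<phi> Y"] by (simp add: one_pCons)
  then have "\<tau> (scale Y s) = \<iota> (tw_mult q tau (\<phi> Y))" by (simp only: scale_Y tau_\<iota>)
  also have "\<dots> = scale Y (\<tau> s)" unfolding \<tau>_s by (rule scale_Y[symmetric])
  finally show "\<tau> (scale Y s) = scale Y (\<tau> s)" .
qed

lemmas twist_simps = is_field_hom_simps[OF twist_hom] twist_emb twist_X twist_Y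

lemma \<tau>\<tau>s: "\<tau> (\<tau> s) = \<iota> (monom 1 2)" and \<tau>\<tau>\<tau>s: "\<tau> (\<tau> (\<tau> s)) = \<iota> (monom 1 3)"
proof -
  show 2: "\<tau> (\<tau> s) = \<iota> (monom 1 2)"
    using tw_mult_tau_monom[OF q_pos, of "1 :: 'l" 1] unfolding \<tau>_s unfolding tau_\<iota>
    by (simp add: tau_def numeral_2_eq_2)
  show "\<tau> (\<tau> (\<tau> s)) = \<iota> (monom 1 3)"
    unfolding 2 unfolding tau_\<iota> using tw_mult_tau_monom[OF q_pos, of "1 :: 'l" 2] by (simp add: numeral_3_eq_3 numeral_2_eq_2)
qed

text \<open>
  The coordinate ring multiples of \<open>s\<close> and \<open>\<tau> s\<close> contain elements of all degrees in \<open>\<tau>\<close> except 2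
  and 3, which accounts for the two additional terms.
\<close>

lemma motive_normal_form:
  "\<exists>U \<in> coord_ring F. \<exists>R \<in> coord_ring F. \<exists>c d.
     \<iota> \<omega> = scale U s + scale R (\<tau> s) + scale (emb F c) (\<tau> (\<tau> s)) + scale (emb F d) (\<tau> (\<tau> (\<tau> s)))"
proof -
  define comb where "comb U R c d =
      scale U s + scale R (\<tau> s) + scale (emb F c) (\<tau> (\<tau> s)) + scale (emb F d) (\<tau> (\<tau> (\<tau> s)))" for U R c d
  define N where "N \<omega> \<longleftrightarrow> (\<exists>U R c d. U \<in> coord_ring F \<and> R \<in> coord_ring F \<and> \<iota> \<omega> = comb U R c d)" for \<omega>
  have NI: "N \<omega>" if "U \<in> coord_ring F" "R \<in> coord_ring F" "\<iota> \<omega> = comb U R c d" for U R c d \<omega>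
    unfolding N_def using that by blast
  have N_add: "N (\<omega> + \<psi>)" if N1: "N \<omega>" and N2: "N \<psi>" for \<omega> \<psi>
  proof -
    obtain U R c d where 1: "U \<in> coord_ring F" "R \<in> coord_ring F" "\<iota> \<omega> = comb U R c d"
      using N1 unfolding N_def by blast
    obtain U' R' c' d' where 2: "U' \<in> coord_ring F" "R' \<in> coord_ring F" "\<iota> \<psi> = comb U' R' c' d'"
      using N2 unfolding N_def by blast
    have eq: "\<iota> (\<omega> + \<psi>) = comb (U + U') (R + R') (c + c') (d + d')"
      unfolding \<iota>_add 1(3) 2(3) comb_def by (simp only: emb_simps(3) scale_left_distrib add_ac)
    show ?thesis by (rule NI[OF _ _ eq]) (use 1 2 in simp_all)
  qed
  have N_smult: "N (smult e \<omega>)" if N1: "N \<omega>" for e \<omega>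
  proof -
    obtain U R c d where 1: "U \<in> coord_ring F" "R \<in> coord_ring F" "\<iota> \<omega> = comb U R c d"
      using N1 unfolding N_def by blast
    have eq: "\<iota> (smult e \<omega>) = comb (emb F e * U) (emb F e * R) (e * c) (e * d)"
      unfolding scale_emb[symmetric] 1(3) comb_def
      by (simp only: emb_simps(4) scale_right_distrib scale_scale)
    show ?thesis by (rule NI[OF _ _ eq]) (use 1 in simp_all)
  qed
  have N_s: "N (motive_act q F \<phi> u v 1)" for u v
    by (rule NI[of "el u v" 0 _ 0 0]) (simp_all add: comb_def \<iota>_act emb_simps(1))
  have N_\<tau>s: "N (motive_act q F \<phi> u v tau)" for u v
    by (rule NI[of 0 "el u v" _ 0 0]) (simp_all add: comb_def \<iota>_act emb_simps(1) \<tau>_s)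
  have tau0: "(tau :: 'l poly) \<noteq> 0" by (simp add: tau_def)
  have all_degrees: "\<exists>\<psi>. N \<psi> \<and> \<psi> \<noteq> 0 \<and> degree \<psi> = n" for n
  proof -
    have deg_x: "inf_degree (monom 1 i) (0 :: 'l poly) = 2 * i"
      and deg_y: "inf_degree 0 (monom (1 :: 'l) i) = 2 * i + 3" for i
      by (simp_all add: inf_degree_def degree_monom_eq)
    have nz: "monom (1 :: 'l) i \<noteq> 0" for i by simp
    have "n = 4 * (n div 4) \<or> n = 4 * (n div 4) + 1 \<or> n = 2 \<or> n = 3 \<or>
        n = 4 * ((n - 6) div 4) + 6 \<or> n = 4 * ((n - 7) div 4) + 7" by presburger
    then consider i where "n = 4 * i" | i where "n = 4 * i + 1" | "n = 2" | "n = 3"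
      | i where "n = 4 * i + 6" | i where "n = 4 * i + 7"
      by blast
    then show ?thesis
    proof cases
      case 1
      then show ?thesis using N_s[of "monom 1 i" 0] degree_motive_act[of "monom 1 i" 0 1] deg_x nz
        by (intro exI[of _ "motive_act q F \<phi> (monom 1 i) 0 1"]) auto
    next
      case 2
      then show ?thesis using N_\<tau>s[of "monom 1 i" 0] degree_motive_act[of "monom 1 i" 0 tau] deg_x nz tau0
        by (intro exI[of _ "motive_act q F \<phi> (monom 1 i) 0 tau"]) (auto simp: degree_tau)
    next
      case 3
      have "N (monom 1 2)" by (rule NI[of 0 0 _ 1 0]) (simp_all add: comb_def \<tau>\<tau>s emb_simps(1,2))
      then show ?thesis using 3 by (intro exI[of _ "monom 1 2"]) (simp add: degree_monom_eq)
    next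
      case 4
      have "N (monom 1 3)" by (rule NI[of 0 0 _ 0 1]) (simp_all add: comb_def \<tau>\<tau>\<tau>s emb_simps(1,2))
      then show ?thesis using 4 by (intro exI[of _ "monom 1 3"]) (simp add: degree_monom_eq)
    next
      case 5
      then show ?thesis using N_s[of 0 "monom 1 i"] degree_motive_act[of 0 "monom 1 i" 1] deg_y nz
        by (intro exI[of _ "motive_act q F \<phi> 0 (monom 1 i) 1"]) auto
    next
      case 6
      then show ?thesis using N_\<tau>s[of 0 "monom 1 i"] degree_motive_act[of 0 "monom 1 i" tau] deg_y nz tau0
        by (intro exI[of _ "motive_act q F \<phi> 0 (monom 1 i) tau"]) (auto simp: degree_tau)
    qed
  qed
  have "N \<omega>"
  proof (induction "degree \<omega>" arbitrary: \<omega> rule: less_induct)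
    case less
    obtain \<psi> where \<psi>: "N \<psi>" "\<psi> \<noteq> 0" "degree \<psi> = degree \<omega>" using all_degrees by blast
    define e where "e = lead_coeff \<omega> / lead_coeff \<psi>"
    define \<rho> where "\<rho> = \<omega> - smult e \<psi>"
    have "coeff \<psi> (degree \<omega>) \<noteq> 0" using \<psi>(2,3) leading_coeff_0_iff[of \<psi>] by simp
    then have "coeff \<rho> (degree \<omega>) = 0" using \<psi>(3) unfolding \<rho>_def e_def by simp
    moreover have "degree \<rho> \<le> degree \<omega>"
      unfolding \<rho>_def using \<psi>(3) degree_diff_le[of \<omega> "degree \<omega>" "smult e \<psi>"] degree_smult_le[of e \<psi>]
      by simp
    ultimately have "\<rho> = 0 \<or> degree \<rho> < degree \<omega>"
      by (metis le_neq_implies_less leading_coeff_0_iff)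
    moreover have "N 0" using N_smult[OF \<psi>(1), of 0] by simp
    ultimately have "N \<rho>" using less by blast
    moreover have "\<omega> = \<rho> + smult e \<psi>" unfolding \<rho>_def by simp
    ultimately show ?case using N_add N_smult \<psi>(1) by metis
  qed
  then show ?thesis unfolding N_def comb_def by blast
qed

text \<open>
  The determinant with respect to the two coordinates of a dual basis is an alternating form that
  does not vanish on \<open>s\<close> and \<open>\<tau> s\<close>, and it factors through the exterior square.
\<close>

lemma exterior_square_wedge_nonzero:
  assumes "exterior_square scale scale2 wedge"
  shows "wedge s (\<tau> s) \<noteq> 0"
proof
  assume zero: "wedge s (\<tau> s) = 0"
  have "vector_space ((*) :: 'k \<Rightarrow> 'k \<Rightarrow> 'k)" by unfold_locales (simp_all add: algebra_simps)
  then interpret pair: vector_space_pair scale "(*) :: 'k \<Rightarrow> 'k \<Rightarrow> 'k"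
    by (simp add: vector_space_pair_def vector_space_axioms)
  have "s \<noteq> 0" using independent_s_\<tau>s[of 1 0] by auto
  have "\<tau> s \<notin> span {s}"
  proof
    assume "\<tau> s \<in> span {s}"
    then obtain k where "\<tau> s = scale k s" by (auto simp: span_singleton)
    then have "scale (- k) s + scale 1 (\<tau> s) = 0" by simp
    then show False using independent_s_\<tau>s by fastforce
  qed
  then have ind: "independent {\<tau> s, s}" and ne: "\<tau> s \<noteq> s"
    using \<open>s \<noteq> 0\<close> independent_insertI[of "\<tau> s" "{s}"] span_base[of s "{s}"] by auto
  obtain l where l: "Vector_Spaces.linear scale (*) l" "l s = 1" "l (\<tau> s) = 0"
    using pair.linear_independent_extend[OF ind, of "\<lambda>z. if z = s then 1 else 0"] ne by auto
  obtain l' where l': "Vector_Spaces.linear scale (*) l'" "l' s = 0" "l' (\<tau> s) = 1"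
    using pair.linear_independent_extend[OF ind, of "\<lambda>z. if z = s then 0 else 1"] ne by auto
  define B where "B y z = l y * l' z - l z * l' y" for y z
  have lin: "k (y + z) = k y + k z" "k (scale c y) = c * k y" "vector_space ((*) :: 'k \<Rightarrow> 'k \<Rightarrow> 'k)"
    if "Vector_Spaces.linear scale ((*) :: 'k \<Rightarrow> 'k \<Rightarrow> 'k) k" for k y z c
    using that unfolding Vector_Spaces.linear_iff by (elim conjE, blast)+
  note lin_l = lin[OF l(1)] lin[OF l'(1)]
  have lin_B: "Vector_Spaces.linear scale (*) (B z)" "Vector_Spaces.linear scale (*) (\<lambda>y. B y z)" for z
    unfolding Vector_Spaces.linear_iff
    using lin_l(3) vector_space_axioms by (auto simp: B_def lin_l(1,2,4,5) ring_distribs)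
  have alt: "alternating_bilinear scale ((*) :: 'k \<Rightarrow> 'k \<Rightarrow> 'k) B"
    unfolding alternating_bilinear_def using lin_B by (simp add: B_def)
  have "\<exists>k. Vector_Spaces.linear scale2 (*) k \<and> (\<forall>y z. k (wedge y z) = B y z)"
    using assms alt unfolding exterior_square_def by simp
  then obtain k where k: "Vector_Spaces.linear scale2 (*) k" "\<And>y z. k (wedge y z) = B y z"
    by blast
  have "B s (\<tau> s) = 1" unfolding B_def using l l' by simp
  moreover have "k 0 = 0"
  proof -
    have "k (0 + 0) = k 0 + k 0" using k(1) unfolding Vector_Spaces.linear_iff by blast
    then have "k 0 + k 0 = k 0 + 0" by (simp only: add_0_right)
    then show ?thesis by (rule add_left_imp_eq)
  qed
  ultimately show False using k(2)[of s "\<tau> s"] zero by simp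
qed

end

section \<open>The chord through a point and its Frobenius conjugate\<close>

lemma frobenius_hom:
  assumes "prime CHAR('l::field)" "q = CHAR('l) ^ e"
  shows "is_field_hom (\<lambda>c::'l. c ^ q)"
  unfolding is_field_hom_def
  using assms freshmans_dream'[where ?'a = 'l, of q e] by (auto simp: power_mult_distrib)

lemma on_curve_cases:
  assumes "on_curve E a b" "on_curve E a b'"
  shows "b' = b \<or> b' = neg_y E a b"
proof -
  have "(b' - b) * (b' - neg_y E a b) = 0"
    using assms unfolding on_curve_def neg_y_def by (simp add: algebra_simps power2_eq_square)
  then show ?thesis by auto
qed

text \<open>
  The chord through \<open>V\<close> and the inverse of \<open>V\<^sup>(\<^sup>1\<^sup>)\<close> meets the curve in the inverse of \<open>\<xi>\<close>; the
  negative of this chord is the line with slope \<open>m\<close> through \<open>\<xi>\<close>, \<open>V\<^sup>(\<^sup>1\<^sup>)\<close> and the inverse of \<open>V\<close>.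
  The slope is well defined as \<open>\<xi>\<close> is generic: if \<open>\<alpha>\<close> were fixed by the Frobenius map, then
  \<open>V\<^sup>(\<^sup>1\<^sup>)\<close> would be \<open>V\<close>, hence \<open>\<xi>\<close> the point at infinity, or the inverse of \<open>V\<close>, hence \<open>\<xi> = 2V\<close>.
  In the second case the Frobenius map sends \<open>\<xi>\<close> to its inverse and fixes \<open>\<theta>\<close>.
\<close>

lemma frobenius_chord:
  fixes E :: "'l::field weierstrass"
  assumes hom: "is_field_hom (\<lambda>c::'l. c ^ q)" and E: "elliptic_curve_over (finite_subfield q) E"
    and gen: "generic_point q E \<theta> \<eta>" and V: "on_curve E \<alpha> \<beta>"
    and sum: "point_add E (Aff \<alpha> \<beta>) (point_neg E (point_frob q (Aff \<alpha> \<beta>))) = Aff \<theta> \<eta>"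
    and m: "m = (\<beta> ^ q - neg_y E \<alpha> \<beta>) / (\<alpha> ^ q - \<alpha>)"
  shows "\<alpha> ^ q \<noteq> \<alpha>" "neg_y E \<alpha> \<beta> = \<eta> + m * (\<alpha> - \<theta>)" "\<beta> ^ q = \<eta> + m * (\<alpha> ^ q - \<theta>)"
    "m\<^sup>2 + a1 E * m - a2 E = \<theta> + \<alpha> + \<alpha> ^ q" "on_curve E (\<alpha> ^ q) (\<beta> ^ q)"
    "(neg_y E \<alpha> \<beta>) ^ q = neg_y E (\<alpha> ^ q) (\<beta> ^ q)" "a1 E ^ q = a1 E"
proof -
  note fr = is_field_hom_simps[OF hom]
  have coeffs: "a1 E ^ q = a1 E" "a2 E ^ q = a2 E" "a3 E ^ q = a3 E" "a4 E ^ q = a4 E" "a6 E ^ q = a6 E"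
    using E unfolding elliptic_curve_over_def finite_subfield_def by auto
  show "a1 E ^ q = a1 E" by fact
  show V': "on_curve E (\<alpha> ^ q) (\<beta> ^ q)"
  proof -
    have "(\<beta>\<^sup>2 + a1 E * \<alpha> * \<beta> + a3 E * \<beta>) ^ q = (\<alpha> ^ 3 + a2 E * \<alpha>\<^sup>2 + a4 E * \<alpha> + a6 E) ^ q"
      using V unfolding on_curve_def by simp
    then show ?thesis unfolding on_curve_def by (simp add: fr(3,4,8) coeffs)
  qed
  show neg_frob: "(neg_y E \<alpha> \<beta>) ^ q = neg_y E (\<alpha> ^ q) (\<beta> ^ q)"
    unfolding neg_y_def by (simp add: fr(3-6) coeffs)
  let ?d = "neg_y E (\<alpha> ^ q) (\<beta> ^ q)"
  show ne: "\<alpha> ^ q \<noteq> \<alpha>"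
  proof
    assume eq: "\<alpha> ^ q = \<alpha>"
    have "\<beta> ^ q \<noteq> \<beta>" using sum by (auto simp: eq)
    then have \<beta>q: "\<beta> ^ q = neg_y E \<alpha> \<beta>" using on_curve_cases[OF V] V' eq by auto
    \<comment> \<open>The tangent at \<open>V\<close> has slope \<open>t\<close>; its Frobenius conjugate is the tangent at the inverse of \<open>V\<close>.\<close>
    define n where "n = 3 * \<alpha>\<^sup>2 + 2 * a2 E * \<alpha> + a4 E - a1 E * \<beta>"
    define k where "k = 2 * \<beta> + a1 E * \<alpha> + a3 E"
    define t where "t = n / k"
    have k0: "k \<noteq> 0"
    proof
      assume "k = 0"
      then have "neg_y E \<alpha> \<beta> = \<beta>" unfolding neg_y_def k_def by (simp add: algebra_simps eq_neg_iff_add_eq_0)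
      then show False using \<open>\<beta> ^ q \<noteq> \<beta>\<close> \<beta>q by simp
    qed
    have \<theta>: "\<theta> = t\<^sup>2 + a1 E * t - a2 E - \<alpha> - \<alpha>"
      using sum \<beta>q \<open>\<beta> ^ q \<noteq> \<beta>\<close> by (auto simp: eq Let_def n_def k_def t_def neg_y_def split: if_splits)
    have nums: "(2::'l) ^ q = 2" "(3::'l) ^ q = 3"
      using fr(3)[of 1 1] fr(3)[of 2 1] by simp_all
    have "n ^ q = n - a1 E * (neg_y E \<alpha> \<beta> - \<beta>)"
      unfolding n_def by (simp add: fr(3,4,6,8) coeffs nums eq \<beta>q algebra_simps)
    moreover have "k ^ q = - k"
      unfolding k_def by (simp add: fr(3,4) coeffs nums eq \<beta>q) (simp add: neg_y_def)
    ultimately have "t ^ q = (n + a1 E * k) / (- k)"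
      unfolding t_def by (simp add: fr(7) neg_y_def k_def algebra_simps)
    then have tq: "t ^ q = - t - a1 E" using k0 unfolding t_def by (simp add: field_simps)
    have \<theta>q: "\<theta> ^ q = \<theta>"
      unfolding \<theta> by (simp add: fr(3,4,6,8) coeffs eq tq nums) (simp add: algebra_simps power2_eq_square)
    have "[:- \<theta>, 1:] \<in> poly_over (finite_subfield q)"
      unfolding poly_over_def finite_subfield_def
      using \<theta>q fr(1,2) by (auto simp: coeff_pCons fr(5) split: nat.splits)
    moreover have "0 \<in> poly_over (finite_subfield q)"
      using fr(1) by (simp add: poly_over_def finite_subfield_def)
    ultimately have "[:- \<theta>, 1:] = 0" using gen unfolding generic_point_def by fastforce
    then show False by simp
  qed
  define t where "t = (?d - \<beta>) / (\<alpha> ^ q - \<alpha>)"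
  have \<theta>: "\<theta> = t\<^sup>2 + a1 E * t - a2 E - \<alpha> - \<alpha> ^ q" and \<eta>: "\<eta> = neg_y E \<theta> (\<beta> + t * (\<theta> - \<alpha>))"
    using sum ne by (auto simp: Let_def t_def)
  \<comment> \<open>Negation on the curve turns the slope \<open>t\<close> into \<open>- t - a1\<close>.\<close>
  have diff: "\<alpha> ^ q - \<alpha> \<noteq> 0" using ne by simp
  have t: "t = - m - a1 E"
    using diff unfolding t_def m neg_y_def by (simp add: field_simps)
  have mdiff: "m * (\<alpha> ^ q - \<alpha>) = \<beta> ^ q - neg_y E \<alpha> \<beta>" using diff unfolding m by simp
  show L1: "neg_y E \<alpha> \<beta> = \<eta> + m * (\<alpha> - \<theta>)"
    unfolding \<eta> t neg_y_def by (simp add: algebra_simps)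
  have "\<beta> ^ q = neg_y E \<alpha> \<beta> + m * (\<alpha> ^ q - \<alpha>)" using mdiff by simp
  then show "\<beta> ^ q = \<eta> + m * (\<alpha> ^ q - \<theta>)" unfolding L1 by (simp add: algebra_simps)
  show "m\<^sup>2 + a1 E * m - a2 E = \<theta> + \<alpha> + \<alpha> ^ q"
    unfolding \<theta> t by (simp add: algebra_simps power2_eq_square)
qed

text \<open>
  The product of the chord \<open>y - g(x)\<close> and of the twist \<open>y - l'(x)\<close> of the line with slope \<open>\<kappa>\<close> is
  divisible by \<open>x - \<alpha>'\<close>, since the two pass through opposite points over \<open>\<alpha>'\<close>. The two equations
  are the coefficients of \<open>y\<close> and 1 in this product, and the quotient is
  \<open>(x + \<gamma>) (x - \<alpha>) - \<mu> (y - l(x))\<close>: this is where the constant \<open>\<gamma>\<close> comes from. In the second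
  equation both sides are monic cubics with the same coefficient of \<open>x\<^sup>2\<close>, so it is enough to
  compare their values at \<open>\<alpha>\<close> and \<open>\<alpha>'\<close>.
\<close>

lemma chord_times_twisted_line:
  fixes E :: "'l::field weierstrass"
  assumes V: "on_curve E \<alpha> \<beta>" and V': "on_curve E \<alpha>' \<beta>'" and ne: "\<alpha>' \<noteq> \<alpha>"
    and L1: "neg_y E \<alpha> \<beta> = \<eta> + m * (\<alpha> - \<theta>)" and L2: "\<beta>' = \<eta> + m * (\<alpha>' - \<theta>)"
    and L3: "m\<^sup>2 + a1 E * m - a2 E = \<theta> + \<alpha> + \<alpha>'"
    and \<mu>: "\<mu> = \<kappa>' + m + a1 E" and \<gamma>: "\<gamma> = \<mu> * (m - \<kappa>) - \<theta>"
  defines "g \<equiv> [:\<eta> - m * \<theta>, m:]" and "l \<equiv> [:neg_y E \<alpha> \<beta> - \<kappa> * \<alpha>, \<kappa>:]"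
    and "l' \<equiv> [:neg_y E \<alpha>' \<beta>' - \<kappa>' * \<alpha>', \<kappa>':]"
  shows "weier_lin E + g + l' = smult \<mu> [:- \<alpha>', 1:]"
    "weier_cubic E + g * l' = [:- \<alpha>', 1:] * ([:\<gamma>, 1:] * [:- \<alpha>, 1:] + smult \<mu> l)"
proof -
  have gx: "poly g \<alpha> = neg_y E \<alpha> \<beta>" "poly g \<alpha>' = \<beta>'"
    unfolding g_def L1 L2 by (simp_all add: algebra_simps)
  show lin: "weier_lin E + g + l' = smult \<mu> [:- \<alpha>', 1:]"
    unfolding weier_lin_def g_def l'_def \<mu> neg_y_def L2 by (simp add: algebra_simps)
  define T where "T = weier_cubic E + g * l' - [:- \<alpha>', 1:] * ([:\<gamma>, 1:] * [:- \<alpha>, 1:] + smult \<mu> l)"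
  have a2: "a2 E = m\<^sup>2 + a1 E * m - \<theta> - \<alpha> - \<alpha>'" using L3 by (simp add: algebra_simps)
  obtain t0 t1 where T: "T = [:t0, t1:]"
  proof
    show "T = [:coeff T 0, coeff T 1:]"
      unfolding T_def weier_cubic_def g_def l_def l'_def \<gamma> \<mu> a2
      by (simp add: algebra_simps power2_eq_square)
  qed
  have cubic: "poly (weier_cubic E) a = b\<^sup>2 + poly (weier_lin E) a * b" if "on_curve E a b" for a b
    using that unfolding on_curve_def weier_cubic_def weier_lin_def
    by (simp add: algebra_simps power2_eq_square power3_eq_cube)
  have ln: "neg_y E a b = - b - poly (weier_lin E) a" for a b
    unfolding neg_y_def weier_lin_def by (simp add: algebra_simps)
  have l'x: "poly l' x = \<mu> * (x - \<alpha>') - poly g x - poly (weier_lin E) x" for x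
    using arg_cong[OF lin, of "\<lambda>p. poly p x"] by (simp add: algebra_simps)
  have lx: "poly l \<alpha> = neg_y E \<alpha> \<beta>" unfolding l_def by (simp add: algebra_simps)
  have "poly T \<alpha> = 0"
    unfolding T_def by (simp add: cubic[OF V] gx l'x lx) (simp add: ln algebra_simps power2_eq_square)
  moreover have "poly T \<alpha>' = 0"
    unfolding T_def by (simp add: cubic[OF V'] gx l'x) (simp add: algebra_simps power2_eq_square)
  ultimately have t: "t0 + \<alpha> * t1 = 0" "t0 + \<alpha>' * t1 = 0" unfolding T by simp_all
  have "t1 * (\<alpha>' - \<alpha>) = (t0 + \<alpha>' * t1) - (t0 + \<alpha> * t1)" by (simp add: algebra_simps)
  then have "t1 * (\<alpha>' - \<alpha>) = 0" unfolding t by simp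
  then have "t1 = 0" using ne by simp
  then have "T = 0" using t unfolding T by simp
  then show "weier_cubic E + g * l' = [:- \<alpha>', 1:] * ([:\<gamma>, 1:] * [:- \<alpha>, 1:] + smult \<mu> l)"
    unfolding T_def by simp
qed

text \<open>
  Negation turns the line \<open>y - l(x)\<close> into \<open>y + p(x)\<close> up to sign, and the product of the two is
  \<open>weier_cubic - l p\<close>. Over \<open>\<alpha>\<close> the line passes through the inverse of \<open>V\<close>; the other two points
  of intersection have the zeros of the quadratic factor as \<open>x\<close>-coordinates.
\<close>

lemma line_norm:
  fixes E :: "'l::field weierstrass" and \<alpha> \<beta> \<kappa> :: 'l
  assumes V: "on_curve E \<alpha> \<beta>"
  defines "l \<equiv> [:neg_y E \<alpha> \<beta> - \<kappa> * \<alpha>, \<kappa>:]" and "p \<equiv> [:- (\<kappa> + a1 E) * \<alpha> - \<beta>, \<kappa> + a1 E:]"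
  shows "p = l + weier_lin E" "\<exists>n0 n1. weier_cubic E - l * p = [:- \<alpha>, 1:] * [:n0, n1, 1:]"
proof -
  show "p = l + weier_lin E"
    unfolding p_def l_def weier_lin_def neg_y_def by (simp add: algebra_simps)
  have "poly (weier_cubic E - l * p) \<alpha> = 0"
    using V unfolding on_curve_def weier_cubic_def l_def p_def neg_y_def
    by (simp add: algebra_simps power2_eq_square power3_eq_cube)
  then obtain w where w: "weier_cubic E - l * p = [:- \<alpha>, 1:] * w"
    unfolding poly_eq_0_iff_dvd by (auto elim!: dvdE)
  have form: "weier_cubic E - l * p = [:coeff (weier_cubic E - l * p) 0, coeff (weier_cubic E - l * p) 1, coeff (weier_cubic E - l * p) 2, 1:]"
    unfolding weier_cubic_def l_def p_def by (simp add: numeral_2_eq_2)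
  have deg: "degree (weier_cubic E - l * p) = 3" and lead: "lead_coeff (weier_cubic E - l * p) = 1"
    by (subst form, simp)+
  have "w \<noteq> 0" using w deg by auto
  then have "degree w = 2" using deg unfolding w by (subst (asm) degree_mult_eq) auto
  moreover have "lead_coeff w = 1" using lead unfolding w lead_coeff_mult by simp
  ultimately have "w = [:coeff w 0, coeff w 1, 1:]"
    by (intro poly_eqI) (auto simp: coeff_pCons numeral_2_eq_2 coeff_eq_0 split: nat.splits)
  then show "\<exists>n0 n1. weier_cubic E - l * p = [:- \<alpha>, 1:] * [:n0, n1, 1:]" using w by metis
qed

section \<open>The relation between \<open>s\<close>, \<open>\<tau> s\<close> and \<open>\<tau>\<^sup>2 s\<close>\<close>

text \<open>
  The coefficients \<open>a = C1 / C2\<close> and \<open>b = C0 / C2\<close> of \<open>\<tau>\<^sup>2 s\<close> have the common denominator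
  \<open>c2(x) = C2\<close>, and \<open>C1 = r1(x) + lam1 y\<close>.
\<close>

locale motive_relation = drinfeld_motive +
  fixes a b :: 'b and c2 r1 :: "'a poly" and c0 c1 lam1 :: 'a
  assumes relation: "\<tau> (\<tau> (\<iota> 1)) = scale b (\<iota> 1) + scale a (\<tau> (\<iota> 1))"
    and c2: "c2 = [:c0, c1, 1:]"
    and c2_a: "px c2 * a = el r1 [:lam1:]"
    and c2_b: "px c2 * b \<in> coord_ring F"
    and lam1: "lam1 \<noteq> 0"
begin

abbreviation "\<sigma> \<equiv> twist q F"

definition vec where "vec g g' = scale g s + scale g' (\<tau> s)"

lemma vec_simps:
  "vec g g' + vec k k' = vec (g + k) (g' + k')" "vec g g' - vec k k' = vec (g - k) (g' - k')"
  "scale k (vec g g') = vec (k * g) (k * g')"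
  unfolding vec_def by (simp_all add: scale_left_distrib scale_left_diff_distrib scale_right_distrib algebra_simps)

lemma vec_eq_iff: "vec g g' = vec k k' \<longleftrightarrow> g = k \<and> g' = k'"
  unfolding vec_def using s_\<tau>s_coeffs by blast

lemma vec_basis: "s = vec 1 0" "\<tau> s = vec 0 1" "\<tau> (\<tau> s) = vec b a"
  unfolding vec_def relation by simp_all

lemma \<tau>_vec: "\<tau> (vec g g') = vec (\<sigma> g' * b) (\<sigma> g + \<sigma> g' * a)"
proof -
  have "\<tau> (vec g g') = scale (\<sigma> g) (\<tau> s) + scale (\<sigma> g') (\<tau> (\<tau> s))"
    unfolding vec_def by (simp only: \<tau>_add \<tau>_scale)
  also have "\<dots> = vec (\<sigma> g' * b) (\<sigma> g + \<sigma> g' * a)"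
    unfolding vec_basis(3) unfolding vec_basis(2) by (simp only: vec_simps) simp
  finally show ?thesis .
qed

lemma \<tau>\<tau>\<tau>s_vec: "\<tau> (\<tau> (\<tau> s)) = vec (\<sigma> a * b) (\<sigma> b + \<sigma> a * a)"
  unfolding vec_basis(3) \<tau>_vec ..

lemma normal_form_vec:
  "\<exists>U \<in> coord_ring F. \<exists>R \<in> coord_ring F. \<exists>c d.
     \<iota> \<omega> = vec (U + emb F c * b + emb F d * (\<sigma> a * b)) (R + emb F c * a + emb F d * (\<sigma> b + \<sigma> a * a))"
proof -
  obtain U R c d where UR: "U \<in> coord_ring F" "R \<in> coord_ring F"
    and eq: "\<iota> \<omega> = scale U s + scale R (\<tau> s) + scale (emb F c) (\<tau> (\<tau> s)) + scale (emb F d) (\<tau> (\<tau> (\<tau> s)))"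
    using motive_normal_form[of \<omega>] by auto
  have "\<iota> \<omega> = vec U R + scale (emb F c) (vec b a) + scale (emb F d) (vec (\<sigma> a * b) (\<sigma> b + \<sigma> a * a))"
    by (simp only: eq vec_def[of U R] vec_basis(3)[symmetric] \<tau>\<tau>\<tau>s_vec[symmetric])
  then show ?thesis using UR unfolding vec_simps by metis
qed

text \<open>
  If \<open>\<tau>\<^sup>3 s\<close> did not occur in the normal form of \<open>x \<tau>\<^sup>2 s\<close>, then \<open>(x - c) C1\<close> would be divisible
  by \<open>C2\<close>. For the coefficients of \<open>y\<close> this means that a quadratic polynomial divides
  \<open>(x - c) lam1\<close>.
\<close>

lemma x_expansion:
  obtains U R c d where "U \<in> coord_ring F" "R \<in> coord_ring F" "d \<noteq> 0"
    "(X - emb F c) * b = U + emb F d * (\<sigma> a * b)"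
    "(X - emb F c) * a = R + emb F d * (\<sigma> b + \<sigma> a * a)"
proof -
  have "scale X (\<tau> (\<tau> s)) = \<iota> (tw_mult q (monom 1 2) (\<phi> X))" unfolding \<tau>\<tau>s scale_X ..
  then obtain U R c d where UR: "U \<in> coord_ring F" "R \<in> coord_ring F"
    and eq: "scale X (\<tau> (\<tau> s)) =
      vec (U + emb F c * b + emb F d * (\<sigma> a * b)) (R + emb F c * a + emb F d * (\<sigma> b + \<sigma> a * a))"
    using normal_form_vec[of "tw_mult q (monom 1 2) (\<phi> X)"] by auto
  from eq have 1: "X * b = U + emb F c * b + emb F d * (\<sigma> a * b)"
    and 2: "X * a = R + emb F c * a + emb F d * (\<sigma> b + \<sigma> a * a)"
    unfolding vec_basis(3) vec_simps vec_eq_iff by auto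
  have "d \<noteq> 0"
  proof
    assume d: "d = 0"
    obtain u v where R: "R = el u v" using UR(2) unfolding coord_ring_iff by blast
    have "(X - emb F c) * a = R" using 2 unfolding d by (simp add: emb_simps(1) algebra_simps)
    then have "(X - emb F c) * (px c2 * a) = px c2 * R" by (simp add: mult_ac)
    then have "el ([:- c, 1:] * r1) ([:- c, 1:] * [:lam1:]) = el (c2 * u) (c2 * v)"
      unfolding c2_a R by (simp add: el_px px_simps emb_simps algebra_simps)
    then have eq: "[:- c, 1:] * [:lam1:] = c2 * v" unfolding el_eq_iff by blast
    then have "v \<noteq> 0" using lam1 by auto
    then have "degree (c2 * v) \<ge> 2" using c2 by (subst degree_mult_eq) auto
    then show False unfolding eq[symmetric] using lam1 by simp
  qed
  moreover have "(X - emb F c) * b = U + emb F d * (\<sigma> a * b)" using 1 by (simp add: algebra_simps)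
  moreover have "(X - emb F c) * a = R + emb F d * (\<sigma> b + \<sigma> a * a)" using 2 by (simp add: algebra_simps)
  ultimately show thesis using that UR by blast
qed

text \<open>
  As \<open>\<tau>\<^sup>3 s\<close> occurs in \<open>x \<tau>\<^sup>2 s\<close>, the motive is generated by \<open>s\<close>, \<open>\<tau> s\<close> and \<open>\<tau>\<^sup>2 s\<close>.
\<close>

lemma motive_generated:
  "\<exists>U \<in> coord_ring F. \<exists>R \<in> coord_ring F. \<exists>r \<in> coord_ring F. \<iota> \<omega> = vec (U + r * b) (R + r * a)"
proof -
  obtain U0 R0 c0 d0 where 0: "U0 \<in> coord_ring F" "R0 \<in> coord_ring F" "d0 \<noteq> 0"
    "(X - emb F c0) * b = U0 + emb F d0 * (\<sigma> a * b)"
    "(X - emb F c0) * a = R0 + emb F d0 * (\<sigma> b + \<sigma> a * a)" by (rule x_expansion)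
  obtain U R c d where 1: "U \<in> coord_ring F" "R \<in> coord_ring F"
    "\<iota> \<omega> = vec (U + emb F c * b + emb F d * (\<sigma> a * b)) (R + emb F c * a + emb F d * (\<sigma> b + \<sigma> a * a))"
    using normal_form_vec[of \<omega>] by auto
  define e where "e = emb F (d / d0)"
  have ed: "e * emb F d0 = emb F d" unfolding e_def using 0(3) by (simp flip: emb_simps(4))
  have db: "emb F d * (\<sigma> a * b) = e * ((X - emb F c0) * b - U0)"
    unfolding 0(4) ed[symmetric] by (simp add: mult_ac)
  have da: "emb F d * (\<sigma> b + \<sigma> a * a) = e * ((X - emb F c0) * a - R0)"
    unfolding 0(5) ed[symmetric] by (simp add: mult_ac)
  have "\<iota> \<omega> = vec ((U - e * U0) + (emb F c + e * (X - emb F c0)) * b)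
      ((R - e * R0) + (emb F c + e * (X - emb F c0)) * a)"
    unfolding 1(3) db da by (simp add: algebra_simps)
  moreover have "e \<in> coord_ring F" unfolding e_def by simp
  ultimately show ?thesis using 0 1
    by (intro bexI[of _ "U - e * U0"] bexI[of _ "R - e * R0"] bexI[of _ "emb F c + e * (X - emb F c0)"]) simp_all
qed

text \<open>
  The normal form of \<open>y \<tau>\<^sup>2 s\<close> contains \<open>\<tau>\<^sup>3 s\<close>, which the one of \<open>x \<tau>\<^sup>2 s\<close> expresses by
  \<open>(x - c0) \<tau>\<^sup>2 s\<close> up to multiples of \<open>s\<close> and \<open>\<tau> s\<close>.
\<close>

lemma y_relation:
  obtains k0 k where "(Y - px [:k0, k:]) * a \<in> coord_ring F" "(Y - px [:k0, k:]) * b \<in> coord_ring F"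
proof -
  obtain U0 R0 c0 d0 where 0: "U0 \<in> coord_ring F" "R0 \<in> coord_ring F" "d0 \<noteq> 0"
    "(X - emb F c0) * b = U0 + emb F d0 * (\<sigma> a * b)"
    "(X - emb F c0) * a = R0 + emb F d0 * (\<sigma> b + \<sigma> a * a)" by (rule x_expansion)
  have "scale Y (\<tau> (\<tau> s)) = \<iota> (tw_mult q (monom 1 2) (\<phi> Y))" unfolding \<tau>\<tau>s scale_Y ..
  then obtain U R c d where UR: "U \<in> coord_ring F" "R \<in> coord_ring F"
    and eq: "scale Y (\<tau> (\<tau> s)) =
      vec (U + emb F c * b + emb F d * (\<sigma> a * b)) (R + emb F c * a + emb F d * (\<sigma> b + \<sigma> a * a))"
    using normal_form_vec[of "tw_mult q (monom 1 2) (\<phi> Y)"] by auto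
  from eq have 1: "Y * b = U + emb F c * b + emb F d * (\<sigma> a * b)"
    and 2: "Y * a = R + emb F c * a + emb F d * (\<sigma> b + \<sigma> a * a)"
    unfolding vec_basis(3) vec_simps vec_eq_iff by auto
  define k where "k = d / d0"
  define e where "e = emb F k"
  have ed: "e * emb F d0 = emb F d" unfolding e_def k_def using 0(3) by (simp flip: emb_simps(4))
  have db: "emb F d * (\<sigma> a * b) = e * ((X - emb F c0) * b - U0)"
    unfolding 0(4) ed[symmetric] by (simp add: mult_ac)
  have da: "emb F d * (\<sigma> b + \<sigma> a * a) = e * ((X - emb F c0) * a - R0)"
    unfolding 0(5) ed[symmetric] by (simp add: mult_ac)
  have px: "px [:c - k * c0, k:] = emb F c + e * (X - emb F c0)"
    unfolding e_def by (simp add: emb_simps(3,4,6) algebra_simps)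
  have eR: "e \<in> coord_ring F" unfolding e_def by simp
  have "(Y - px [:c - k * c0, k:]) * a = R - e * R0"
    unfolding px using 2 unfolding da by (simp add: algebra_simps)
  moreover have "(Y - px [:c - k * c0, k:]) * b = U - e * U0"
    unfolding px using 1 unfolding db by (simp add: algebra_simps)
  moreover have "R - e * R0 \<in> coord_ring F" "U - e * U0 \<in> coord_ring F" using UR 0 eR by simp_all
  ultimately show thesis using that[of "c - k * c0" k] by (simp only:)
qed

end

lemma (in drinfeld_motive) alternating_bilinear_simps:
  assumes "alternating_bilinear scale scale2 B"
  shows "B (y + y') z = B y z + B y' z" "B y (z + z') = B y z + B y z'"
    "B (scale g y) z = scale2 g (B y z)" "B y (scale g z) = scale2 g (B y z)" "B y y = 0"
    "B z y = - B y z"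
proof -
  have lin: "Vector_Spaces.linear scale scale2 (B x)" "Vector_Spaces.linear scale scale2 (\<lambda>y. B y x)" for x
    using assms unfolding alternating_bilinear_def by auto
  have add: "B (y + y') z = B y z + B y' z" "B y (z + z') = B y z + B y z'" for y y' z z'
    using lin[of z] lin[of y] unfolding Vector_Spaces.linear_iff by auto
  show "B (y + y') z = B y z + B y' z" "B y (z + z') = B y z + B y z'" by (rule add)+
  show "B (scale g y) z = scale2 g (B y z)" "B y (scale g z) = scale2 g (B y z)"
    using lin[of z] lin[of y] unfolding Vector_Spaces.linear_iff by auto
  have alt: "B y y = 0" for y using assms unfolding alternating_bilinear_def by simp
  show "B y y = 0" by (rule alt)
  have "(B y y + B z y) + (B y z + B z z) = 0" using alt[of "y + z"] unfolding add .
  then have "B y z + B z y = 0" unfolding alt by (simp add: add.commute)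
  then show "B z y = - B y z" by (simp add: eq_neg_iff_add_eq_0 add.commute)
qed

context motive_relation begin

lemma wedge_vec:
  assumes W: "exterior_square scale scale2 wedge"
  shows "wedge (vec g g') (vec k k') = scale2 (g * k' - g' * k) (wedge s (\<tau> s))"
proof -
  interpret W: vector_space scale2 using W unfolding exterior_square_def by blast
  have alt: "alternating_bilinear scale scale2 wedge" using W unfolding exterior_square_def by blast
  note bil = alternating_bilinear_simps[OF alt]
  show ?thesis
    unfolding vec_def bil(1-5) bil(6)[of "\<tau> s" s] by (simp add: W.scale_left_diff_distrib mult.commute)
qed

lemma wedge_scale_cancel:
  assumes W: "exterior_square scale scale2 wedge" and eq: "scale2 g (wedge s (\<tau> s)) = scale2 k (wedge s (\<tau> s))"
  shows "g = k"
proof -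
  interpret W: vector_space scale2 using W unfolding exterior_square_def by blast
  show ?thesis using eq exterior_square_wedge_nonzero[OF W] by (simp add: W.scale_cancel_right)
qed

text \<open>
  The lattice is spanned by the three products of the generators \<open>s\<close>, \<open>\<tau> s\<close>, \<open>\<tau>\<^sup>2 s\<close>, which are
  \<open>1\<close>, \<open>a\<close> and \<open>- b\<close> times the product of the first two.
\<close>

lemma wedge_lattice_elements:
  assumes W: "exterior_square scale scale2 wedge" and z: "z \<in> wedge_lattice \<iota> wedge"
  shows "\<exists>u \<in> coord_ring F. \<exists>v \<in> coord_ring F. \<exists>w \<in> coord_ring F.
    z = scale2 (u + v * a + w * b) (wedge s (\<tau> s))"
proof -
  interpret W: vector_space scale2 using W unfolding exterior_square_def by blast
  define G where "G = {u + v * a + w * b | u v w. u \<in> coord_ring F \<and> v \<in> coord_ring F \<and> w \<in> coord_ring F}"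
  have G_add: "g + k \<in> G" if gk: "g \<in> G" "k \<in> G" for g k
  proof -
    obtain u v w where 1: "u \<in> coord_ring F" "v \<in> coord_ring F" "w \<in> coord_ring F" "g = u + v * a + w * b"
      using gk(1) unfolding G_def by auto
    obtain u' v' w' where 2: "u' \<in> coord_ring F" "v' \<in> coord_ring F" "w' \<in> coord_ring F" "k = u' + v' * a + w' * b"
      using gk(2) unfolding G_def by auto
    have "g + k = (u + u') + (v + v') * a + (w + w') * b" unfolding 1 2 by (simp add: algebra_simps)
    then show ?thesis unfolding G_def using 1 2 coord_ring_add by blast
  qed
  have G_wedge: "\<exists>g \<in> G. wedge (\<iota> \<omega>) (\<iota> \<psi>) = scale2 g (wedge s (\<tau> s))" for \<omega> \<psi>
  proof -
    obtain U R r where 1: "U \<in> coord_ring F" "R \<in> coord_ring F" "r \<in> coord_ring F"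
      "\<iota> \<omega> = vec (U + r * b) (R + r * a)" using motive_generated[of \<omega>] by auto
    obtain U' R' r' where 2: "U' \<in> coord_ring F" "R' \<in> coord_ring F" "r' \<in> coord_ring F"
      "\<iota> \<psi> = vec (U' + r' * b) (R' + r' * a)" using motive_generated[of \<psi>] by auto
    have eq: "(U + r * b) * (R' + r' * a) - (R + r * a) * (U' + r' * b) =
        (U * R' - R * U') + (U * r' - r * U') * a + (r * R' - R * r') * b"
      by (simp add: algebra_simps)
    have "(U * R' - R * U') + (U * r' - r * U') * a + (r * R' - R * r') * b \<in> G"
      unfolding G_def using 1 2 coord_ring_diff coord_ring_mult by blast
    moreover have "wedge (\<iota> \<omega>) (\<iota> \<psi>) = scale2 ((U * R' - R * U') + (U * r' - r * U') * a + (r * R' - R * r') * b) (wedge s (\<tau> s))"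
      unfolding 1(4) 2(4) wedge_vec[OF W] eq ..
    ultimately show ?thesis by blast
  qed
  have zero: "0 \<in> G"
  proof -
    have "0 = 0 + 0 * a + 0 * b" by simp
    then show ?thesis unfolding G_def using coord_ring_closed(6) by blast
  qed
  have sums: "\<exists>g \<in> G. (\<Sum>i<n. wedge (\<iota> (\<omega> i)) (\<iota> (\<psi> i))) = scale2 g (wedge s (\<tau> s))" for n :: nat and \<omega> \<psi>
  proof (induction n)
    case 0
    then show ?case using zero by (intro bexI[of _ 0]) auto
  next
    case (Suc n)
    then obtain g where g: "g \<in> G" "(\<Sum>i<n. wedge (\<iota> (\<omega> i)) (\<iota> (\<psi> i))) = scale2 g (wedge s (\<tau> s))" by blast
    obtain k where k: "k \<in> G" "wedge (\<iota> (\<omega> n)) (\<iota> (\<psi> n)) = scale2 k (wedge s (\<tau> s))" using G_wedge by blast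
    show ?case using G_add[OF g(1) k(1)] g(2) k(2)
      by (intro bexI[of _ "g + k"]) (simp_all add: W.scale_left_distrib)
  qed
  obtain n :: nat and \<omega> \<psi> where "z = (\<Sum>i<n. wedge (\<iota> (\<omega> i)) (\<iota> (\<psi> i)))"
    using z unfolding wedge_lattice_def mem_Collect_eq by blast
  then obtain g where "g \<in> G" "z = scale2 g (wedge s (\<tau> s))" using sums[of \<omega> \<psi> n] by auto
  then show ?thesis unfolding G_def by blast
qed

end

section \<open>The action of \<open>\<tau>\<close> on the second basis vector\<close>

lemma (in weierstrass_field) monic_quadratic_eq_if_divides:
  assumes "px [:k0, k1, 1:] * (Y + px p) = px [:n0, n1, 1:] * el u v"
  shows "[:k0, k1, 1:] = [:n0, n1, 1:]"
proof -
  let ?c = "[:k0, k1, 1:]" and ?n = "[:n0, n1, 1:]"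
  have "px ?c * (Y + px p) = el (?c * p) ?c"
    unfolding el_px px_mult by (simp only: algebra_simps)
  moreover have "px ?n * el u v = el (?n * u) (?n * v)"
    unfolding el_px px_mult by (simp only: algebra_simps)
  ultimately have eq: "?c = ?n * v" using assms el_eq_iff by metis
  then have v0: "v \<noteq> 0" by auto
  have "degree ?c = 2" "degree ?n = 2" by simp_all
  moreover have "degree (?n * v) = degree ?n + degree v" using v0 by (intro degree_mult_eq) auto
  ultimately have "degree v = 0" using eq by (metis add_cancel_right_right)
  then obtain k where k: "v = [:k:]" by (auto elim!: degree_eq_zeroE)
  show ?thesis using eq unfolding k by simp
qed

lemma (in drinfeld_motive) twist_px_linear: "twist q F (px [:u, v:]) = px [:u ^ q, v ^ q:]"
  by (simp add: twist_simps)

text \<open>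
  Here \<open>y - l(x)\<close> is the line with slope \<open>\<kappa>\<close>, \<open>D = y + p(x)\<close>, which is \<open>C1'\<close>, defines its image
  under negation, and \<open>N\<close> is the quadratic polynomial vanishing at the poles of \<open>h\<close>, so that
  \<open>h = D / N\<close>. The functions \<open>f\<close> and \<open>1 / h\<close> have the same two possible poles \<open>V\<close> and \<open>\<infinity>\<close>, and \<open>\<nu>\<close>
  is their difference.
\<close>

locale attached_line = motive_relation +
  fixes h f :: 'b and l p N :: "'a poly" and l0 l1 p0 p1 n0 n1 d0 d1 d2 \<alpha> \<gamma> \<mu> \<nu> :: 'a
  assumes h_line: "h * (Y - px l) = X - emb F \<alpha>"
    and l: "l = [:l0, l1:]" and p: "p = [:p0, p1:]" and N: "N = [:n0, n1, 1:]" and r1: "r1 = [:d0, d1, d2:]"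
    and p_l: "p = l + weier_lin E"
    and norm: "weier_cubic E - l * p = [:- \<alpha>, 1:] * N"
    and f_h: "f * h = 1 + emb F \<nu> * h"
    and h_b: "\<sigma> h * b = f * h"
    and b_h: "b = (X + emb F \<gamma>) * h - emb F \<mu>"
    and h_gen: "\<exists>u \<in> coord_ring F. \<exists>v \<in> coord_ring F. \<exists>w \<in> coord_ring F. h = u + v * a + w * b"
begin

abbreviation "D \<equiv> Y + px p"

lemma X_\<alpha>: "X - emb F \<alpha> = px [:- \<alpha>, 1:]" "px [:- \<alpha>, 1:] \<noteq> 0"
  unfolding px_eq_0_iff by (simp_all add: emb_simps)

lemma line_times_conjugate: "(Y - px k) * D = el (weier_cubic E - k * p) (l - k)"
proof -
  have "(Y - px k) * D = Y\<^sup>2 + (px p - px k) * Y - px k * px p"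
    by (simp add: algebra_simps power2_eq_square)
  also have "\<dots> = el (weier_cubic E - k * p) (l - k)"
    unfolding weierstrass_eq el_px p_l by (simp add: px_simps algebra_simps)
  finally show ?thesis .
qed

lemma line_nonzero: "Y - px l \<noteq> 0"
  using h_line X_\<alpha> by auto

lemma h_times_N: "h * px N = D"
proof -
  have "(Y - px l) * D = (X - emb F \<alpha>) * px N"
    unfolding line_times_conjugate norm X_\<alpha>(1) el_px px_mult by simp
  then have "(Y - px l) * D = (Y - px l) * (h * px N)" unfolding h_line[symmetric] by (simp add: mult_ac)
  then show ?thesis by (rule mult_left_cancel[OF line_nonzero, THEN iffD1, symmetric])
qed

text \<open>
  This is how the structure of the motive restricts \<open>a\<close> and \<open>b\<close>: their common denominators are
  denominators of \<open>h\<close>, as \<open>h\<close> is a combination of \<open>1\<close>, \<open>a\<close> and \<open>b\<close>.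
\<close>

lemma mult_h_in:
  assumes "g \<in> coord_ring F" "g * a \<in> coord_ring F" "g * b \<in> coord_ring F"
  shows "g * h \<in> coord_ring F"
proof -
  obtain u v w where 1: "u \<in> coord_ring F" "v \<in> coord_ring F" "w \<in> coord_ring F" "h = u + v * a + w * b"
    using h_gen by auto
  have "g * h = g * u + v * (g * a) + w * (g * b)" unfolding 1(4) by (simp add: algebra_simps)
  then show ?thesis using assms 1(1-3) by simp
qed

text \<open>
  So \<open>C2\<close> is a denominator of \<open>h = D / N\<close>. As \<open>D\<close> has the coefficient 1 at \<open>y\<close>, it follows that
  \<open>N\<close> divides \<open>C2\<close>, and both are monic of degree 2.
\<close>

lemma c2_eq: "c2 = N"
proof -
  have "px c2 * h \<in> coord_ring F" using c2_a c2_b by (intro mult_h_in) simp_all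
  then obtain u v where uv: "px c2 * h = el u v" unfolding coord_ring_iff by blast
  have "px c2 * D = px N * el u v" unfolding h_times_N[symmetric] uv[symmetric] by (simp add: mult_ac)
  then show ?thesis unfolding c2 N by (rule monic_quadratic_eq_if_divides)
qed

lemma h_c2: "h * px c2 = D"
  unfolding c2_eq by (rule h_times_N)

text \<open>
  The line in \<open>y_relation\<close> is a denominator of \<open>h\<close>, too. There is only one such line with
  coefficient 1 at \<open>y\<close>, as two of them differ by a linear polynomial in \<open>x\<close>, which is not
  divisible by \<open>N\<close> unless it is zero.
\<close>

lemma line_mult_a: "(Y - px l) * a \<in> coord_ring F"
proof -
  obtain k0 k1 where k: "(Y - px [:k0, k1:]) * a \<in> coord_ring F" "(Y - px [:k0, k1:]) * b \<in> coord_ring F"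
    by (rule y_relation)
  define k where "k = [:k0, k1:]"
  note k = k[folded k_def]
  have "(Y - px k) * h \<in> coord_ring F" using k by (intro mult_h_in) simp_all
  then obtain u v where uv: "(Y - px k) * h = el u v" unfolding coord_ring_iff by blast
  have "el (weier_cubic E - k * p) (l - k) = px c2 * el u v"
    unfolding line_times_conjugate[symmetric] h_c2[symmetric] uv[symmetric] by (simp add: mult_ac)
  also have "\<dots> = el (c2 * u) (c2 * v)" unfolding el_px px_mult by (simp only: algebra_simps)
  finally have eq: "l - k = c2 * v" unfolding el_eq_iff by blast
  have "v = 0"
  proof (rule ccontr)
    assume "v \<noteq> 0"
    then have "degree (c2 * v) \<ge> 2" unfolding c2 by (subst degree_mult_eq) auto
    then show False unfolding eq[symmetric] unfolding l k_def by (auto split: if_splits)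
  qed
  then have "l = k" using eq by simp
  then show ?thesis using k(1) by simp
qed

text \<open>
  The denominators \<open>C2\<close> and \<open>y - l(x)\<close> leave no other poles to \<open>a\<close> than the two of \<open>h\<close>;
  subtracting \<open>lam1 h + d2\<close> makes the numerator a linear polynomial in \<open>x\<close>, and this is divisible
  by \<open>N\<close> only if it is zero.
\<close>

lemma a_eq: "a = emb F lam1 * h + emb F d2"
proof -
  obtain n v where nv: "(Y - px l) * a = el n v" using line_mult_a unfolding coord_ring_iff by blast
  have Dl: "D * (Y - px l) = px [:- \<alpha>, 1:] * px c2"
    unfolding h_c2[symmetric] X_\<alpha>(1)[symmetric] h_line[symmetric] by (simp add: mult_ac)
  \<comment> \<open>\<open>j\<close> is the numerator of \<open>a - lam1 h - d2\<close>, and \<open>n' + v' y\<close> is \<open>(y - l(x))\<close> times that function.\<close>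
  define j where "j = r1 - smult d2 c2 - smult lam1 p"
  define n' where "n' = n + smult d2 l - smult lam1 [:- \<alpha>, 1:]"
  define v' where "v' = v - [:d2:]"
  have "px [:- \<alpha>, 1:] * (px c2 * a) = D * el n v"
    unfolding nv[symmetric] using Dl by (simp add: mult_ac)
  then have 1: "px [:- \<alpha>, 1:] * el r1 [:lam1:] = D * el n v" unfolding c2_a .
  have "px [:- \<alpha>, 1:] * px j = px [:- \<alpha>, 1:] * el r1 [:lam1:] - emb F d2 * (px [:- \<alpha>, 1:] * px c2)
      - emb F lam1 * px [:- \<alpha>, 1:] * D"
    unfolding j_def by (simp add: el_px px_add px_diff px_smult algebra_simps)
  also have "\<dots> = D * el n v - emb F d2 * (D * (Y - px l)) - emb F lam1 * px [:- \<alpha>, 1:] * D"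
    unfolding 1 Dl ..
  also have "\<dots> = D * el n' v'"
    unfolding n'_def v'_def el_px px_add px_diff px_smult by (simp add: algebra_simps)
  also have "\<dots> = el p 1 * el n' v'" by (simp add: el_px add.commute)
  finally have "el ([:- \<alpha>, 1:] * j) 0 = el p 1 * el n' v'" by (simp only: el_px px_mult px_0) simp
  then have 2: "[:- \<alpha>, 1:] * j = p * n' + v' * weier_cubic E" "0 = p * v' + n' - v' * weier_lin E"
    unfolding el_mult el_eq_iff by simp_all
  have n': "n' = - (l * v')" using 2(2) unfolding p_l by (simp add: algebra_simps eq_neg_iff_add_eq_0)
  have "[:- \<alpha>, 1:] * j = v' * (weier_cubic E - l * p)" unfolding 2(1) n' by (simp add: algebra_simps)
  also have "\<dots> = [:- \<alpha>, 1:] * (v' * c2)" unfolding norm c2_eq by (simp only: mult_ac)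
  finally have j: "j = v' * c2" by (simp only: mult_cancel_left) auto
  have "v' = 0"
  proof (rule ccontr)
    assume "v' \<noteq> 0"
    then have "degree (v' * c2) \<ge> 2" unfolding c2 by (subst degree_mult_eq) auto
    then show False unfolding j[symmetric] unfolding j_def r1 c2 p by (auto split: if_splits)
  qed
  then have "j = 0" using j by simp
  then have r1': "r1 = smult d2 c2 + smult lam1 p" unfolding j_def by (simp add: algebra_simps)
  have "px c2 * a = px c2 * (emb F lam1 * h + emb F d2)"
  proof -
    have "px c2 * a = emb F d2 * px c2 + emb F lam1 * D"
      unfolding c2_a el_px r1' px_add px_smult by (simp add: algebra_simps)
    then show ?thesis unfolding h_c2[symmetric] by (simp add: algebra_simps)
  qed
  moreover have "px c2 \<noteq> 0" unfolding px_eq_0_iff c2 by simp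
  ultimately show ?thesis by simp
qed

text \<open>
  Substituting \<open>a = lam1 h + d2\<close> and \<open>b = (x + \<gamma>) h - \<mu>\<close>, and using \<open>D = C2 h\<close>, the claim becomes
  \<open>C2\<^sup>(\<^sup>1\<^sup>) = \<rho> \<mu> + (x + \<gamma>) (x + \<epsilon>)\<close>. This follows from three equations between polynomials in
  \<open>x\<close>. Two of them express that the coefficients of \<open>s\<close> and \<open>\<tau> s\<close> in \<open>x \<tau>\<^sup>2 s\<close> have the form given
  by \<open>x_expansion\<close>, the third one is the relation \<open>h\<^sup>(\<^sup>1\<^sup>) b = f h\<close>. Eliminating between them
  makes both sides of the claim appear multiplied by \<open>C2\<close>, so common zeros of \<open>C2\<close> and \<open>C2\<^sup>(\<^sup>1\<^sup>)\<close>
  do no harm.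
\<close>

lemma tau_second_coefficient:
  "(X + emb F \<gamma>) * (\<sigma> h * (emb F (lam1 ^ q) * a + X + emb F (\<gamma> ^ q))) =
    emb F (lam1 ^ (q + 1)) * (f * h) + \<sigma> D"
proof -
  obtain U R c d where UR: "U \<in> coord_ring F" "R \<in> coord_ring F"
    and U: "(X - emb F c) * b = U + emb F d * (\<sigma> a * b)"
    and R: "(X - emb F c) * a = R + emb F d * (\<sigma> b + \<sigma> a * a)" by (rule x_expansion)
  define z where "z = - (c + d * d2 ^ q)"
  define \<rho> where "\<rho> = lam1 ^ (q + 1)"
  define \<epsilon> where "\<epsilon> = \<gamma> ^ q + lam1 ^ q * d2"
  define c2' where "c2' = [:c0 ^ q, c1 ^ q, 1:]"
  define p' where "p' = [:p0 ^ q, p1 ^ q:]"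
  define P where "P = p + p' - weier_lin E"
  have emb_z: "X - emb F c = (X + emb F z) + emb F d * emb F (d2 ^ q)"
    unfolding z_def by (simp add: emb_simps(3-6))
  have \<sigma>a: "\<sigma> a = emb F (lam1 ^ q) * \<sigma> h + emb F (d2 ^ q)"
    unfolding a_eq by (simp only: is_field_hom_simps(3,4)[OF twist_hom] twist_emb)
  have \<sigma>b: "\<sigma> b = (X + emb F (\<gamma> ^ q)) * \<sigma> h - emb F (\<mu> ^ q)"
    unfolding b_h by (simp only: is_field_hom_simps(3,4,6)[OF twist_hom] twist_emb twist_X)
  have \<sigma>c2: "\<sigma> (px c2) = px c2'"
    unfolding c2 c2'_def by (simp add: twist_simps emb_simps(2))
  have \<sigma>D: "\<sigma> D = Y + px p'"
    unfolding p p'_def by (simp only: is_field_hom_simps(3)[OF twist_hom] twist_Y twist_px_linear)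
  have h_c2': "\<sigma> h * px c2' = Y + px p'"
    using arg_cong[OF h_c2, of \<sigma>] unfolding is_field_hom_simps(4)[OF twist_hom] \<sigma>c2 \<sigma>D .
  have DD: "(Y + px p') * D = el (weier_cubic E + p * p') P"
  proof -
    have "(Y + px p') * D = Y\<^sup>2 + (px p + px p') * Y + px p * px p'"
      by (simp add: algebra_simps power2_eq_square)
    then show ?thesis unfolding weierstrass_eq el_px P_def by (simp add: px_simps algebra_simps)
  qed
  \<comment> \<open>From the coefficient of \<open>s\<close>: the quadratic polynomial on the right is a denominator of \<open>h\<close>.\<close>
  have c2_quad: "c2 = [:z, 1:] * [:\<gamma>, 1:] - [:d * lam1 ^ q * \<nu>:]"
  proof -
    define Q where "Q = [:z * \<gamma> - d * lam1 ^ q * \<nu>, z + \<gamma>, 1:]"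
    have Q: "Q = [:z, 1:] * [:\<gamma>, 1:] - [:d * lam1 ^ q * \<nu>:]" unfolding Q_def by simp
    have pxQ: "px Q = (X + emb F z) * (X + emb F \<gamma>) - emb F (d * lam1 ^ q) * emb F \<nu>"
      unfolding Q px_diff px_mult by (simp add: emb_simps(2,4) add.commute)
    have "(X + emb F z) * b + emb F d * emb F (d2 ^ q) * b = U + emb F d * (\<sigma> a * b)"
      using U unfolding emb_z by (simp only: distrib_right)
    also have "\<sigma> a * b = emb F (lam1 ^ q) * (1 + emb F \<nu> * h) + emb F (d2 ^ q) * b"
      unfolding \<sigma>a f_h[symmetric] h_b[symmetric] by (simp only: distrib_right mult.assoc)
    finally have "(X + emb F z) * b = U + emb F (d * lam1 ^ q) * (1 + emb F \<nu> * h)"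
      unfolding emb_simps(4) by (simp add: algebra_simps)
    then have "px Q * h = U + emb F (d * lam1 ^ q) + (X + emb F z) * emb F \<mu>"
      unfolding pxQ b_h by (simp add: algebra_simps)
    also have "\<dots> \<in> coord_ring F" using UR by simp
    finally obtain u v where uv: "px Q * h = el u v" unfolding coord_ring_iff by blast
    have "px Q * D = px c2 * el u v" unfolding h_c2[symmetric] uv[symmetric] by (simp only: mult_ac)
    then show ?thesis unfolding Q[symmetric] unfolding Q_def c2
      by (rule monic_quadratic_eq_if_divides[symmetric])
  qed
  \<comment> \<open>From the coefficient of \<open>\<tau> s\<close>, first as an equation between functions, then for the coefficients of \<open>y\<close>
    after multiplication with \<open>C2\<close> and its twist. The remainder \<open>v\<close> disappears for reasons of degree.\<close>
  define R' where "R' = R - emb F (d * \<mu> ^ q) - (X + emb F z) * emb F d2"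
  have 2: "emb F lam1 * (X + emb F z) * h = emb F d * \<sigma> h * (emb F \<rho> * h + (X + emb F \<epsilon>)) + R'"
  proof -
    have "(X + emb F z) * a = R + emb F d * (\<sigma> b + emb F (lam1 ^ q) * \<sigma> h * a)"
      using R unfolding emb_z unfolding \<sigma>a by (simp add: algebra_simps)
    then have "(X + emb F z) * (emb F lam1 * h + emb F d2) = R + emb F d *
       ((X + emb F (\<gamma> ^ q)) * \<sigma> h - emb F (\<mu> ^ q) + emb F (lam1 ^ q) * \<sigma> h * (emb F lam1 * h + emb F d2))"
      unfolding \<sigma>b unfolding a_eq .
    then show ?thesis unfolding R'_def \<rho>_def \<epsilon>_def
      by (simp add: emb_simps(3,4) algebra_simps)
  qed
  obtain u v where uv: "R' = el u v" using UR unfolding R'_def by (metis coord_ring_iff coord_ring_closed(3,4) coord_ring_add coord_ring_diff coord_ring_mult)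
  have poly_eq: "smult lam1 ([:z, 1:] * c2') = smult d (smult \<rho> P + [:\<epsilon>, 1:] * c2) + v * (c2 * c2')"
  proof -
    have "emb F lam1 * (X + emb F z) * (h * px c2) * px c2' =
       emb F d * (\<sigma> h * px c2') * (emb F \<rho> * (h * px c2) + (X + emb F \<epsilon>) * px c2) + R' * (px c2 * px c2')"
      using arg_cong[OF 2, of "\<lambda>g. g * (px c2 * px c2')"] by (simp add: algebra_simps)
    then have "emb F lam1 * px [:z, 1:] * D * px c2' =
       emb F d * (emb F \<rho> * ((Y + px p') * D) + (Y + px p') * (px [:\<epsilon>, 1:] * px c2)) + R' * (px c2 * px c2')"
      unfolding h_c2 h_c2' by (simp add: emb_simps(2) algebra_simps)
    then have "el (smult lam1 ([:z, 1:] * c2') * p) (smult lam1 ([:z, 1:] * c2')) =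
       el (smult d (smult \<rho> (weier_cubic E + p * p') + [:\<epsilon>, 1:] * c2 * p') + u * (c2 * c2'))
          (smult d (smult \<rho> P + [:\<epsilon>, 1:] * c2) + v * (c2 * c2'))"
      unfolding DD uv unfolding el_px px_add px_mult px_smult by (simp only: algebra_simps)
    then show ?thesis unfolding el_eq_iff by blast
  qed
  obtain P0 P1 where P01: "P = [:P0, P1:]"
    unfolding P_def p p'_def weier_lin_def by simp
  have v0: "v = 0"
  proof (rule ccontr)
    assume "v \<noteq> 0"
    then have "degree (v * (c2 * c2')) = degree v + 4"
      unfolding c2 c2'_def by (simp add: degree_mult_eq del: mult_pCons_left mult_pCons_right)
    moreover have "v * (c2 * c2') = smult lam1 ([:z, 1:] * c2') - smult d (smult \<rho> P + [:\<epsilon>, 1:] * c2)"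
      using poly_eq by (simp only: algebra_simps)
    moreover have "degree (smult lam1 ([:z, 1:] * c2') - smult d (smult \<rho> P + [:\<epsilon>, 1:] * c2)) \<le> 3"
      unfolding P01 c2 c2'_def by (simp add: degree_diff_le)
    ultimately show False by simp
  qed
  have d: "d = lam1" using poly_eq unfolding v0 P01 c2 c2'_def by simp
  have F2: "[:z, 1:] * c2' = smult \<rho> P + [:\<epsilon>, 1:] * c2"
  proof -
    have "smult lam1 ([:z, 1:] * c2') = smult lam1 (smult \<rho> P + [:\<epsilon>, 1:] * c2)"
      using poly_eq unfolding v0 d by simp
    then show ?thesis using lam1 by (simp only: smult_cancel)
  qed
  \<comment> \<open>The coefficient of \<open>y\<close> in \<open>h\<^sup>(\<^sup>1\<^sup>) b = 1 + \<nu> h\<close>, multiplied with the same denominators.\<close>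
  have F3: "[:\<gamma>, 1:] * P = smult \<mu> c2 + smult \<nu> c2'"
  proof -
    have "(\<sigma> h * px c2') * ((X + emb F \<gamma>) * (h * px c2) - emb F \<mu> * px c2) = px c2' * (px c2 + emb F \<nu> * (h * px c2))"
      using arg_cong[OF h_b[unfolded f_h b_h], of "\<lambda>g. g * (px c2 * px c2')"] by (simp add: algebra_simps)
    then have "px [:\<gamma>, 1:] * ((Y + px p') * D) - emb F \<mu> * ((Y + px p') * px c2) = px c2' * (px c2 + emb F \<nu> * D)"
      unfolding h_c2 h_c2' by (simp add: emb_simps(2) algebra_simps)
    then have "el ([:\<gamma>, 1:] * (weier_cubic E + p * p') - smult \<mu> (p' * c2)) ([:\<gamma>, 1:] * P - smult \<mu> c2) =
        el (c2' * c2 + smult \<nu> (c2' * p)) (smult \<nu> c2')"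
      unfolding DD unfolding el_px px_add px_diff px_mult px_smult by (simp only: algebra_simps)
    then have "[:\<gamma>, 1:] * P - smult \<mu> c2 = smult \<nu> c2'" unfolding el_eq_iff by blast
    then show ?thesis by (simp only: algebra_simps)
  qed
  have c2'_eq: "c2' = [:\<rho> * \<mu>:] + [:\<gamma>, 1:] * [:\<epsilon>, 1:]"
  proof -
    have c2_\<rho>: "c2 = [:z, 1:] * [:\<gamma>, 1:] - [:\<rho> * \<nu>:]"
      unfolding c2_quad d \<rho>_def by (simp add: mult_ac)
    have "c2 * c2' = [:\<gamma>, 1:] * ([:z, 1:] * c2') - smult (\<rho> * \<nu>) c2'"
      unfolding c2_\<rho> by (simp only: left_diff_distrib mult_ac) (simp add: smult_diff_left)
    also have "\<dots> = smult \<rho> ([:\<gamma>, 1:] * P) + [:\<gamma>, 1:] * [:\<epsilon>, 1:] * c2 - smult (\<rho> * \<nu>) c2'"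
      unfolding F2 by (simp only: distrib_left mult_smult_left mult_smult_right mult_ac)
    also have "\<dots> = c2 * ([:\<rho> * \<mu>:] + [:\<gamma>, 1:] * [:\<epsilon>, 1:])"
      unfolding F3 by (simp only: distrib_left smult_add_right smult_smult mult_ac) simp
    finally have "c2 * c2' = c2 * ([:\<rho> * \<mu>:] + [:\<gamma>, 1:] * [:\<epsilon>, 1:])" .
    moreover have "c2 \<noteq> 0" unfolding c2 by simp
    ultimately show ?thesis by (simp only: mult_cancel_left) auto
  qed
  have "emb F (lam1 ^ q) * a + X + emb F (\<gamma> ^ q) = emb F \<rho> * h + (X + emb F \<epsilon>)"
    unfolding a_eq \<rho>_def \<epsilon>_def by (simp add: emb_simps(3,4) algebra_simps)
  then have "(X + emb F \<gamma>) * (\<sigma> h * (emb F (lam1 ^ q) * a + X + emb F (\<gamma> ^ q))) =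
      \<sigma> h * (emb F \<rho> * ((X + emb F \<gamma>) * h) + (X + emb F \<gamma>) * (X + emb F \<epsilon>))"
    by (simp add: algebra_simps)
  also have "\<dots> = emb F \<rho> * (\<sigma> h * b) + \<sigma> h * (emb F (\<rho> * \<mu>) + (X + emb F \<gamma>) * (X + emb F \<epsilon>))"
    unfolding b_h by (simp add: emb_simps(4) algebra_simps)
  also have "emb F (\<rho> * \<mu>) + (X + emb F \<gamma>) * (X + emb F \<epsilon>) = px c2'"
    unfolding c2'_eq px_add px_mult by (simp add: emb_simps(2) algebra_simps)
  finally show ?thesis unfolding h_c2' \<sigma>D h_b \<rho>_def .
qed

end

theorem theorem2:
  fixes q e :: nat
    and E :: "'l::alg_closed_field weierstrass"
    and F :: "('l, 'k::field) funfield"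
    and \<theta> \<eta> \<alpha> \<beta> m \<kappa> lam1 \<gamma>1 c0 c1 d0 d1 d2 e0 e1 e2 e3 e4 :: 'l
    and \<phi> :: "'k \<Rightarrow> 'l poly"
    and scale :: "'k \<Rightarrow> 'm::ab_group_add \<Rightarrow> 'm"
    and \<iota> :: "'l poly \<Rightarrow> 'm"
    and \<tau> :: "'m \<Rightarrow> 'm"
    and scale2 :: "'k \<Rightarrow> 'w::ab_group_add \<Rightarrow> 'w"
    and wedge :: "'m \<Rightarrow> 'm \<Rightarrow> 'w"
    and \<tau>2 :: "'w \<Rightarrow> 'w"
    and V V1 V2 :: "'l point"
    and f h C0 C1 C2 C1' :: 'k
    and s E1 E2 :: 'm
    and S0 :: 'w
  assumes q: "prime CHAR('l)" "e > 0" "q = CHAR('l) ^ e"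
    and E: "elliptic_curve_over (finite_subfield q) E"
    and \<xi>: "generic_point q E \<theta> \<eta>"
    and F: "function_field E F"
    and \<phi>: "drinfeld_module_rank2 q F \<theta> \<eta> \<phi>"
    and M: "generic_fibre q F \<phi> scale \<iota>"
    and s: "s = \<iota> 1"
    and \<tau>: "semilinear (twist q F) scale \<tau>" "\<And>\<omega>. \<tau> (\<iota> \<omega>) = \<iota> (tw_mult q tau \<omega>)"
    and W: "exterior_square scale scale2 wedge"
    and \<tau>2: "semilinear (twist q F) scale2 \<tau>2" "\<And>y z. \<tau>2 (wedge y z) = wedge (\<tau> y) (\<tau> z)"
    and V: "V = Aff \<alpha> \<beta>" "V \<in> points E"
           "point_add E V (point_neg E (point_frob q V)) = Aff \<theta> \<eta>"
    and m: "m = (\<beta> ^ q - neg_y E \<alpha> \<beta>) / (\<alpha> ^ q - \<alpha>)"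
    and f: "f = (fy F - emb F \<eta> - emb F m * (fx F - emb F \<theta>)) / (fx F - emb F \<alpha>)"
    and S0: "wedge_lattice \<iota> wedge = {scale2 g S0 | g. g \<in> inverse_ideal E F (pt V)}"
            "\<tau>2 S0 = scale2 (- f) S0"
    and h: "S0 = scale2 h (wedge s (\<tau> s))" "sign F h = 1"
    and V12: "has_divisor E F h (pt V + pt Infty - pt V1 - pt V2)" "point_add E V1 V2 = V"
    and \<kappa>: "has_divisor E F
              (fy F - emb F (neg_y E \<alpha> \<beta>) - emb F \<kappa> * (fx F - emb F \<alpha>))
              (pt (point_neg E V) + pt V1 + pt V2 - Poly_Mapping.single Infty 3)"
    and C2: "C2 = (fx F)\<^sup>2 + emb F c1 * fx F + emb F c0"
    and C1: "C1 = emb F d2 * (fx F)\<^sup>2 + emb F lam1 * fy F + emb F d1 * fx F + emb F d0"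
    and C0: "C0 = emb F e4 * (fx F * fy F) + emb F e3 * (fx F)\<^sup>2 + emb F e2 * fy F
                    + emb F e1 * fx F + emb F e0"
    and relation: "scale C2 (\<tau> (\<tau> s)) = scale C1 (\<tau> s) + scale C0 s"
    and lam1: "lam1 \<noteq> 0"
    and \<gamma>1: "\<gamma>1 = (\<kappa> ^ q + m + a1 E) * (m - \<kappa>) - \<theta>"
    and C1': "C1' = fy F + emb F (\<kappa> + a1 E) * (fx F - emb F \<alpha>) - emb F \<beta>"
    and E1: "E1 = s"
    and E2: "E2 = scale h (scale (emb F lam1) (\<tau> s) + scale (fx F + emb F \<gamma>1) s)"
  shows "\<tau> E1 = scale (1 / emb F lam1)
           (scale (- (fx F + emb F \<gamma>1)) E1 + scale (1 / h) E2) \<and>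
         \<tau> E2 = scale (1 / emb F lam1)
           (scale (- twist q F C1') E1 +
            scale (1 / (fx F + emb F \<gamma>1) *
                   (emb F (lam1 ^ (q + 1)) * f + twist q F C1' / h)) E2)"
proof -
  have q_pos: "q > 0" using q prime_gt_0_nat by simp
  have hom: "is_field_hom (\<lambda>c::'l. c ^ q)" by (rule frobenius_hom[OF q(1,3)])
  interpret weierstrass_field E F by unfold_locales (rule F)
  interpret drinfeld_motive E F q \<theta> \<eta> \<phi> scale \<iota> \<tau>
    by unfold_locales (use q_pos \<phi> M \<tau> in auto)
  have disc: "discriminant E \<noteq> 0" using E unfolding elliptic_curve_over_def by blast
  have curve: "on_curve E \<alpha> \<beta>" using V(1,2) unfolding points_def by auto
  note chord = frobenius_chord[OF hom E \<xi> curve V(3)[unfolded V(1)] m]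
  define l where "l = [:neg_y E \<alpha> \<beta> - \<kappa> * \<alpha>, \<kappa>:]"
  define l' where "l' = [:neg_y E (\<alpha> ^ q) (\<beta> ^ q) - \<kappa> ^ q * \<alpha> ^ q, \<kappa> ^ q:]"
  define p where "p = [:- (\<kappa> + a1 E) * \<alpha> - \<beta>, \<kappa> + a1 E:]"
  define g where "g = [:\<eta> - m * \<theta>, m:]"
  define \<mu> where "\<mu> = \<kappa> ^ q + m + a1 E"
  have line: "fy F - emb F (neg_y E \<alpha> \<beta>) - emb F \<kappa> * (fx F - emb F \<alpha>) = Y - px l"
    unfolding l_def by (simp add: emb_simps(1,4,6) algebra_simps)
  have h_frac: "h = (X - emb F \<alpha>) / (Y - px l)"
    by (rule function_of_line_divisor[OF disc curve V12(1)[unfolded V(1)] h(2)])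
      (use \<kappa> V(1) line in \<open>auto simp: l_def\<close>)
  have h0: "h \<noteq> 0" using V12(1) unfolding has_divisor_def by blast
  have l0: "Y - px l \<noteq> 0" using h0 unfolding h_frac by auto
  have h_line: "h * (Y - px l) = X - emb F \<alpha>" using l0 unfolding h_frac by simp
  have X\<alpha>: "X - emb F c \<noteq> 0" for c
  proof -
    have "X - emb F c = px [:- c, 1:]" by (simp add: emb_simps)
    then show ?thesis by (simp only: px_eq_0_iff) simp
  qed
  have f': "f = (Y - px g) / (X - emb F \<alpha>)"
    unfolding f g_def by (simp add: emb_simps(1,4,6) algebra_simps)
  \<comment> \<open>Chord and line both pass through the inverse of \<open>V\<close>, so they differ by a multiple of \<open>x - \<alpha>\<close>.\<close>
  have f_h: "f * h = 1 + emb F (\<kappa> - m) * h"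
  proof -
    have "g = l - smult (\<kappa> - m) [:- \<alpha>, 1:]"
      unfolding g_def l_def chord(2) by (simp add: algebra_simps)
    then have "px g = px l - emb F (\<kappa> - m) * (X - emb F \<alpha>)"
      by (simp add: px_diff px_smult emb_simps del: smult_pCons)
    then have "(f * h) * (Y - px l) = (Y - px l) + emb F (\<kappa> - m) * (h * (Y - px l))"
      using l0 X\<alpha>[of \<alpha>] unfolding h_line f' h_frac by simp
    then have "(f * h) * (Y - px l) = (1 + emb F (\<kappa> - m) * h) * (Y - px l)"
      by (simp only: distrib_right mult_1_left mult.assoc)
    then show ?thesis by (rule mult_right_cancel[OF l0, THEN iffD1])
  qed
  define c2 where "c2 = [:c0, c1, 1:]"
  define r1 where "r1 = [:d0, d1, d2:]"
  have C2': "C2 = px c2" and C1_el: "C1 = el r1 [:lam1:]"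
    unfolding C2 C1 c2_def r1_def by (simp_all add: el_px emb_simps(1,2) algebra_simps power2_eq_square)
  have C20: "C2 \<noteq> 0" unfolding C2' px_eq_0_iff c2_def by simp
  have C0_in: "C0 \<in> coord_ring F" unfolding C0 by simp
  define a where "a = C1 / C2"
  define b where "b = C0 / C2"
  interpret motive_relation E F q \<theta> \<eta> \<phi> scale \<iota> \<tau> a b c2 r1 c0 c1 lam1
  proof
    have "scale (1 / C2) (scale C2 (\<tau> (\<tau> s))) = scale (1 / C2) (scale C1 (\<tau> s) + scale C0 s)"
      unfolding relation ..
    then show "\<tau> (\<tau> (\<iota> 1)) = scale b (\<iota> 1) + scale a (\<tau> (\<iota> 1))"
      using C20 unfolding s a_def b_def by (simp add: scale_right_distrib add.commute)
    show "px c2 * a = el r1 [:lam1:]" using C20 unfolding a_def C2'[symmetric] C1_el[symmetric] by simp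
    show "px c2 * b \<in> coord_ring F" using C20 C0_in unfolding b_def C2'[symmetric] by simp
  qed (use lam1 c2_def in auto)
  note S0' = h(1)[unfolded s]
  \<comment> \<open>This is \<open>\<tau> S0 = - f S0\<close>, evaluated on \<open>\<tau> s\<close> and \<open>\<tau>\<^sup>2 s\<close>.\<close>
  have h_b: "\<sigma> h * b = f * h"
  proof -
    have w2: "vector_space scale2" using W unfolding exterior_square_def by blast
    interpret W: vector_space scale2 by (rule w2)
    have "\<tau>2 S0 = scale2 (\<sigma> h) (wedge (\<tau> (\<iota> 1)) (\<tau> (\<tau> (\<iota> 1))))"
      using \<tau>2 unfolding S0' semilinear_def by simp
    also have "\<dots> = scale2 (\<sigma> h * (- b)) (wedge (\<iota> 1) (\<tau> (\<iota> 1)))"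
      unfolding vec_basis(3) unfolding vec_basis(2) wedge_vec[OF W] unfolding vec_basis(2)[symmetric]
      by simp
    finally have "\<tau>2 S0 = scale2 (\<sigma> h * (- b)) (wedge (\<iota> 1) (\<tau> (\<iota> 1)))" .
    moreover have "\<tau>2 S0 = scale2 (- f * h) (wedge (\<iota> 1) (\<tau> (\<iota> 1)))"
      unfolding S0(2) unfolding S0' by simp
    ultimately have "scale2 (\<sigma> h * (- b)) (wedge (\<iota> 1) (\<tau> (\<iota> 1))) = scale2 (- f * h) (wedge (\<iota> 1) (\<tau> (\<iota> 1)))"
      by (rule trans[OF sym])
    then have "\<sigma> h * (- b) = - f * h" by (rule wedge_scale_cancel[OF W])
    then show ?thesis by simp
  qed
  have \<sigma>_line: "\<sigma> h * (Y - px l') = X - emb F (\<alpha> ^ q)"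
  proof -
    have "(neg_y E \<alpha> \<beta> - \<kappa> * \<alpha>) ^ q = neg_y E (\<alpha> ^ q) (\<beta> ^ q) - \<kappa> ^ q * \<alpha> ^ q"
      by (simp only: is_field_hom_simps(4,6)[OF hom] chord(6))
    then have "\<sigma> (px l) = px l'"
      unfolding l_def l'_def twist_px_linear by simp
    then show ?thesis
      using arg_cong[OF h_line, of \<sigma>] by (simp only: is_field_hom_simps(4,6)[OF twist_hom] twist_emb twist_X twist_Y)
  qed
  note chord_poly = chord_times_twisted_line[OF curve chord(5,1,2,3,4) \<mu>_def
      \<gamma>1[folded \<mu>_def], folded g_def l_def l'_def]
  have b_h: "b = (X + emb F \<gamma>1) * h - emb F \<mu>"
  proof -
    have "(Y - px g) * (Y - px l') = px (weier_cubic E + g * l') - px (weier_lin E + g + l') * Y"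
    proof -
      have "(Y - px g) * (Y - px l') = Y\<^sup>2 - (px g + px l') * Y + px g * px l'"
        by (simp add: algebra_simps power2_eq_square)
      then show ?thesis unfolding weierstrass_eq px_simps by (simp add: algebra_simps)
    qed
    also have "\<dots> = (X - emb F (\<alpha> ^ q)) * ((X + emb F \<gamma>1) * (X - emb F \<alpha>) - emb F \<mu> * (Y - px l))"
      unfolding chord_poly px_mult px_add px_smult by (simp add: emb_simps(2,5) algebra_simps)
    finally have 1: "(Y - px g) * (Y - px l') =
        (X - emb F (\<alpha> ^ q)) * ((X + emb F \<gamma>1) * (X - emb F \<alpha>) - emb F \<mu> * (Y - px l))" .
    have "(f * h) * (Y - px l) = Y - px g"
      using l0 X\<alpha>[of \<alpha>] unfolding f' h_frac by simp
    then have "(Y - px g) * (Y - px l') = (\<sigma> h * (Y - px l')) * (b * (Y - px l))"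
      unfolding h_b[symmetric] by (simp add: mult_ac)
    then have "(X - emb F (\<alpha> ^ q)) * (b * (Y - px l)) =
        (X - emb F (\<alpha> ^ q)) * ((X + emb F \<gamma>1) * (X - emb F \<alpha>) - emb F \<mu> * (Y - px l))"
      unfolding \<sigma>_line 1 by (rule sym)
    then have "b * (Y - px l) = (X + emb F \<gamma>1) * (X - emb F \<alpha>) - emb F \<mu> * (Y - px l)"
      by (rule mult_left_cancel[OF X\<alpha>, THEN iffD1])
    then have "b * (Y - px l) = ((X + emb F \<gamma>1) * h - emb F \<mu>) * (Y - px l)"
      unfolding h_line[symmetric] by (simp only: left_diff_distrib mult.assoc)
    then show ?thesis by (rule mult_right_cancel[OF l0, THEN iffD1])
  qed
  \<comment> \<open>As \<open>V\<close> is an effective divisor, \<open>S0\<close> itself lies in the lattice.\<close>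
  have h_gen: "\<exists>u \<in> coord_ring F. \<exists>v \<in> coord_ring F. \<exists>w \<in> coord_ring F. h = u + v * a + w * b"
  proof -
    interpret W: vector_space scale2 using W unfolding exterior_square_def by blast
    have "1 \<in> inverse_ideal E F (pt V)"
      by (rule one_in_inverse_ideal[OF disc]) (simp add: lookup_single when_def)
    then have "scale2 1 S0 \<in> wedge_lattice \<iota> wedge" unfolding S0(1) by blast
    then have "S0 \<in> wedge_lattice \<iota> wedge" by simp
    from wedge_lattice_elements[OF W this] obtain u v w where "u \<in> coord_ring F" "v \<in> coord_ring F" "w \<in> coord_ring F"
      "S0 = scale2 (u + v * a + w * b) (wedge (\<iota> 1) (\<tau> (\<iota> 1)))"
      by blast
    then show ?thesis using wedge_scale_cancel[OF W] unfolding S0' by metis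
  qed
  obtain n0 n1 where norm: "weier_cubic E - l * p = [:- \<alpha>, 1:] * [:n0, n1, 1:]"
    using line_norm(2)[OF curve, of \<kappa>] unfolding l_def p_def by blast
  have p_l: "p = l + weier_lin E" unfolding l_def p_def by (rule line_norm(1)[OF curve])
  interpret attached_line E F q \<theta> \<eta> \<phi> scale \<iota> \<tau> a b c2 r1 c0 c1 lam1 h f l p "[:n0, n1, 1:]"
    "neg_y E \<alpha> \<beta> - \<kappa> * \<alpha>" \<kappa> "- (\<kappa> + a1 E) * \<alpha> - \<beta>" "\<kappa> + a1 E" n0 n1 d0 d1 d2 \<alpha> \<gamma>1 \<mu> "\<kappa> - m"
    by unfold_locales (fact h_line l_def p_def refl r1_def p_l norm f_h h_b b_h h_gen)+
  have C1'_D: "C1' = D"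
    unfolding C1' p_def by (simp add: emb_simps(1,3,4,5,6) algebra_simps)
  have lam0: "emb F lam1 \<noteq> 0" using lam1 by (simp add: emb_simps(9))
  have \<gamma>0: "X + emb F \<gamma>1 \<noteq> 0" using X\<alpha>[of "- \<gamma>1"] by (simp add: emb_simps(5))
  have E1v: "E1 = vec 1 0" unfolding E1 s by (rule vec_basis(1))
  have E2v: "E2 = vec (h * (X + emb F \<gamma>1)) (h * emb F lam1)"
    unfolding E2 s unfolding vec_def by (simp add: scale_right_distrib add.commute)
  have part1: "\<tau> E1 = scale (1 / emb F lam1) (scale (- (X + emb F \<gamma>1)) E1 + scale (1 / h) E2)"
    unfolding E1v E2v \<tau>_vec vec_simps vec_eq_iff using lam0 h0 by (simp add: twist_simps)
  have part2: "\<tau> E2 = scale (1 / emb F lam1) (scale (- \<sigma> D) E1 +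
      scale (1 / (X + emb F \<gamma>1) * (emb F (lam1 ^ (q + 1)) * f + \<sigma> D / h)) E2)"
    unfolding E1v E2v \<tau>_vec vec_simps vec_eq_iff
  proof
    have \<sigma>: "\<sigma> (h * emb F lam1) = \<sigma> h * emb F lam1 ^ q"
      "\<sigma> (h * (X + emb F \<gamma>1)) = \<sigma> h * (X + emb F (\<gamma>1 ^ q))"
      by (simp_all only: is_field_hom_simps(3,4)[OF twist_hom] twist_emb twist_X emb_simps(8))
    define d where "d = \<sigma> D"
    have lam_q: "emb F (lam1 ^ (q + 1)) = emb F lam1 * emb F lam1 ^ q" by (simp add: emb_simps(4,8))
    have "1 / emb F lam1 * (- d * 1 + 1 / (X + emb F \<gamma>1) * (emb F (lam1 ^ (q + 1)) * f + d / h) * (h * (X + emb F \<gamma>1)))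
        = 1 / emb F lam1 * (emb F (lam1 ^ (q + 1)) * (f * h))"
    proof -
      have "1 / x * (k * f + d / h) * (h * x) = k * (f * h) + d" if "x \<noteq> 0" for x k :: 'k
        using that h0 by (simp add: field_simps)
      then show ?thesis using \<gamma>0 by simp
    qed
    also have "\<dots> = emb F lam1 ^ q * (f * h)" using lam0 unfolding lam_q by simp
    finally show "\<sigma> (h * emb F lam1) * b = 1 / emb F lam1 * (- \<sigma> D * 1 + 1 / (X + emb F \<gamma>1) *
        (emb F (lam1 ^ (q + 1)) * f + \<sigma> D / h) * (h * (X + emb F \<gamma>1)))"
      unfolding \<sigma> d_def h_b[symmetric] by (simp add: mult_ac)
    have "(X + emb F \<gamma>1) * (\<sigma> (h * (X + emb F \<gamma>1)) + \<sigma> (h * emb F lam1) * a) =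
        (X + emb F \<gamma>1) * (\<sigma> h * (emb F (lam1 ^ q) * a + X + emb F (\<gamma>1 ^ q)))"
      unfolding \<sigma> by (simp add: emb_simps(8) algebra_simps)
    also have "\<dots> = emb F (lam1 ^ (q + 1)) * (f * h) + d"
      unfolding d_def by (rule tau_second_coefficient)
    finally have "\<sigma> (h * (X + emb F \<gamma>1)) + \<sigma> (h * emb F lam1) * a =
        (emb F (lam1 ^ (q + 1)) * (f * h) + d) / (X + emb F \<gamma>1)"
      using \<gamma>0 by (simp add: nonzero_eq_divide_eq mult.commute)
    also have "\<dots> = 1 / emb F lam1 * (- d * 0 + 1 / (X + emb F \<gamma>1) * (emb F (lam1 ^ (q + 1)) * f + d / h) * (h * emb F lam1))"
    proof -
      have "(k * (f * h) + d) / x = 1 / y * (- d * 0 + 1 / x * (k * f + d / h) * (h * y))"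
        if "x \<noteq> 0" "y \<noteq> 0" for x y k :: 'k
        using that h0 by (simp add: field_simps)
      then show ?thesis using \<gamma>0 lam0 by simp
    qed
    finally show "\<sigma> (h * (X + emb F \<gamma>1)) + \<sigma> (h * emb F lam1) * a =
        1 / emb F lam1 * (- \<sigma> D * 0 + 1 / (X + emb F \<gamma>1) *
        (emb F (lam1 ^ (q + 1)) * f + \<sigma> D / h) * (h * emb F lam1))"
      unfolding d_def .
  qed
  show ?thesis using part1 part2 unfolding C1'_D by blast
qed

end
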